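(* Let $m\ge 2$ be an integer. Suppose that the bilinear form $B$ is continuous and coercive on $V=H_0^1(\Omega)$, i.e. there are constants $\alpha,\beta>0$ with $|B(u,v)|\le \alpha\|u\|_{H^1(\Omega)}\|v\|_{H^1(\Omega)}$ and $\beta\|u\|_{H^1(\Omega)}^2\le |B(u,u)|$ for all $u,v\in V$, and that $F$ is a continuous linear functional on $V$. Suppose that the finite element spaces $V_h$ have approximation order $m$, i.e. there is a constant $C_0$, independent of $h$, such that $$\|v-\mathcal{I}_h v\|_{H^1(\Omega)}\le C_0\,h^{m-1}|v|_{H^m(\Omega)}\qquad\text{for all } v\in H^m(\Omega)\cap H_0^1(\Omega).$$ Let $u_\theta$ be smooth on $\overline\Omega$ without zeros in $\overline\Omega$, let $V_h^*=\{w\,u_\theta : w\in V_h\}$, and let $u\in V\cap H^m(\Omega)$ satisfy $B(u,v)=F(v)$ for all $v\in V$. Then the unique solution $u_h^*\in V_h^*$ of the variational problem $$B(u_h^*,v)=F(v)\qquad\text{for all } v\in V_h^*$$ satisfies $$\|u-u_h^*\|_{H^1(\Omega)}\le C\,h^{m-1}\,\|u_\theta\|_{C_1(\Omega)}\,\Big|\frac{u}{u_\theta}\Big|_{H^m(\Omega)},$$ where $C>0$ is a constant independent of $h$, $u$ and $u_\theta$.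
   Context: $\Omega\subset\mathbb{R}^d$ is a bounded, sufficiently regular domain. The elliptic problem is $-\nabla\cdot(a\nabla u)+cu=f$ in $\Omega$, $u=0$ on $\partial\Omega$, with weak form on $V=H_0^1(\Omega)$ given by $B(u,v)=\int_\Omega a\nabla u\cdot\nabla v+c\,u\,v\,\mathrm{d}x$ and $F(v)=\int_\Omega f v\,\mathrm{d}x$. For each mesh size $h$, $\mathcal{T}^h$ is a subdivision of $\Omega$ and $V_h\subset H_0^1(\Omega)$ is the finite-dimensional (Lagrange) finite element space of functions in $H_0^1(\Omega)$ that are polynomials of a fixed degree on each element of $\mathcal{T}^h$; $\mathcal{I}_h$ is the global interpolator with values in $V_h$. $u_\theta:\overline\Omega\to\mathbb{R}$ is a given fixed function (in applications, the output of a trained neural network). $|\cdot|_{H^m(\Omega)}$ is the Sobolev seminorm consisting of the derivatives of order exactly $m$, and $\|g\|_{C_1(\Omega)}$ is the maximum of the sup norms over $\Omega$ of $g$ and its first-order partial derivatives. *)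

theory Defs
  imports "HOL-Analysis.Analysis"
begin

text \<open>
  Functions on the domain \<open>\<Omega>\<close> are total functions on \<open>real ^ 'd\<close>; their values outside \<open>\<Omega>\<close>
  (for \<open>u\<^sub>\<theta>\<close>: outside the closure of \<open>\<Omega>\<close>) are irrelevant.  Elements of Sobolev spaces are
  represented by functions, so that equality in these spaces is equality almost everywhere on \<open>\<Omega>\<close>.
\<close>

subsection \<open>Classical partial derivatives, smooth functions\<close>

definition partial_deriv :: "'d::finite \<Rightarrow> (real ^ 'd \<Rightarrow> real) \<Rightarrow> real ^ 'd \<Rightarrow> real" where
  "partial_deriv i f x = frechet_derivative f (at x) (axis i 1)"

fun iter_partial :: "'d::finite list \<Rightarrow> (real ^ 'd \<Rightarrow> real) \<Rightarrow> real ^ 'd \<Rightarrow> real" where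
  "iter_partial [] f = f"
| "iter_partial (i # is) f = partial_deriv i (iter_partial is f)"

text \<open>On an open set this is \<open>C\<^sup>\<infinity>\<close>: differentiability of all iterated partial derivatives entails
  their continuity.\<close>

definition smooth_in :: "(real ^ 'd::finite) set \<Rightarrow> (real ^ 'd \<Rightarrow> real) \<Rightarrow> bool" where
  "smooth_in S f \<longleftrightarrow> (\<forall>is. \<forall>x\<in>S. iter_partial is f differentiable (at x))"

text \<open>\<open>C\<^sup>\<infinity>\<close> on the closure of an open set \<open>\<Omega>\<close>: smooth in \<open>\<Omega>\<close>, with all derivatives extending
  continuously to the closure.\<close>

definition smooth_on_closure :: "(real ^ 'd::finite) set \<Rightarrow> (real ^ 'd \<Rightarrow> real) \<Rightarrow> bool" where
  "smooth_on_closure \<Omega> f \<longleftrightarrow>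
     continuous_on (closure \<Omega>) f \<and> smooth_in \<Omega> f \<and>
     (\<forall>is. \<exists>g. continuous_on (closure \<Omega>) g \<and> (\<forall>x\<in>\<Omega>. g x = iter_partial is f x))"

definition C1_norm :: "(real ^ 'd::finite) set \<Rightarrow> (real ^ 'd \<Rightarrow> real) \<Rightarrow> real" where
  "C1_norm \<Omega> g =
     Max (insert (SUP x\<in>\<Omega>. \<bar>g x\<bar>) (range (\<lambda>i. SUP x\<in>\<Omega>. \<bar>partial_deriv i g x\<bar>)))"

definition test_function :: "(real ^ 'd::finite) set \<Rightarrow> (real ^ 'd \<Rightarrow> real) \<Rightarrow> bool" where
  "test_function \<Omega> \<phi> \<longleftrightarrow>
     smooth_in UNIV \<phi> \<and> compact (closure {x. \<phi> x \<noteq> 0}) \<and> closure {x. \<phi> x \<noteq> 0} \<subseteq> \<Omega>"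

subsection \<open>Multi-indices and weak derivatives\<close>

type_synonym 'd multi_index = "'d \<Rightarrow> nat"

definition mi_order :: "'d::finite multi_index \<Rightarrow> nat" where
  "mi_order \<alpha> = (\<Sum>i\<in>UNIV. \<alpha> i)"

text \<open>The derivative for a multi-index; it is only applied to smooth functions, for which the order
  of differentiation (the choice of the list) does not matter.\<close>

definition multi_deriv :: "'d::finite multi_index \<Rightarrow> (real ^ 'd \<Rightarrow> real) \<Rightarrow> real ^ 'd \<Rightarrow> real" where
  "multi_deriv \<alpha> f = iter_partial (SOME is. \<forall>i. count_list is i = \<alpha> i) f"

definition locally_integrable :: "(real ^ 'd::finite) set \<Rightarrow> (real ^ 'd \<Rightarrow> real) \<Rightarrow> bool" where
  "locally_integrable \<Omega> u \<longleftrightarrow> (\<forall>K. compact K \<and> K \<subseteq> \<Omega> \<longrightarrow> set_integrable lebesgue K u)"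

definition has_weak_deriv ::
    "(real ^ 'd::finite) set \<Rightarrow> 'd multi_index \<Rightarrow> (real ^ 'd \<Rightarrow> real) \<Rightarrow> (real ^ 'd \<Rightarrow> real) \<Rightarrow> bool" where
  "has_weak_deriv \<Omega> \<alpha> u v \<longleftrightarrow>
     locally_integrable \<Omega> u \<and> locally_integrable \<Omega> v \<and>
     (\<forall>\<phi>. test_function \<Omega> \<phi> \<longrightarrow>
        (LINT x|lebesgue_on \<Omega>. u x * multi_deriv \<alpha> \<phi> x) =
        (-1) ^ mi_order \<alpha> * (LINT x|lebesgue_on \<Omega>. v x * \<phi> x))"

text \<open>Weak derivatives are unique up to null sets; this selects one.\<close>

definition weak_deriv ::
    "(real ^ 'd::finite) set \<Rightarrow> 'd multi_index \<Rightarrow> (real ^ 'd \<Rightarrow> real) \<Rightarrow> real ^ 'd \<Rightarrow> real" where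
  "weak_deriv \<Omega> \<alpha> u = (SOME v. has_weak_deriv \<Omega> \<alpha> u v)"

definition weak_grad ::
    "(real ^ 'd::finite) set \<Rightarrow> (real ^ 'd \<Rightarrow> real) \<Rightarrow> real ^ 'd \<Rightarrow> real ^ 'd" where
  "weak_grad \<Omega> u x = (\<chi> i. weak_deriv \<Omega> ((\<lambda>_. 0)(i := 1)) u x)"

subsection \<open>Sobolev spaces\<close>

definition L2_space :: "(real ^ 'd::finite) set \<Rightarrow> (real ^ 'd \<Rightarrow> real) set" where
  "L2_space \<Omega> = {u. u \<in> borel_measurable (lebesgue_on \<Omega>) \<and>
                    integrable (lebesgue_on \<Omega>) (\<lambda>x. (u x)\<^sup>2)}"

definition sobolev_space :: "nat \<Rightarrow> (real ^ 'd::finite) set \<Rightarrow> (real ^ 'd \<Rightarrow> real) set" where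
  "sobolev_space m \<Omega> =
     {u \<in> L2_space \<Omega>. \<forall>\<alpha>. mi_order \<alpha> \<le> m \<longrightarrow> (\<exists>v\<in>L2_space \<Omega>. has_weak_deriv \<Omega> \<alpha> u v)}"

definition sobolev_norm :: "nat \<Rightarrow> (real ^ 'd::finite) set \<Rightarrow> (real ^ 'd \<Rightarrow> real) \<Rightarrow> real" where
  "sobolev_norm m \<Omega> u =
     sqrt (\<Sum>\<alpha> | mi_order \<alpha> \<le> m. LINT x|lebesgue_on \<Omega>. (weak_deriv \<Omega> \<alpha> u x)\<^sup>2)"

definition sobolev_seminorm :: "nat \<Rightarrow> (real ^ 'd::finite) set \<Rightarrow> (real ^ 'd \<Rightarrow> real) \<Rightarrow> real" where
  "sobolev_seminorm m \<Omega> u =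
     sqrt (\<Sum>\<alpha> | mi_order \<alpha> = m. LINT x|lebesgue_on \<Omega>. (weak_deriv \<Omega> \<alpha> u x)\<^sup>2)"

text \<open>The closure of the test functions in \<open>H\<^sup>1\<close>.\<close>

definition H01 :: "(real ^ 'd::finite) set \<Rightarrow> (real ^ 'd \<Rightarrow> real) set" where
  "H01 \<Omega> = {u \<in> sobolev_space 1 \<Omega>.
     \<forall>\<epsilon>>0. \<exists>\<phi>. test_function \<Omega> \<phi> \<and> sobolev_norm 1 \<Omega> (\<lambda>x. u x - \<phi> x) < \<epsilon>}"

subsection \<open>The weak form of \<open>-div (a grad u) + c u = f\<close>\<close>

definition weak_integrand ::
    "(real ^ 'd::finite) set \<Rightarrow> (real ^ 'd \<Rightarrow> real) \<Rightarrow> (real ^ 'd \<Rightarrow> real) \<Rightarrow>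
     (real ^ 'd \<Rightarrow> real) \<Rightarrow> (real ^ 'd \<Rightarrow> real) \<Rightarrow> real ^ 'd \<Rightarrow> real" where
  "weak_integrand \<Omega> a c u v x =
     a x * (weak_grad \<Omega> u x \<bullet> weak_grad \<Omega> v x) + c x * u x * v x"

definition bform ::
    "(real ^ 'd::finite) set \<Rightarrow> (real ^ 'd \<Rightarrow> real) \<Rightarrow> (real ^ 'd \<Rightarrow> real) \<Rightarrow>
     (real ^ 'd \<Rightarrow> real) \<Rightarrow> (real ^ 'd \<Rightarrow> real) \<Rightarrow> real" where
  "bform \<Omega> a c u v = (LINT x|lebesgue_on \<Omega>. weak_integrand \<Omega> a c u v x)"

definition load ::
    "(real ^ 'd::finite) set \<Rightarrow> (real ^ 'd \<Rightarrow> real) \<Rightarrow> (real ^ 'd \<Rightarrow> real) \<Rightarrow> real" where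
  "load \<Omega> f v = (LINT x|lebesgue_on \<Omega>. f x * v x)"

definition variational_solution ::
    "((real ^ 'd::finite \<Rightarrow> real) \<Rightarrow> (real ^ 'd \<Rightarrow> real) \<Rightarrow> real) \<Rightarrow>
     ((real ^ 'd \<Rightarrow> real) \<Rightarrow> real) \<Rightarrow> (real ^ 'd \<Rightarrow> real) set \<Rightarrow> (real ^ 'd \<Rightarrow> real) \<Rightarrow> bool" where
  "variational_solution B F W u \<longleftrightarrow> u \<in> W \<and> (\<forall>v\<in>W. B u v = F v)"

subsection \<open>Finite element spaces\<close>

definition subdivision :: "(real ^ 'd::finite) set \<Rightarrow> (real ^ 'd) set set \<Rightarrow> bool" where
  "subdivision \<Omega> \<T> \<longleftrightarrow>
     finite \<T> \<and> (\<forall>K\<in>\<T>. compact K \<and> interior K \<noteq> {}) \<and>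
     (\<forall>K\<in>\<T>. \<forall>L\<in>\<T>. K \<noteq> L \<longrightarrow> interior K \<inter> interior L = {}) \<and>
     \<Union>\<T> = closure \<Omega>"

definition poly_fun_le :: "nat \<Rightarrow> (real ^ 'd::finite \<Rightarrow> real) \<Rightarrow> bool" where
  "poly_fun_le k p \<longleftrightarrow>
     (\<exists>c. \<forall>x. p x = (\<Sum>\<alpha> | mi_order \<alpha> \<le> k. c \<alpha> * (\<Prod>i\<in>UNIV. (x $ i) ^ \<alpha> i)))"

definition fe_space ::
    "(real ^ 'd::finite) set \<Rightarrow> nat \<Rightarrow> (real ^ 'd) set set \<Rightarrow> (real ^ 'd \<Rightarrow> real) set" where
  "fe_space \<Omega> k \<T> =
     {v \<in> H01 \<Omega>. \<forall>K\<in>\<T>. \<exists>p. poly_fun_le k p \<and> (AE x in lebesgue_on \<Omega>. x \<in> K \<longrightarrow> v x = p x)}"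

end

theory Submission
  imports Defs
begin

text \<open>
  Division by \<open>u\<^sub>\<theta>\<close> maps \<open>H\<^sup>m \<inter> H\<^sub>0\<^sup>1\<close> into itself, because \<open>1 / u\<^sub>\<theta>\<close> is smooth up to the boundary and a test
  function times a function smooth on \<open>\<Omega>\<close> is again a test function.  Cea's lemma on \<open>V\<^sub>h\<^sup>*\<close> bounds the error
  by \<open>\<alpha> / \<beta>\<close> times the distance from \<open>u\<close> to \<open>(\<I>\<^sub>h (u / u\<^sub>\<theta>)) u\<^sub>\<theta>\<close>; this difference is
  \<open>(u / u\<^sub>\<theta> - \<I>\<^sub>h (u / u\<^sub>\<theta>)) u\<^sub>\<theta>\<close>, and multiplication by \<open>u\<^sub>\<theta>\<close> costs a factor \<open>C \<parallel>u\<^sub>\<theta>\<parallel>\<close> in \<open>H\<^sup>1\<close>, with the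
  \<open>C\<^sub>1\<close> norm of \<open>u\<^sub>\<theta>\<close>.  Existence of the discrete solution needs no sign of the form: the form is symmetric
  and vanishes on the diagonal only at null functions, which suffices for Gram-Schmidt.
\<close>

subsection \<open>Functions smooth up to the boundary\<close>

text \<open>Sobolev functions are plain functions here, and \<open>weak_deriv\<close> selects one of
  many weak derivatives. Additivity of the gradient, square integrability of a selected derivative
  and the formula for the norm therefore all rest on the uniqueness of weak derivatives up to null
  sets, that is, on the fundamental lemma of the calculus of variations. This is why bump functions
  and Lebesgue differentiation appear before any Sobolev space. A second choice, that of the list in
  \<open>multi_deriv\<close>, is harmless because mixed partial derivatives of smooth functions
  commute. No Leibniz rule of order m is used: \<open>u / u\<^sub>\<theta>\<close> is placed in the
  Sobolev space by recursion on m with the first-order rule, and its seminorm is never expanded but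
  only passed on from the interpolation bound. Since the discrete space is not a quotient by null
  functions, the Galerkin argument is phrased with a functional \<open>N\<close> that may vanish at
  nonzero functions; such functions lie in the kernel of the form and of the load.\<close>

lemma partial_deriv_eqI:
  "(f has_derivative f') (at x) \<Longrightarrow> partial_deriv i f x = f' (axis i 1)"
  unfolding partial_deriv_def using frechet_derivative_at by metis

lemma partial_deriv_cong:
  assumes "open S" "x \<in> S" "\<And>y. y \<in> S \<Longrightarrow> f y = g y"
  shows "partial_deriv i f x = partial_deriv i g x"
proof -
  have "(f has_derivative D) (at x) \<longleftrightarrow> (g has_derivative D) (at x)" for D
    using assms has_derivative_transform_within_open by metis
  then show ?thesis
    unfolding partial_deriv_def frechet_derivative_def by simp
qed

lemma differentiable_cong_open:
  assumes "open S" "x \<in> S" "\<And>y. y \<in> S \<Longrightarrow> f y = g y"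
  shows "f differentiable at x \<longleftrightarrow> g differentiable at x"
  unfolding differentiable_def using assms has_derivative_transform_within_open by metis

lemma partial_deriv_add:
  assumes "f differentiable at x" "g differentiable at x"
  shows "partial_deriv i (\<lambda>x. f x + g x) x = partial_deriv i f x + partial_deriv i g x"
  using partial_deriv_eqI[OF has_derivative_add[OF assms[unfolded frechet_derivative_works]]]
  by (simp add: partial_deriv_def)

lemma partial_deriv_mult:
  assumes "f differentiable at x" "g differentiable at x"
  shows "partial_deriv i (\<lambda>x. f x * g x) x = f x * partial_deriv i g x + g x * partial_deriv i f x"
  using partial_deriv_eqI[OF has_derivative_mult[OF assms[unfolded frechet_derivative_works]]]
  by (simp add: partial_deriv_def)

lemma partial_deriv_const [simp]: "partial_deriv i (\<lambda>x. c) = (\<lambda>x. 0)"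
  by (rule ext) (simp add: partial_deriv_def)

lemma partial_deriv_inverse:
  assumes "f differentiable at x" "f x \<noteq> 0"
  shows "partial_deriv i (\<lambda>x. inverse (f x)) x = (- 1) * partial_deriv i f x * (inverse (f x) * inverse (f x))"
  using partial_deriv_eqI[OF Deriv.has_derivative_inverse[OF assms(2) assms(1)[unfolded frechet_derivative_works]]]
  by (simp add: partial_deriv_def)

section \<open>Smoothness up to the boundary, by recursion on the order\<close>

definition extends_cont :: "(real ^ 'd) set \<Rightarrow> (real ^ 'd) set \<Rightarrow> (real ^ 'd::finite \<Rightarrow> real) \<Rightarrow> bool" where
  "extends_cont S C f \<longleftrightarrow> (\<exists>g. continuous_on C g \<and> (\<forall>x\<in>S. g x = f x))"

text \<open>With \<open>C = {}\<close> this is plain smoothness, with \<open>C = closure S\<close> smoothness up to the boundary.\<close>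

primrec smooth_upto :: "(real ^ 'd) set \<Rightarrow> (real ^ 'd) set \<Rightarrow> nat \<Rightarrow> (real ^ 'd::finite \<Rightarrow> real) \<Rightarrow> bool" where
  "smooth_upto S C 0 f \<longleftrightarrow> (\<forall>x\<in>S. f differentiable at x) \<and> extends_cont S C f"
| "smooth_upto S C (Suc n) f \<longleftrightarrow> (\<forall>x\<in>S. f differentiable at x) \<and> extends_cont S C f \<and>
     (\<forall>i. smooth_upto S C n (partial_deriv i f))"

lemma smooth_upto_0: "smooth_upto S C n f \<Longrightarrow> smooth_upto S C 0 f"
  by (cases n) auto

lemma smooth_upto_Suc_iff:
  "smooth_upto S C (Suc n) f \<longleftrightarrow> smooth_upto S C 0 f \<and> (\<forall>i. smooth_upto S C n (partial_deriv i f))"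
  by simp

lemma smooth_upto_SucD: "smooth_upto S C (Suc n) f \<Longrightarrow> smooth_upto S C n f"
  by (induction n arbitrary: f) auto

lemma smooth_upto_differentiable: "smooth_upto S C n f \<Longrightarrow> x \<in> S \<Longrightarrow> f differentiable at x"
  by (cases n) auto

lemma smooth_upto_extends: "smooth_upto S C n f \<Longrightarrow> extends_cont S C f"
  by (cases n) auto

text \<open>Sum, product and quotient rules describe a partial derivative only at the points of
  \<open>S\<close>. As derivatives on an open set are local, this is enough to transfer smoothness
  from the formula to the derivative itself.\<close>

lemma smooth_upto_cong:
  assumes "open S" "\<And>y. y \<in> S \<Longrightarrow> f y = g y"
  shows "smooth_upto S C n f \<longleftrightarrow> smooth_upto S C n g"
  using assms(2)
proof (induction n arbitrary: f g)
  case (0 f g)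
  have "f differentiable at x \<longleftrightarrow> g differentiable at x" if "x \<in> S" for x
    using differentiable_cong_open[OF assms(1) that 0] .
  then show ?case using 0 by (simp add: extends_cont_def)
next
  case (Suc n f g)
  have "f differentiable at x \<longleftrightarrow> g differentiable at x" if "x \<in> S" for x
    using differentiable_cong_open[OF assms(1) that Suc.prems] .
  then have "smooth_upto S C 0 f \<longleftrightarrow> smooth_upto S C 0 g"
    using Suc.prems by (simp add: extends_cont_def)
  moreover have "smooth_upto S C n (partial_deriv i f) \<longleftrightarrow> smooth_upto S C n (partial_deriv i g)" for i
    using Suc.prems partial_deriv_cong[OF assms(1)] by (intro Suc.IH) blast
  ultimately show ?case unfolding smooth_upto_Suc_iff by blast
qed

lemma smooth_upto_const [simp]: "smooth_upto S C n (\<lambda>x. c)"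
proof (induction n arbitrary: c)
  case 0
  show ?case by (auto simp: extends_cont_def intro!: exI[of _ "\<lambda>x. c"])
next
  case (Suc n)
  then show ?case by (auto simp: extends_cont_def intro!: exI[of _ "\<lambda>x. c"])
qed

lemma extends_cont_add: "extends_cont S C f \<Longrightarrow> extends_cont S C g \<Longrightarrow> extends_cont S C (\<lambda>x. f x + g x)"
  unfolding extends_cont_def
  by (elim exE, rename_tac F G, rule_tac x="\<lambda>x. F x + G x" in exI) (auto intro: continuous_on_add)

lemma extends_cont_mult: "extends_cont S C f \<Longrightarrow> extends_cont S C g \<Longrightarrow> extends_cont S C (\<lambda>x. f x * g x)"
  unfolding extends_cont_def
  by (elim exE, rename_tac F G, rule_tac x="\<lambda>x. F x * G x" in exI) (auto intro: continuous_on_mult)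

lemma smooth_upto_add:
  assumes "open S" "smooth_upto S C n f" "smooth_upto S C n g"
  shows "smooth_upto S C n (\<lambda>x. f x + g x)"
  using assms(2,3)
proof (induction n arbitrary: f g)
  case 0
  then show ?case by (auto intro: extends_cont_add)
next
  case (Suc n)
  have "smooth_upto S C n (\<lambda>x. partial_deriv i f x + partial_deriv i g x)" for i
    using Suc by auto
  moreover have "partial_deriv i (\<lambda>x. f x + g x) x = partial_deriv i f x + partial_deriv i g x"
    if "x \<in> S" for i x
    using Suc.prems that by (intro partial_deriv_add) auto
  ultimately have "smooth_upto S C n (partial_deriv i (\<lambda>x. f x + g x))" for i
    using smooth_upto_cong[OF assms(1)] by (metis (no_types, lifting))
  then show ?case using Suc.prems by (auto intro: extends_cont_add)
qed

lemma smooth_upto_mult: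
  assumes "open S" "smooth_upto S C n f" "smooth_upto S C n g"
  shows "smooth_upto S C n (\<lambda>x. f x * g x)"
  using assms(2,3)
proof (induction n arbitrary: f g)
  case 0
  then show ?case by (auto intro: extends_cont_mult)
next
  case (Suc n)
  have "smooth_upto S C n (\<lambda>x. f x * partial_deriv i g x)"
       "smooth_upto S C n (\<lambda>x. g x * partial_deriv i f x)" for i
    using Suc.IH[of f "partial_deriv i g"] Suc.IH[of g "partial_deriv i f"] Suc.prems smooth_upto_SucD
    by (auto simp del: smooth_upto.simps(1))
  then have "smooth_upto S C n (\<lambda>x. f x * partial_deriv i g x + g x * partial_deriv i f x)" for i
    using smooth_upto_add[OF assms(1)] by blast
  moreover have "partial_deriv i (\<lambda>x. f x * g x) x = f x * partial_deriv i g x + g x * partial_deriv i f x"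
    if "x \<in> S" for i x
    using Suc.prems that by (intro partial_deriv_mult) auto
  ultimately have "smooth_upto S C n (partial_deriv i (\<lambda>x. f x * g x))" for i
    using smooth_upto_cong[OF assms(1)] by (metis (no_types, lifting))
  then show ?case using Suc.prems by (auto intro: extends_cont_mult)
qed

text \<open>Induction on the order succeeds because the derivative of 1 / f is built from the
  derivative of f and from 1 / f, both known to the lower order. The extension \<open>g\<close> must
  be nonzero on all of \<open>C\<close>: a function without zeros in \<open>S\<close> may still tend
  to 0 at the boundary.\<close>

lemma smooth_upto_inverse:
  assumes "open S" "smooth_upto S C n f" "\<And>x. x \<in> S \<Longrightarrow> f x \<noteq> 0"
    and g: "continuous_on C g" "\<And>x. x \<in> S \<Longrightarrow> g x = f x" "\<And>x. x \<in> C \<Longrightarrow> g x \<noteq> 0"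
  shows "smooth_upto S C n (\<lambda>x. inverse (f x))"
  using assms(2)
proof (induction n)
  case 0
  have "extends_cont S C (\<lambda>x. inverse (f x))"
    unfolding extends_cont_def using g by (intro exI[of _ "\<lambda>x. inverse (g x)"]) (auto intro: continuous_on_inverse)
  then show ?case using 0 assms(3) by (auto intro: differentiable_inverse)
next
  case (Suc n)
  have *: "smooth_upto S C n (\<lambda>x. inverse (f x))"
    using Suc smooth_upto_SucD by blast
  have "smooth_upto S C n (\<lambda>x. (- 1) * partial_deriv i f x * (inverse (f x) * inverse (f x)))" for i
    using Suc.prems * by (intro smooth_upto_mult assms(1) smooth_upto_const) auto
  moreover have "partial_deriv i (\<lambda>x. inverse (f x)) x = (- 1) * partial_deriv i f x * (inverse (f x) * inverse (f x))"
    if "x \<in> S" for i x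
    using Suc.prems that assms(3) by (intro partial_deriv_inverse) auto
  ultimately have "smooth_upto S C n (partial_deriv i (\<lambda>x. inverse (f x)))" for i
    using smooth_upto_cong[OF assms(1)] by (metis (no_types, lifting))
  then show ?case
    unfolding smooth_upto_Suc_iff using smooth_upto_0[OF *] by blast
qed

section \<open>Agreement with smoothness in terms of iterated partial derivatives\<close>

lemma iter_partial_append: "iter_partial (is @ js) f = iter_partial is (iter_partial js f)"
  by (induction "is") auto

lemma smooth_upto_all_iff:
  "(\<forall>n. smooth_upto S C n f) \<longleftrightarrow> (\<forall>is. smooth_upto S C 0 (iter_partial is f))"
proof
  show "\<forall>is. smooth_upto S C 0 (iter_partial is f)" if *: "\<forall>n. smooth_upto S C n f"
  proof
    fix "is"
    have "\<forall>n. smooth_upto S C n (iter_partial is f)"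
      using * by (induction "is") (simp, metis iter_partial.simps(2) smooth_upto_Suc_iff)
    then show "smooth_upto S C 0 (iter_partial is f)" by blast
  qed
next
  assume *: "\<forall>is. smooth_upto S C 0 (iter_partial is f)"
  have "(\<forall>is. smooth_upto S C 0 (iter_partial is f)) \<Longrightarrow> smooth_upto S C n f" for n
  proof (induction n arbitrary: f)
    case 0
    then show ?case by (metis iter_partial.simps(1))
  next
    case (Suc n)
    \<comment> \<open>\<open>iter_partial\<close> applies the last entry of its list first, whereas
      \<open>smooth_upto\<close> peels off the derivative taken first; hence the new index goes to
      the end of the list.\<close>
    have "smooth_upto S C 0 (iter_partial is (partial_deriv i f))" for i "is"
      using Suc.prems[rule_format, of "is @ [i]"] by (simp only: iter_partial_append iter_partial.simps)
    then have "smooth_upto S C n (partial_deriv i f)" for i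
      using Suc.IH by blast
    then show ?case
      unfolding smooth_upto_Suc_iff using Suc.prems by (metis iter_partial.simps(1))
  qed
  with * show "\<forall>n. smooth_upto S C n f" by blast
qed

lemma smooth_in_iff: "smooth_in S f \<longleftrightarrow> (\<forall>n. smooth_upto S {} n f)"
  unfolding smooth_upto_all_iff by (auto simp: smooth_in_def extends_cont_def)

lemma smooth_on_closure_iff:
  "smooth_on_closure S f \<longleftrightarrow> continuous_on (closure S) f \<and> (\<forall>n. smooth_upto S (closure S) n f)"
  unfolding smooth_upto_all_iff by (auto simp: smooth_on_closure_def smooth_in_def extends_cont_def)

lemma smooth_in_cong:
  assumes "open S" "\<And>y. y \<in> S \<Longrightarrow> f y = g y"
  shows "smooth_in S f \<longleftrightarrow> smooth_in S g"
  unfolding smooth_in_iff using smooth_upto_cong[of S f g] assms by blast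

lemma smooth_in_const [simp]: "smooth_in S (\<lambda>x. c)"
  by (simp add: smooth_in_iff)

lemma smooth_in_add: "open S \<Longrightarrow> smooth_in S f \<Longrightarrow> smooth_in S g \<Longrightarrow> smooth_in S (\<lambda>x. f x + g x)"
  by (simp add: smooth_in_iff smooth_upto_add)

lemma smooth_in_mult: "open S \<Longrightarrow> smooth_in S f \<Longrightarrow> smooth_in S g \<Longrightarrow> smooth_in S (\<lambda>x. f x * g x)"
  by (simp add: smooth_in_iff smooth_upto_mult)

lemma smooth_in_differentiable: "smooth_in S f \<Longrightarrow> x \<in> S \<Longrightarrow> f differentiable at x"
  unfolding smooth_in_iff using smooth_upto_differentiable by blast

lemma smooth_in_partial: "smooth_in S f \<Longrightarrow> smooth_in S (partial_deriv i f)"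
  unfolding smooth_in_iff using smooth_upto_Suc_iff by blast

lemma smooth_in_iter_partial: "smooth_in S f \<Longrightarrow> smooth_in S (iter_partial is f)"
  by (induction "is") (auto intro: smooth_in_partial)

lemma smooth_in_continuous_on: "smooth_in S f \<Longrightarrow> continuous_on S f"
  using smooth_in_differentiable differentiable_imp_continuous_within
  by (metis continuous_at_imp_continuous_on)

lemma smooth_in_subset: "smooth_in T f \<Longrightarrow> S \<subseteq> T \<Longrightarrow> smooth_in S f"
  unfolding smooth_in_def by blast

lemma smooth_on_closure_smooth_in: "smooth_on_closure S f \<Longrightarrow> smooth_in S f"
  unfolding smooth_on_closure_def by blast

lemma smooth_on_closure_inverse:
  assumes "open S" "smooth_on_closure S f" "\<And>x. x \<in> closure S \<Longrightarrow> f x \<noteq> 0"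
  shows "smooth_on_closure S (\<lambda>x. inverse (f x))"
  using assms unfolding smooth_on_closure_iff
  by (auto intro!: smooth_upto_inverse[where g = f] continuous_on_inverse simp: closure_subset[THEN subsetD])

lemma extends_cont_bounded:
  assumes "bounded S" "extends_cont S (closure S) f"
  obtains M where "\<And>x. x \<in> S \<Longrightarrow> \<bar>f x\<bar> \<le> M"
proof -
  obtain g where g: "continuous_on (closure S) g" "\<And>x. x \<in> S \<Longrightarrow> g x = f x"
    using assms(2) unfolding extends_cont_def by blast
  have "bounded (g ` closure S)"
    using assms(1) g(1) by (intro compact_imp_bounded compact_continuous_image) auto
  then obtain M where "\<And>x. x \<in> closure S \<Longrightarrow> \<bar>g x\<bar> \<le> M"
    unfolding bounded_iff by auto
  then show thesis
    using that g(2) closure_subset by (metis subsetD)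
qed

text \<open>A partial derivative is only controlled on \<open>S\<close>, not on its boundary, so a continuous
  extension has to be chosen.\<close>

lemma smooth_on_closure_partial:
  assumes "open S" "smooth_on_closure S f"
  obtains g where "smooth_on_closure S g" "\<And>x. x \<in> S \<Longrightarrow> g x = partial_deriv i f x"
proof -
  have D: "smooth_upto S (closure S) n (partial_deriv i f)" for n
    using assms(2) smooth_upto_Suc_iff unfolding smooth_on_closure_iff by blast
  then obtain g where g: "continuous_on (closure S) g" "\<And>x. x \<in> S \<Longrightarrow> g x = partial_deriv i f x"
    using smooth_upto_extends unfolding extends_cont_def by blast
  have "smooth_upto S (closure S) n g" for n
    using smooth_upto_cong[OF assms(1), of g "partial_deriv i f"] g(2) D by blast
  then show thesis using that g unfolding smooth_on_closure_iff by blast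
qed

subsection \<open>Symmetry of partial derivatives and test functions\<close>

lemma line_has_real_derivative:
  assumes "f differentiable at (y + s *\<^sub>R axis i 1)"
  shows "((\<lambda>s. f (y + s *\<^sub>R axis i 1)) has_real_derivative partial_deriv i f (y + s *\<^sub>R axis i 1)) (at s)"
proof -
  have "(f has_derivative frechet_derivative f (at (y + s *\<^sub>R axis i 1))) (at (y + s *\<^sub>R axis i 1))"
    using assms frechet_derivative_works by blast
  moreover have "((\<lambda>s. y + s *\<^sub>R axis i 1) has_derivative (\<lambda>r. r *\<^sub>R axis i 1)) (at s)"
    by (auto intro!: derivative_eq_intros)
  ultimately have "((\<lambda>s. f (y + s *\<^sub>R axis i 1)) has_derivative
      (\<lambda>r. frechet_derivative f (at (y + s *\<^sub>R axis i 1)) (r *\<^sub>R axis i 1))) (at s)"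
    using has_derivative_compose by fast
  moreover have "linear (frechet_derivative f (at (y + s *\<^sub>R axis i 1)))"
    using assms by (rule linear_frechet_derivative)
  ultimately show ?thesis
    unfolding has_field_derivative_def partial_deriv_def
    by (simp add: linear_cmul mult.commute[of _ "frechet_derivative f _ _"])
qed

text \<open>The one-dimensional mean value theorem is applied twice: to the increment of f in
  direction j as a function of the step in direction i, and then to the resulting partial derivative
  along direction j.\<close>

lemma second_difference_mvt:
  assumes f: "smooth_in UNIV f" and "t > 0"
  obtains \<xi> \<eta> where "0 < \<xi>" "\<xi> < t" "0 < \<eta>" "\<eta> < t"
    "f (x + t *\<^sub>R axis i 1 + t *\<^sub>R axis j 1) - f (x + t *\<^sub>R axis i 1) - f (x + t *\<^sub>R axis j 1) + f x
      = t * (t * partial_deriv j (partial_deriv i f) (x + \<xi> *\<^sub>R axis i 1 + \<eta> *\<^sub>R axis j 1))"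
proof -
  let ?ei = "axis i 1 :: real ^ 'a" and ?ej = "axis j 1 :: real ^ 'a"
  have d: "f differentiable at y" "partial_deriv i f differentiable at y" for y
    using f smooth_in_partial smooth_in_differentiable by blast+
  have "\<exists>\<xi>. \<xi> > 0 \<and> \<xi> < t \<and>
      (f (x + t *\<^sub>R ?ej + t *\<^sub>R ?ei) - f (x + t *\<^sub>R ?ei)) - (f (x + t *\<^sub>R ?ej + 0 *\<^sub>R ?ei) - f (x + 0 *\<^sub>R ?ei))
      = (t - 0) * (partial_deriv i f (x + t *\<^sub>R ?ej + \<xi> *\<^sub>R ?ei) - partial_deriv i f (x + \<xi> *\<^sub>R ?ei))"
    using \<open>t > 0\<close> by (intro MVT2 DERIV_diff line_has_real_derivative d)
  then obtain \<xi> where \<xi>: "\<xi> > 0" "\<xi> < t"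
      "f (x + t *\<^sub>R ?ej + t *\<^sub>R ?ei) - f (x + t *\<^sub>R ?ei) - f (x + t *\<^sub>R ?ej) + f x
      = t * (partial_deriv i f (x + t *\<^sub>R ?ej + \<xi> *\<^sub>R ?ei) - partial_deriv i f (x + \<xi> *\<^sub>R ?ei))"
    by (auto simp: algebra_simps)
  have "\<exists>\<eta>. \<eta> > 0 \<and> \<eta> < t \<and>
      partial_deriv i f (x + \<xi> *\<^sub>R ?ei + t *\<^sub>R ?ej) - partial_deriv i f (x + \<xi> *\<^sub>R ?ei + 0 *\<^sub>R ?ej)
      = (t - 0) * partial_deriv j (partial_deriv i f) (x + \<xi> *\<^sub>R ?ei + \<eta> *\<^sub>R ?ej)"
    using \<open>t > 0\<close> by (intro MVT2 line_has_real_derivative d)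
  then obtain \<eta> where \<eta>: "\<eta> > 0" "\<eta> < t"
      "partial_deriv i f (x + t *\<^sub>R ?ej + \<xi> *\<^sub>R ?ei) - partial_deriv i f (x + \<xi> *\<^sub>R ?ei)
      = t * partial_deriv j (partial_deriv i f) (x + \<xi> *\<^sub>R ?ei + \<eta> *\<^sub>R ?ej)"
    by (auto simp: algebra_simps)
  show thesis
    using that[of \<xi> \<eta>] \<xi> \<eta> by (simp add: add.assoc add.commute[of "t *\<^sub>R ?ej"])
qed

text \<open>The second difference does not change when the two directions are swapped. So the two
  mixed derivatives take a common value at two points arbitrarily close to x, which contradicts
  their continuity if they differ at x.\<close>

lemma partial_deriv_commute:
  assumes f: "smooth_in UNIV f"
  shows "partial_deriv i (partial_deriv j f) = partial_deriv j (partial_deriv i f)"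
proof
  fix x
  let ?p = "partial_deriv i (partial_deriv j f)" and ?q = "partial_deriv j (partial_deriv i f)"
  let ?ei = "axis i 1 :: real ^ 'a" and ?ej = "axis j 1 :: real ^ 'a"
  have cont: "isCont ?p x" "isCont ?q x"
    using f smooth_in_partial smooth_in_continuous_on
    by (metis continuous_on_eq_continuous_at open_UNIV UNIV_I)+
  show "?p x = ?q x"
  proof (rule ccontr)
    assume "?p x \<noteq> ?q x"
    then have e: "\<bar>?p x - ?q x\<bar> / 2 > 0" by simp
    obtain d1 where d1: "d1 > 0" "\<And>y. dist y x < d1 \<Longrightarrow> \<bar>?p y - ?p x\<bar> < \<bar>?p x - ?q x\<bar> / 2"
      using cont(1) e unfolding continuous_at_eps_delta dist_real_def by blast
    obtain d2 where d2: "d2 > 0" "\<And>y. dist y x < d2 \<Longrightarrow> \<bar>?q y - ?q x\<bar> < \<bar>?p x - ?q x\<bar> / 2"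
      using cont(2) e unfolding continuous_at_eps_delta dist_real_def by blast
    \<comment> \<open>The intermediate points are reached from x by two steps shorter than t, so
      they are closer than 2 t to x, which is at most either radius.\<close>
    define t where "t = min d1 d2 / 2"
    have t: "t > 0" "2 * t \<le> d1" "2 * t \<le> d2" using d1 d2 by (auto simp: t_def)
    have near: "dist (x + a *\<^sub>R axis k 1 + b *\<^sub>R axis l 1) x < 2 * t"
      if "0 < a" "a < t" "0 < b" "b < t" for a b :: real and k l :: 'a
      using norm_triangle_ineq[of "a *\<^sub>R axis k (1::real)" "b *\<^sub>R axis l 1"] that
      by (simp add: dist_norm add.assoc)
    obtain a b where ab: "0 < a" "a < t" "0 < b" "b < t"
      "f (x + t *\<^sub>R ?ei + t *\<^sub>R ?ej) - f (x + t *\<^sub>R ?ei) - f (x + t *\<^sub>R ?ej) + f x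
      = t * (t * ?q (x + a *\<^sub>R ?ei + b *\<^sub>R ?ej))"
      using second_difference_mvt[OF f t(1)] by metis
    obtain a' b' where ab': "0 < a'" "a' < t" "0 < b'" "b' < t"
      "f (x + t *\<^sub>R ?ej + t *\<^sub>R ?ei) - f (x + t *\<^sub>R ?ej) - f (x + t *\<^sub>R ?ei) + f x
      = t * (t * ?p (x + a' *\<^sub>R ?ej + b' *\<^sub>R ?ei))"
      using second_difference_mvt[OF f t(1)] by metis
    have "t * (t * ?q (x + a *\<^sub>R ?ei + b *\<^sub>R ?ej))
        = f (x + t *\<^sub>R ?ei + t *\<^sub>R ?ej) - f (x + t *\<^sub>R ?ei) - f (x + t *\<^sub>R ?ej) + f x"
      using ab(5) by simp
    also have "\<dots> = f (x + t *\<^sub>R ?ej + t *\<^sub>R ?ei) - f (x + t *\<^sub>R ?ej) - f (x + t *\<^sub>R ?ei) + f x"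
      by (simp add: algebra_simps)
    also have "\<dots> = t * (t * ?p (x + a' *\<^sub>R ?ej + b' *\<^sub>R ?ei))"
      by (rule ab'(5))
    finally have "t * (t * ?q (x + a *\<^sub>R ?ei + b *\<^sub>R ?ej)) = t * (t * ?p (x + a' *\<^sub>R ?ej + b' *\<^sub>R ?ei))" .
    then have "?q (x + a *\<^sub>R ?ei + b *\<^sub>R ?ej) = ?p (x + a' *\<^sub>R ?ej + b' *\<^sub>R ?ei)"
      using t(1) by simp
    moreover have "\<bar>?q (x + a *\<^sub>R ?ei + b *\<^sub>R ?ej) - ?q x\<bar> < \<bar>?p x - ?q x\<bar> / 2"
      using near[OF ab(1-4)] t by (intro d2(2)) (meson order_less_le_trans)
    moreover have "\<bar>?p (x + a' *\<^sub>R ?ej + b' *\<^sub>R ?ei) - ?p x\<bar> < \<bar>?p x - ?q x\<bar> / 2"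
      using near[OF ab'(1-4)] t by (intro d1(2)) (meson order_less_le_trans)
    ultimately show False by (simp add: abs_if split: if_splits)
  qed
qed

section \<open>Independence of the order of differentiation\<close>

lemma iter_partial_partial:
  "smooth_in UNIV f \<Longrightarrow> iter_partial is (partial_deriv i f) = partial_deriv i (iter_partial is f)"
  by (induction "is") (auto simp: partial_deriv_commute smooth_in_iter_partial)

lemma iter_partial_perm:
  assumes "smooth_in UNIV f" "mset is = mset js"
  shows "iter_partial is f = iter_partial js f"
  using assms(2)
proof (induction "is" arbitrary: js)
  case (Cons i "is")
  then obtain js1 js2 where js: "js = js1 @ i # js2"
    by (metis list.set_intros(1) set_mset_mset split_list)
  then have "mset is = mset (js1 @ js2)" using Cons.prems by simp
  then have "iter_partial is f = iter_partial (js1 @ js2) f" using Cons.IH by blast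
  then show ?case
    by (simp add: js iter_partial_append iter_partial_partial smooth_in_iter_partial assms(1))
qed simp

text \<open>Lists with equal counts are permutations of each other, so the list selected in
  \<open>multi_deriv\<close> can be exchanged for any convenient one.\<close>

lemma multi_deriv_eq:
  assumes "smooth_in UNIV f" "\<And>i. count_list is i = \<alpha> i"
  shows "multi_deriv \<alpha> f = iter_partial is f"
proof -
  have "\<forall>i. count_list (SOME is. \<forall>i. count_list is i = \<alpha> i) i = \<alpha> i"
    using assms(2) by (intro someI_ex[of "\<lambda>is. \<forall>i. count_list is i = \<alpha> i"]) blast
  then have "mset (SOME is. \<forall>i. count_list is i = \<alpha> i) = mset is"
    using assms(2) by (intro multiset_eqI) (simp add: count_mset)
  then show ?thesis unfolding multi_deriv_def using iter_partial_perm[OF assms(1)] by blast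
qed

lemma multi_index_list_exists: "\<exists>is. \<forall>i. count_list is i = \<alpha> (i::'d::finite)"
proof -
  obtain "is" where "mset is = Abs_multiset \<alpha>" using ex_mset by blast
  moreover have "count (Abs_multiset \<alpha>) = \<alpha>" by (rule count_Abs_multiset) simp
  ultimately show ?thesis by (metis count_mset)
qed

lemma multi_deriv_Suc:
  assumes "smooth_in UNIV f"
  shows "multi_deriv (\<alpha>(i := Suc (\<alpha> i))) f = partial_deriv i (multi_deriv \<alpha> f)"
    and "multi_deriv (\<alpha>(i := Suc (\<alpha> i))) f = multi_deriv \<alpha> (partial_deriv i f)"
proof -
  obtain "is" where "is": "\<And>i. count_list is i = \<alpha> i" using multi_index_list_exists[of \<alpha>] by blast
  then have "multi_deriv (\<alpha>(i := Suc (\<alpha> i))) f = iter_partial (i # is) f"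
    using assms by (intro multi_deriv_eq) auto
  then show "multi_deriv (\<alpha>(i := Suc (\<alpha> i))) f = partial_deriv i (multi_deriv \<alpha> f)"
    "multi_deriv (\<alpha>(i := Suc (\<alpha> i))) f = multi_deriv \<alpha> (partial_deriv i f)"
    using multi_deriv_eq[of f "is" \<alpha>] multi_deriv_eq[of "partial_deriv i f" "is" \<alpha>] assms "is"
    by (auto simp: iter_partial_partial smooth_in_partial)
qed

lemma multi_deriv_0 [simp]: "multi_deriv (\<lambda>_. 0) f = f"
proof -
  have "(SOME is. \<forall>i::'a. count_list is i = 0) = []"
    by (rule some_equality) (auto simp: count_list_0_iff intro: list.set_cases)
  then show ?thesis by (simp add: multi_deriv_def)
qed

lemma multi_deriv_unit: "smooth_in UNIV f \<Longrightarrow> multi_deriv ((\<lambda>_. 0)(i := 1)) f = partial_deriv i f"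
  using multi_deriv_Suc(1)[of f "\<lambda>_. 0" i] by simp

lemma smooth_in_multi_deriv: "smooth_in S f \<Longrightarrow> smooth_in S (multi_deriv \<alpha> f)"
  unfolding multi_deriv_def by (rule smooth_in_iter_partial)

section \<open>Supports and closure properties of test functions\<close>

lemma test_function_smooth: "test_function \<Omega> \<phi> \<Longrightarrow> smooth_in UNIV \<phi>"
  unfolding test_function_def by blast

lemma test_functionI:
  assumes "smooth_in UNIV \<phi>" "compact K" "K \<subseteq> \<Omega>" "\<And>x. x \<notin> K \<Longrightarrow> \<phi> x = 0"
  shows "test_function \<Omega> \<phi>"
proof -
  have "closure {x. \<phi> x \<noteq> 0} \<subseteq> K"
    using assms compact_imp_closed by (intro closure_minimal) auto
  moreover have "compact (closure {x. \<phi> x \<noteq> 0})"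
    using calculation assms(2) by (meson bounded_subset compact_closure compact_imp_bounded
        closure_subset order_trans)
  ultimately show ?thesis using assms unfolding test_function_def by blast
qed

lemma test_functionE:
  assumes "test_function \<Omega> \<phi>"
  obtains K where "compact K" "K \<subseteq> \<Omega>" "\<And>x. x \<notin> K \<Longrightarrow> \<phi> x = 0"
  using assms closure_subset unfolding test_function_def by (smt (verit) mem_Collect_eq subsetD)

lemma partial_deriv_outside:
  assumes "closed K" "\<And>x. x \<notin> K \<Longrightarrow> f x = 0" "x \<notin> K"
  shows "partial_deriv i f x = 0"
  using partial_deriv_cong[of "- K" x f "\<lambda>x. 0" i] assms by auto

lemma test_function_partial:
  assumes "test_function \<Omega> \<phi>"
  shows "test_function \<Omega> (partial_deriv i \<phi>)"
proof -
  obtain K where K: "compact K" "K \<subseteq> \<Omega>" "\<And>x. x \<notin> K \<Longrightarrow> \<phi> x = 0" using test_functionE[OF assms] by metis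
  show ?thesis
    using K test_function_smooth[OF assms]
    by (intro test_functionI[of _ K] smooth_in_partial partial_deriv_outside[of K] compact_imp_closed) auto
qed

lemma test_function_multi_deriv: "test_function \<Omega> \<phi> \<Longrightarrow> test_function \<Omega> (multi_deriv \<alpha> \<phi>)"
proof -
  have "test_function \<Omega> \<phi> \<Longrightarrow> test_function \<Omega> (iter_partial is \<phi>)" for "is"
    by (induction "is") (auto intro: test_function_partial)
  then show "test_function \<Omega> \<phi> \<Longrightarrow> test_function \<Omega> (multi_deriv \<alpha> \<phi>)"
    by (simp add: multi_deriv_def)
qed

text \<open>\<open>g\<close> is arbitrary off \<open>\<Omega>\<close>, so smoothness on the whole space is glued from \<open>\<Omega>\<close> and the complement
  of the support.\<close>

lemma test_function_mult:
  assumes "open \<Omega>" "test_function \<Omega> \<phi>" "smooth_in \<Omega> g"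
  shows "test_function \<Omega> (\<lambda>x. \<phi> x * g x)"
proof -
  obtain K where K: "compact K" "K \<subseteq> \<Omega>" "\<And>x. x \<notin> K \<Longrightarrow> \<phi> x = 0" using test_functionE[OF assms(2)] by metis
  have "smooth_in \<Omega> (\<lambda>x. \<phi> x * g x)"
    using assms test_function_smooth smooth_in_subset[of UNIV \<phi> \<Omega>] by (intro smooth_in_mult) auto
  moreover have "smooth_in (- K) (\<lambda>x. \<phi> x * g x)"
    using smooth_in_cong[of "- K" "\<lambda>x. \<phi> x * g x" "\<lambda>x. 0"] K compact_imp_closed by auto
  ultimately have "smooth_in UNIV (\<lambda>x. \<phi> x * g x)"
    using K(2) unfolding smooth_in_def by blast
  then show ?thesis using K by (intro test_functionI[of _ K]) auto
qed

lemma test_function_lincomb: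
  assumes "test_function \<Omega> \<phi>" "test_function \<Omega> \<psi>"
  shows "test_function \<Omega> (\<lambda>x. s * \<phi> x + t * \<psi> x)"
proof -
  obtain K where K: "compact K" "K \<subseteq> \<Omega>" "\<And>x. x \<notin> K \<Longrightarrow> \<phi> x = 0" using test_functionE[OF assms(1)] by metis
  obtain L where L: "compact L" "L \<subseteq> \<Omega>" "\<And>x. x \<notin> L \<Longrightarrow> \<psi> x = 0" using test_functionE[OF assms(2)] by metis
  show ?thesis
    using K L assms[THEN test_function_smooth]
    by (intro test_functionI[of _ "K \<union> L"] smooth_in_add smooth_in_mult smooth_in_const) auto
qed

section \<open>Smooth bump functions\<close>

definition bump1 :: "nat \<Rightarrow> real \<Rightarrow> real" where
  "bump1 k t = (if t > 0 then inverse t ^ k * exp (- inverse t) else 0)"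

lemma bump1_tendsto_0: "(bump1 k \<longlongrightarrow> 0) (at 0)"
proof (rule filterlim_split_at)
  show "(bump1 k \<longlongrightarrow> 0) (at_left 0)"
    by (rule tendsto_eventually) (auto simp: bump1_def eventually_at_filter)
  have "((\<lambda>t. inverse t ^ k * exp (- inverse t)) \<longlongrightarrow> 0) (at_right (0::real))"
    unfolding filterlim_at_right_to_top
    using tendsto_power_div_exp_0[of k] by (simp add: exp_minus field_simps)
  moreover have "\<forall>\<^sub>F t in at_right 0. inverse t ^ k * exp (- inverse t) = bump1 k t"
    by (auto simp: bump1_def eventually_at_filter)
  ultimately show "(bump1 k \<longlongrightarrow> 0) (at_right 0)"
    by (rule Lim_transform_eventually)
qed

text \<open>The case k = 0 is the classical function exp(-1/t) extended by zero. The powers of 1/t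
  are included to obtain a family whose span is closed under differentiation, so that smoothness
  follows by induction on the order with k arbitrary.\<close>

lemma bump1_has_derivative:
  "(bump1 k has_real_derivative (bump1 (k + 2) t - k * bump1 (Suc k) t)) (at t)"
proof (cases t "0::real" rule: linorder_cases)
  case less
  have "((\<lambda>t. 0) has_real_derivative 0) (at t)" by simp
  then have "(bump1 k has_real_derivative 0) (at t)"
    by (rule has_field_derivative_transform_within_open[of _ _ _ "{..<0}"]) (use less in \<open>auto simp: bump1_def\<close>)
  then show ?thesis using less by (simp add: bump1_def)
next
  case equal
  \<comment> \<open>Division by h raises the index by one, so the difference quotient at 0 is again
    a member of the family, and its limit is known.\<close>
  have "((\<lambda>h. bump1 k h / h) \<longlongrightarrow> 0) (at 0)"
    using bump1_tendsto_0[of "Suc k"]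
    by (rule Lim_transform_eventually) (auto simp: bump1_def eventually_at_filter field_simps)
  then show ?thesis using equal by (simp add: has_field_derivative_iff bump1_def)
next
  case greater
  have "((\<lambda>t. inverse t ^ k * exp (- inverse t)) has_real_derivative
      (bump1 (k + 2) t - k * bump1 (Suc k) t)) (at t)"
  proof -
    \<comment> \<open>The truncated exponent does no harm: for k = 0 the factor k makes both sides
      vanish.\<close>
    have "real k * inverse t ^ (k - 1) * (inverse t * inverse t) = real k * inverse t ^ Suc k"
      by (cases k) auto
    moreover have "((\<lambda>t. inverse t ^ k * exp (- inverse t)) has_real_derivative
      inverse t ^ k * (exp (- inverse t) * (inverse t * inverse t))
      - real k * inverse t ^ (k - 1) * (inverse t * inverse t) * exp (- inverse t)) (at t)"
      by (rule derivative_eq_intros refl | use greater in simp)+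
    ultimately have "((\<lambda>t. inverse t ^ k * exp (- inverse t)) has_real_derivative
      inverse t ^ k * (exp (- inverse t) * (inverse t * inverse t))
      - real k * inverse t ^ Suc k * exp (- inverse t)) (at t)"
      by (simp only:)
    then show ?thesis using greater by (simp add: bump1_def algebra_simps)
  qed
  then show ?thesis
    by (rule has_field_derivative_transform_within_open[of _ _ _ "{0<..}"]) (use greater in \<open>auto simp: bump1_def\<close>)
qed

text \<open>The affine argument serves both faces of a box in direction i: the slope 1 gives a
  function vanishing below the lower face, the slope -1 one vanishing above the upper face.\<close>

lemma bump1_smooth: "smooth_in UNIV (\<lambda>x :: real ^ 'd::finite. bump1 k (s * x $ i + c))"
proof -
  have der: "((\<lambda>x. bump1 k (s * x $ i + c)) has_derivative
      (\<lambda>v. (s * v $ i) * (bump1 (k + 2) (s * x $ i + c) - k * bump1 (Suc k) (s * x $ i + c)))) (at x)" for k and x :: "real ^ 'd"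
  proof -
    have "((\<lambda>x :: real ^ 'd. s * x $ i + c) has_derivative (\<lambda>v. s * v $ i)) (at x)"
      by (rule derivative_eq_intros bounded_linear_imp_has_derivative[OF bounded_linear_vec_nth] refl | simp)+
    from has_derivative_compose[OF this bump1_has_derivative[unfolded has_field_derivative_def]]
    show ?thesis by (simp add: mult.commute)
  qed
  have pd: "partial_deriv j (\<lambda>x. bump1 k (s * x $ i + c)) =
     (\<lambda>x. (s * axis j 1 $ i) * (bump1 (k + 2) (s * x $ i + c) + (- k) * bump1 (Suc k) (s * x $ i + c)))" for k and j :: 'd
    using partial_deriv_eqI[OF der] by fastforce
  have "smooth_upto UNIV {} n (\<lambda>x :: real ^ 'd. bump1 k (s * x $ i + c))" for n
  proof (induction n arbitrary: k)
    case 0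
    show ?case using der by (auto simp: differentiable_def extends_cont_def)
  next
    case (Suc n)
    have "smooth_upto UNIV {} 0 (\<lambda>x :: real ^ 'd. bump1 k (s * x $ i + c))"
      using der by (auto simp: differentiable_def extends_cont_def)
    then show ?case unfolding smooth_upto_Suc_iff pd
      by (intro conjI allI smooth_upto_mult smooth_upto_add smooth_upto_const Suc open_UNIV)
  qed
  then show ?thesis by (simp add: smooth_in_iff)
qed

lemma smooth_in_prod:
  assumes "open S" "\<And>i. i \<in> I \<Longrightarrow> smooth_in S (f i)"
  shows "smooth_in S (\<lambda>x. \<Prod>i\<in>I. f i x)"
  using assms(2) by (induction I rule: infinite_finite_induct) (auto intro: smooth_in_mult[OF assms(1)])

lemma smooth_in_power: "open S \<Longrightarrow> smooth_in S f \<Longrightarrow> smooth_in S (\<lambda>x. f x ^ n)"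
  by (induction n) (auto intro: smooth_in_mult)

text \<open>For \<open>\<rho>\<close> smooth with values in \<open>[0, 1)\<close> and positive exactly on the box, the functions
  \<open>1 - (1 - \<rho>)\<^sup>n\<close> increase to the indicator function of the box.\<close>

lemma test_functions_tendsto_indicator_box:
  fixes a b :: "real ^ 'd::finite"
  assumes "cbox a b \<subseteq> \<Omega>"
  obtains \<phi> where "\<And>n. test_function \<Omega> (\<phi> n)" "\<And>n x. \<bar>\<phi> n x\<bar> \<le> indicator (box a b) x"
    "\<And>x. (\<lambda>n. \<phi> n x) \<longlonglongrightarrow> indicator (box a b) x"
proof -
  define \<rho> where "\<rho> x = (\<Prod>i\<in>UNIV. bump1 0 (1 * x $ i + - a $ i) * bump1 0 ((-1) * x $ i + b $ i))" for x
  have sm: "smooth_in UNIV \<rho>"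
    unfolding \<rho>_def by (intro smooth_in_prod smooth_in_mult bump1_smooth) auto
  have b1: "0 \<le> bump1 0 t" "bump1 0 t < 1" "bump1 0 t = 0 \<longleftrightarrow> t \<le> 0" for t
    by (auto simp: bump1_def)
  have r0: "\<rho> x \<ge> 0" for x unfolding \<rho>_def by (intro prod_nonneg) (simp add: b1)
  have r1: "\<rho> x < 1" for x
  proof -
    \<comment> \<open>An empty product would be 1. As the index type is nonempty, one factor can be
      split off, and this factor gives the strict bound.\<close>
    obtain j :: 'd where True by blast
    have "\<rho> x = (\<lambda>i. bump1 0 (1 * x $ i + - a $ i) * bump1 0 ((-1) * x $ i + b $ i)) j *
       (\<Prod>i\<in>UNIV - {j}. bump1 0 (1 * x $ i + - a $ i) * bump1 0 ((-1) * x $ i + b $ i))"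
      unfolding \<rho>_def by (rule prod.remove) auto
    also have "\<dots> \<le> (bump1 0 (1 * x $ j + - a $ j) * bump1 0 ((-1) * x $ j + b $ j)) * 1"
      by (intro mult_left_mono prod_le_1) (auto simp: b1 less_imp_le intro: mult_le_one)
    also have "\<dots> < 1"
      using b1 mult_strict_mono'[of "bump1 0 (1 * x $ j + - a $ j)" 1 "bump1 0 ((-1) * x $ j + b $ j)" 1] by auto
    finally show ?thesis .
  qed
  have rz: "\<rho> x = 0 \<longleftrightarrow> x \<notin> box a b" for x
    unfolding \<rho>_def by (auto simp: b1 mem_box_cart not_less)
  define \<phi> where "\<phi> n x = 1 + (- 1) * (1 + (- 1) * \<rho> x) ^ n" for n x
  show thesis
  proof
    fix n x
    have "smooth_in UNIV (\<phi> n)"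
      unfolding \<phi>_def by (intro smooth_in_add smooth_in_mult smooth_in_power smooth_in_const sm) auto
    then show "test_function \<Omega> (\<phi> n)"
      using assms box_subset_cbox[of a b] rz
      by (intro test_functionI[of _ "cbox a b"]) (force simp: \<phi>_def)+
    show "\<bar>\<phi> n x\<bar> \<le> indicator (box a b) x"
      using r0[of x] r1[of x] rz[of x] power_le_one[of "1 - \<rho> x" n] zero_le_power[of "1 - \<rho> x" n]
      by (cases "x \<in> box a b") (auto simp: \<phi>_def)
    show "(\<lambda>n. \<phi> n x) \<longlonglongrightarrow> indicator (box a b) x"
    proof (cases "x \<in> box a b")
      case True
      then have "\<rho> x > 0" using rz r0[of x] by (simp add: order_less_le)
      then have "(\<lambda>n. (1 + (- 1) * \<rho> x) ^ n) \<longlonglongrightarrow> 0"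
        using r1[of x] by (intro LIMSEQ_power_zero) simp
      then have "(\<lambda>n. \<phi> n x) \<longlonglongrightarrow> 1 + (- 1) * 0"
        unfolding \<phi>_def by (rule tendsto_add[OF tendsto_const tendsto_mult[OF tendsto_const]])
      then show ?thesis using True by simp
    next
      case False
      then have "\<rho> x = 0" using rz by blast
      then show ?thesis using False by (simp add: \<phi>_def)
    qed
  qed
qed

subsection \<open>The fundamental lemma of the calculus of variations\<close>

lemma integrable_mult_bounded:
  fixes f g :: "'a \<Rightarrow> real"
  assumes "integrable M f" "g \<in> borel_measurable M" "\<And>x. x \<in> space M \<Longrightarrow> \<bar>g x\<bar> \<le> B"
  shows "integrable M (\<lambda>x. f x * g x)"
proof (rule Bochner_Integration.integrable_bound)
  show "integrable M (\<lambda>x. f x * B)" using assms(1) by simp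
  show "(\<lambda>x. f x * g x) \<in> borel_measurable M" using assms by measurable
  show "AE x in M. norm (f x * g x) \<le> norm (f x * B)"
  proof (rule AE_I2)
    fix x assume "x \<in> space M"
    then have "\<bar>g x\<bar> \<le> \<bar>B\<bar>" using assms(3) by fastforce
    then show "norm (f x * g x) \<le> norm (f x * B)" by (simp add: abs_mult mult_left_mono)
  qed
qed

lemma integrable_lebesgue_on_open:
  fixes f :: "'a::euclidean_space \<Rightarrow> real"
  assumes "open \<Omega>"
  shows "integrable (lebesgue_on \<Omega>) f \<longleftrightarrow> integrable lebesgue (\<lambda>x. indicator \<Omega> x * f x)"
  using assms integrable_restrict_space[of \<Omega> lebesgue f] by auto

lemma integral_lebesgue_on_open:
  fixes f :: "'a::euclidean_space \<Rightarrow> real"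
  assumes "open \<Omega>"
  shows "(LINT x|lebesgue_on \<Omega>. f x) = (LINT x|lebesgue. indicator \<Omega> x * f x)"
  using assms integral_restrict_space[of \<Omega> lebesgue f] by auto

lemma AE_lebesgue_on_open:
  fixes \<Omega> :: "'a::euclidean_space set"
  assumes "open \<Omega>"
  shows "(AE x in lebesgue_on \<Omega>. P x) \<longleftrightarrow> (AE x in lebesgue. x \<in> \<Omega> \<longrightarrow> P x)"
  using assms by (intro AE_restrict_space_iff) auto

lemma continuous_on_measurable_lebesgue_on:
  fixes f :: "'a::euclidean_space \<Rightarrow> real"
  assumes "continuous_on \<Omega> f" "open \<Omega>"
  shows "f \<in> borel_measurable (lebesgue_on \<Omega>)"
  using assms by (intro continuous_imp_measurable_on_sets_lebesgue) auto

lemma test_function_continuous: "test_function \<Omega> \<phi> \<Longrightarrow> continuous_on S \<phi>"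
  using smooth_in_continuous_on[OF test_function_smooth] continuous_on_subset by blast

lemma test_function_bounded:
  assumes "test_function \<Omega> \<phi>"
  obtains B where "\<And>x. \<bar>\<phi> x\<bar> \<le> B"
proof -
  obtain K where K: "compact K" "K \<subseteq> \<Omega>" "\<And>x. x \<notin> K \<Longrightarrow> \<phi> x = 0"
    using test_functionE[OF assms] by metis
  then have "bounded (\<phi> ` K)"
    using test_function_continuous[OF assms] compact_continuous_image compact_imp_bounded by metis
  then obtain B where B: "\<And>x. x \<in> K \<Longrightarrow> \<bar>\<phi> x\<bar> \<le> B" unfolding bounded_iff by auto
  have "\<bar>\<phi> x\<bar> \<le> max B 0" for x using B[of x] K(3)[of x] by (cases "x \<in> K") auto
  then show thesis using that by blast
qed

lemma integrable_locally_integrable_test: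
  assumes "open \<Omega>" "locally_integrable \<Omega> v" "test_function \<Omega> \<phi>"
  shows "integrable (lebesgue_on \<Omega>) (\<lambda>x. v x * \<phi> x)"
proof -
  obtain K where K: "compact K" "K \<subseteq> \<Omega>" "\<And>x. x \<notin> K \<Longrightarrow> \<phi> x = 0"
    using test_functionE[OF assms(3)] by metis
  obtain B where B: "\<And>x. \<bar>\<phi> x\<bar> \<le> B" using test_function_bounded[OF assms(3)] by metis
  have "integrable lebesgue (\<lambda>x. indicator K x *\<^sub>R v x)"
    using assms(2) K unfolding locally_integrable_def set_integrable_def by blast
  moreover have "\<phi> \<in> borel_measurable lebesgue"
    using continuous_on_measurable_lebesgue_on[OF test_function_continuous[OF assms(3)], of UNIV]
    by (simp add: lebesgue_on_UNIV_eq)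
  ultimately have "integrable lebesgue (\<lambda>x. indicator K x *\<^sub>R v x * \<phi> x)"
    using B by (rule integrable_mult_bounded)
  moreover have "(\<lambda>x. indicator K x *\<^sub>R v x * \<phi> x) = (\<lambda>x. indicator \<Omega> x * (v x * \<phi> x))"
    using K by (force simp: indicator_def)
  ultimately show ?thesis using integrable_lebesgue_on_open[OF assms(1)] by simp
qed

lemma locally_integrableD:
  "locally_integrable \<Omega> v \<Longrightarrow> compact K \<Longrightarrow> K \<subseteq> \<Omega> \<Longrightarrow> set_integrable lebesgue K v"
  unfolding locally_integrable_def by blast

lemma locally_integrable_lincomb:
  assumes "locally_integrable \<Omega> u" "locally_integrable \<Omega> v"
  shows "locally_integrable \<Omega> (\<lambda>x. s * u x + t * v x)"
  unfolding locally_integrable_def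
  by (intro allI impI set_integral_add(1) set_integrable_mult_right)
     (use assms in \<open>blast intro: locally_integrableD\<close>)+

lemma locally_integrable_const [simp]: "locally_integrable \<Omega> (\<lambda>x. c)"
  unfolding locally_integrable_def
  by (auto simp: set_integrable_def lmeasurable_iff_integrable[symmetric] lmeasurable_compact)

lemma integrable_imp_locally_integrable:
  assumes "open \<Omega>" "integrable (lebesgue_on \<Omega>) f"
  shows "locally_integrable \<Omega> f"
  unfolding locally_integrable_def
proof (intro allI impI)
  fix K assume K: "compact K \<and> K \<subseteq> \<Omega>"
  have "set_integrable lebesgue \<Omega> f"
    using assms(2)[unfolded integrable_lebesgue_on_open[OF assms(1)]] by (simp add: set_integrable_def)
  then show "set_integrable lebesgue K f"
    by (rule set_integrable_subset) (use K in \<open>auto intro: fmeasurableD lmeasurable_compact\<close>)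
qed

text \<open>Test functions tend to the indicator of the open box, and dominated convergence applies
  with the majorant |w| on that box. The open and the closed box give the same integral.\<close>

lemma integral_cbox_eq_0_of_test:
  fixes w :: "real ^ 'd::finite \<Rightarrow> real"
  assumes "open \<Omega>" "locally_integrable \<Omega> w" "cbox a b \<subseteq> \<Omega>"
    and 0: "\<And>\<phi>. test_function \<Omega> \<phi> \<Longrightarrow> (LINT x|lebesgue_on \<Omega>. w x * \<phi> x) = 0"
  shows "integral (cbox a b) w = 0"
proof -
  obtain \<phi> where \<phi>: "\<And>n. test_function \<Omega> (\<phi> n)" "\<And>n x. \<bar>\<phi> n x\<bar> \<le> indicator (box a b) x"
    "\<And>x. (\<lambda>n. \<phi> n x) \<longlonglongrightarrow> indicator (box a b) x"
    using test_functions_tendsto_indicator_box[OF assms(3)] by metis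
  have box: "box a b \<subseteq> \<Omega>" using assms(3) box_subset_cbox by blast
  have "set_integrable lebesgue (cbox a b) w"
    by (rule locally_integrableD[OF assms(2) compact_cbox assms(3)])
  then have si: "set_integrable lebesgue (box a b) w"
    by (rule set_integrable_subset) (auto simp: box_subset_cbox)
  moreover have eq: "indicator \<Omega> x * (w x * indicator (box a b) x) = indicator (box a b) x *\<^sub>R w x" for x
    using box by (auto simp: indicator_def)
  ultimately have "integrable lebesgue (\<lambda>x. indicator \<Omega> x * (w x * indicator (box a b) x))"
    unfolding set_integrable_def by (simp only: eq)
  then have int: "integrable (lebesgue_on \<Omega>) (\<lambda>x. w x * indicator (box a b) x)"
    using integrable_lebesgue_on_open[OF assms(1)] by simp
  have "(\<lambda>n. LINT x|lebesgue_on \<Omega>. w x * \<phi> n x) \<longlonglongrightarrow> (LINT x|lebesgue_on \<Omega>. w x * indicator (box a b) x)"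
  proof (rule integral_dominated_convergence)
    show "(\<lambda>x. w x * indicator (box a b) x) \<in> borel_measurable (lebesgue_on \<Omega>)"
      using int by (rule borel_measurable_integrable)
    show "(\<lambda>x. w x * \<phi> n x) \<in> borel_measurable (lebesgue_on \<Omega>)" for n
      using integrable_locally_integrable_test[OF assms(1,2) \<phi>(1)] by (rule borel_measurable_integrable)
    show "integrable (lebesgue_on \<Omega>) (\<lambda>x. \<bar>w x * indicator (box a b) x\<bar>)"
      using int by simp
    show "AE x in lebesgue_on \<Omega>. (\<lambda>n. w x * \<phi> n x) \<longlonglongrightarrow> w x * indicator (box a b) x"
      by (intro AE_I2 tendsto_mult tendsto_const \<phi>(3))
    show "AE x in lebesgue_on \<Omega>. norm (w x * \<phi> n x) \<le> \<bar>w x * indicator (box a b) x\<bar>" for n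
      using \<phi>(2)[of n] by (intro AE_I2) (simp add: abs_mult mult_left_mono)
  qed
  then have "(\<lambda>n. 0) \<longlonglongrightarrow> (LINT x|lebesgue_on \<Omega>. w x * indicator (box a b) x)"
    using 0 \<phi>(1) by simp
  then have "(LINT x|lebesgue_on \<Omega>. w x * indicator (box a b) x) = 0"
    using LIMSEQ_unique tendsto_const by metis
  moreover have "(LINT x|lebesgue. indicator \<Omega> x * (w x * indicator (box a b) x)) = (LINT x:box a b|lebesgue. w x)"
    unfolding set_lebesgue_integral_def by (simp only: eq)
  ultimately have "(LINT x:box a b|lebesgue. w x) = 0"
    using integral_lebesgue_on_open[OF assms(1)] by metis
  then show ?thesis
    using set_lebesgue_integral_eq_integral(2)[OF si] integral_open_interval by metis
qed

text \<open>Lebesgue differentiation: at almost every point the value of w is the limit of its means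
  over small cubes with a corner at that point, and all these means are 0.\<close>

lemma AE_eq_0_of_integral_cbox:
  fixes w :: "real ^ 'd::finite \<Rightarrow> real"
  assumes "set_integrable lebesgue (cbox c d) w"
    and 0: "\<And>a b. cbox a b \<subseteq> cbox c d \<Longrightarrow> integral (cbox a b) w = 0"
  shows "AE x in lebesgue. x \<in> cbox c d \<longrightarrow> w x = 0"
proof -
  \<comment> \<open>The differentiation theorem asks for integrability on every box, hence the
    extension by zero.\<close>
  define f where "f x = (if x \<in> cbox c d then w x else 0)" for x
  have "w integrable_on cbox c d" using set_lebesgue_integral_eq_integral(1)[OF assms(1)] .
  then have "f integrable_on UNIV" unfolding f_def by (simp add: integrable_restrict_UNIV)
  then have "f integrable_on cbox a b" for a b
    using integrable_on_subcbox by blast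
  then obtain N where N: "negligible N"
    "\<And>x e. x \<notin> N \<Longrightarrow> 0 < e \<Longrightarrow> \<exists>r>0. \<forall>h. 0 < h \<and> h < r \<longrightarrow>
         norm (integral (cbox x (x + h *\<^sub>R One)) f /\<^sub>R h ^ DIM(real ^ 'd) - f x) < e"
    using integrable_ccontinuous_explicit[of f] by blast
  have z: "w x = 0" if x: "x \<in> box c d" "x \<notin> N" for x
  proof (rule ccontr)
    assume "w x \<noteq> 0"
    then obtain r where r: "r > 0" "\<And>h. 0 < h \<and> h < r \<Longrightarrow>
         norm (integral (cbox x (x + h *\<^sub>R One)) f /\<^sub>R h ^ DIM(real ^ 'd) - f x) < \<bar>w x\<bar>"
      using N(2)[OF x(2), of "\<bar>w x\<bar>"] by auto
    obtain \<epsilon> where \<epsilon>: "\<epsilon> > 0" "ball x \<epsilon> \<subseteq> box c d"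
      using x(1) open_box open_contains_ball by blast
    \<comment> \<open>The norm of \<open>One\<close> is the diagonal of the unit cube, so a cube of
      side h with h * D < \<epsilon> and a corner at x stays inside the ball of radius
      \<epsilon>.\<close>
    define D where "D = norm (One :: real ^ 'd) + 1"
    have D: "D > 0" by (simp add: D_def add_nonneg_pos)
    define h where "h = min (r / 2) (\<epsilon> / (2 * D))"
    have h: "0 < h" "h < r" "h * D < \<epsilon>"
    proof -
      show "0 < h" "h < r" using r \<epsilon> D by (auto simp: h_def min_def)
      have "h * D \<le> \<epsilon> / (2 * D) * D" using D by (intro mult_right_mono) (auto simp: h_def)
      also have "\<dots> < \<epsilon>" using D \<epsilon> by (simp add: field_simps)
      finally show "h * D < \<epsilon>" .
    qed
    have sub: "cbox x (x + h *\<^sub>R One) \<subseteq> box c d"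
    proof
      fix y assume y: "y \<in> cbox x (x + h *\<^sub>R One)"
      have "norm (y - x) \<le> norm (h *\<^sub>R (One :: real ^ 'd))"
        using y by (intro norm_le_componentwise) (auto simp: mem_box algebra_simps h(1) less_imp_le inner_sum_left_Basis abs_le_iff)
      also have "\<dots> < \<epsilon>" using h by (simp add: D_def algebra_simps)
      finally show "y \<in> box c d" using \<epsilon>(2) by (auto simp: dist_norm norm_minus_commute)
    qed
    then have "integral (cbox x (x + h *\<^sub>R One)) f = integral (cbox x (x + h *\<^sub>R One)) w"
      using box_subset_cbox by (intro integral_cong) (auto simp: f_def)
    also have "\<dots> = 0" using sub box_subset_cbox by (intro 0) blast
    finally have "norm (f x) < \<bar>w x\<bar>" using r(2)[of h] h by simp
    moreover have "x \<in> cbox c d" using x(1) box_subset_cbox by blast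
    ultimately show False by (simp add: f_def)
  qed
  \<comment> \<open>A small cube around the argument fits only at interior points; the faces are
    added to the exceptional set.\<close>
  have "negligible (N \<union> (cbox c d - box c d))"
    by (intro negligible_Un N(1) negligible_frontier_interval)
  then have "N \<union> (cbox c d - box c d) \<in> null_sets lebesgue"
    by (simp add: negligible_iff_null_sets)
  then show ?thesis
    by (rule AE_I') (use z in auto)
qed

text \<open>An open set is a countable union of closed boxes, so the exceptional null sets of the
  single boxes add up to a null set.\<close>

lemma AE_eq_0_of_test:
  fixes w :: "real ^ 'd::finite \<Rightarrow> real"
  assumes "open \<Omega>" "locally_integrable \<Omega> w"
    and 0: "\<And>\<phi>. test_function \<Omega> \<phi> \<Longrightarrow> (LINT x|lebesgue_on \<Omega>. w x * \<phi> x) = 0"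
  shows "AE x in lebesgue_on \<Omega>. w x = 0"
proof -
  obtain \<D> where \<D>: "countable \<D>" "\<D> \<subseteq> Pow \<Omega>" "\<And>X. X \<in> \<D> \<Longrightarrow> \<exists>a b. X = cbox a b" "\<Union>\<D> = \<Omega>"
    using open_countable_Union_open_cbox[OF assms(1)] by metis
  have "AE x in lebesgue. x \<in> X \<longrightarrow> w x = 0" if X: "X \<in> \<D>" for X
  proof -
    obtain a b where ab: "X = cbox a b" using \<D>(3)[OF X] by blast
    have sub: "cbox a b \<subseteq> \<Omega>" using \<D>(2) X ab by blast
    show ?thesis unfolding ab
    proof (rule AE_eq_0_of_integral_cbox)
      show "set_integrable lebesgue (cbox a b) w"
        by (rule locally_integrableD[OF assms(2) compact_cbox sub])
      show "integral (cbox a' b') w = 0" if "cbox a' b' \<subseteq> cbox a b" for a' b'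
        using integral_cbox_eq_0_of_test[OF assms(1,2) _ 0] sub that by blast
    qed
  qed
  then have "AE x in lebesgue. \<forall>X\<in>\<D>. x \<in> X \<longrightarrow> w x = 0"
    by (subst AE_ball_countable[OF \<D>(1)]) blast
  then have "AE x in lebesgue. x \<in> \<Omega> \<longrightarrow> w x = 0"
    using \<D>(4) by (auto elim: eventually_mono)
  then show ?thesis using AE_lebesgue_on_open[OF assms(1)] by blast
qed

text \<open>By translation invariance every difference quotient of \<omega> has integral 0, and the
  quotients converge to the partial derivative under an integrable majorant. This is the
  boundary-free form of integration by parts.\<close>

lemma integral_partial_deriv_test:
  fixes \<omega> :: "real ^ 'd::finite \<Rightarrow> real"
  assumes "test_function UNIV \<omega>"
  shows "(LINT x|lebesgue. partial_deriv i \<omega> x) = 0"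
proof -
  let ?e = "axis i 1 :: real ^ 'd"
  obtain K where K: "compact K" "\<And>x. x \<notin> K \<Longrightarrow> \<omega> x = 0" using test_functionE[OF assms] by metis
  obtain B where B: "\<And>x. \<bar>partial_deriv i \<omega> x\<bar> \<le> B"
    using test_function_bounded[OF test_function_partial[OF assms]] by metis
  obtain R where R: "\<And>x. x \<in> K \<Longrightarrow> norm x \<le> R" using K(1) compact_imp_bounded bounded_iff by metis
  have diff: "\<omega> differentiable at x" for x
    using smooth_in_differentiable[OF test_function_smooth[OF assms]] by blast
  have meas: "\<omega> \<in> borel_measurable borel"
    using test_function_continuous[OF assms] by (rule borel_measurable_continuous_onI)
  have measp: "partial_deriv i \<omega> \<in> borel_measurable borel"
    using test_function_continuous[OF test_function_partial[OF assms]] by (rule borel_measurable_continuous_onI)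
  \<comment> \<open>The step 1 / (n + 1) is at most 1, so a quotient of a function supported in the
    ball of radius R vanishes outside the ball of radius R + 1, uniformly in n.\<close>
  define q where "q n x = (\<omega> (x + (1 / real (Suc n)) *\<^sub>R ?e) - \<omega> x) * real (Suc n)" for n x
  have shift: "(LINT x|lborel. \<omega> (x + v)) = (LINT x|lborel. \<omega> x)" for v
  proof -
    have "(LINT x|lborel. \<omega> x) = (LINT x|distr lborel borel ((+) v). \<omega> x)"
      by (simp add: lborel_distr_plus)
    also have "\<dots> = (LINT x|lborel. \<omega> (v + x))"
      using meas by (intro integral_distr) auto
    finally show ?thesis by (simp add: add.commute)
  qed
  obtain C where C: "\<And>x. \<bar>\<omega> x\<bar> \<le> C" using test_function_bounded[OF assms] by metis
  have int0: "integrable lborel \<omega>"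
  proof (rule Bochner_Integration.integrable_bound)
    show "integrable lborel (\<lambda>x. C * indicator (cball 0 R) x)"
      by (intro integrable_mult_right integrable_real_indicator) (use emeasure_bounded_finite[OF bounded_cball] in auto)
    show "AE x in lborel. norm (\<omega> x) \<le> norm (C * indicator (cball 0 R) x)"
    proof (rule AE_I2)
      fix x
      show "norm (\<omega> x) \<le> norm (C * indicator (cball 0 R) x)"
        using C[of x] R[of x] K(2)[of x] by (cases "x \<in> K") (auto simp: indicator_def)
    qed
  qed (use meas in simp)
  have int1: "integrable lborel (\<lambda>x. \<omega> (x + v))" for v
  proof -
    have "integrable (distr lborel borel ((+) v)) \<omega>" using int0 by (simp add: lborel_distr_plus)
    then have "integrable lborel (\<lambda>x. \<omega> (v + x))"
      using meas by (subst (asm) integrable_distr_eq) auto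
    then show ?thesis by (simp add: add.commute)
  qed
  have "(\<lambda>n. LINT x|lborel. q n x) \<longlonglongrightarrow> (LINT x|lborel. partial_deriv i \<omega> x)"
  proof (rule integral_dominated_convergence)
    show "integrable lborel (\<lambda>x. B * indicator (cball 0 (R + 1)) x)"
      by (intro integrable_mult_right integrable_real_indicator) (use emeasure_bounded_finite[OF bounded_cball] in auto)
    show "q n \<in> borel_measurable lborel" for n
      unfolding q_def using meas by measurable
    show "AE x in lborel. (\<lambda>n. q n x) \<longlonglongrightarrow> partial_deriv i \<omega> x"
    proof (rule AE_I2)
      fix x
      have "((\<lambda>s. \<omega> (x + s *\<^sub>R ?e)) has_real_derivative partial_deriv i \<omega> x) (at 0)"
        using line_has_real_derivative[of \<omega> x 0 i] diff by simp
      then have "((\<lambda>s. (\<omega> (x + s *\<^sub>R ?e) - \<omega> x) / s) \<longlongrightarrow> partial_deriv i \<omega> x) (at 0)"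
        by (simp add: has_field_derivative_iff)
      moreover have "filterlim (\<lambda>n. 1 / real (Suc n)) (at 0) sequentially"
        unfolding filterlim_at using LIMSEQ_inverse_real_of_nat by (auto simp: inverse_eq_divide)
      ultimately have "(\<lambda>n. (\<omega> (x + (1 / real (Suc n)) *\<^sub>R ?e) - \<omega> x) / (1 / real (Suc n))) \<longlonglongrightarrow> partial_deriv i \<omega> x"
        by (rule filterlim_compose)
      then show "(\<lambda>n. q n x) \<longlonglongrightarrow> partial_deriv i \<omega> x" by (simp add: q_def)
    qed
    show "AE x in lborel. norm (q n x) \<le> B * indicator (cball 0 (R + 1)) x" for n
    proof (rule AE_I2)
      fix x
      let ?t = "1 / real (Suc n)"
      show "norm (q n x) \<le> B * indicator (cball 0 (R + 1)) x"
      proof (cases "x \<in> cball 0 (R + 1)")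
        case True
        \<comment> \<open>By the mean value theorem the quotient is a value of the partial
          derivative, hence bounded by B independently of n.\<close>
        have "\<exists>z>0. z < ?t \<and> \<omega> (x + ?t *\<^sub>R ?e) - \<omega> (x + 0 *\<^sub>R ?e) = (?t - 0) * partial_deriv i \<omega> (x + z *\<^sub>R ?e)"
          by (intro MVT2 line_has_real_derivative diff) auto
        then obtain z where "\<omega> (x + ?t *\<^sub>R ?e) - \<omega> x = ?t * partial_deriv i \<omega> (x + z *\<^sub>R ?e)"
          by auto
        then have "q n x = partial_deriv i \<omega> (x + z *\<^sub>R ?e)" by (simp add: q_def)
        then show ?thesis using B True by simp
      next
        case False
        then have far: "norm x > R + 1" by simp
        have "norm x \<le> norm (x + ?t *\<^sub>R ?e) + norm (?t *\<^sub>R ?e)"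
          by (metis add_diff_cancel norm_triangle_ineq4)
        moreover have "norm (?t *\<^sub>R ?e) \<le> 1" by simp
        ultimately have "norm (x + ?t *\<^sub>R ?e) > R" "norm x > R" using far by linarith+
        then have "\<omega> (x + ?t *\<^sub>R ?e) = 0" "\<omega> x = 0" using K(2) R by (meson not_le)+
        then show ?thesis using False by (simp add: q_def)
      qed
    qed
  qed (use measp in simp)
  moreover have "(\<lambda>n. LINT x|lborel. q n x) = (\<lambda>n. 0)"
    unfolding q_def using shift int0 int1 by simp
  ultimately have "(LINT x|lborel. partial_deriv i \<omega> x) = 0"
    by (auto dest: LIMSEQ_unique[OF _ tendsto_const])
  then show ?thesis using measp by (simp add: integral_completion)
qed

subsection \<open>Weak derivatives and Sobolev spaces\<close>

abbreviation unit_mi :: "'d::finite \<Rightarrow> 'd multi_index" where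
  "unit_mi i \<equiv> (\<lambda>_. 0)(i := 1)"

section \<open>Multi-indices\<close>

lemma mi_order_0 [simp]: "mi_order (\<lambda>_. 0) = 0"
  by (simp add: mi_order_def)

lemma mi_order_Suc [simp]: "mi_order (\<alpha>(i := Suc (\<alpha> i))) = Suc (mi_order \<alpha>)"
  unfolding mi_order_def by (simp add: sum.remove[of UNIV i])

lemma mi_order_unit [simp]: "mi_order (unit_mi i) = 1"
  using mi_order_Suc[of "\<lambda>_. 0" i] by simp

lemmas [simp] = mi_order_unit[unfolded One_nat_def]

lemma mi_order_eq_0: "mi_order \<alpha> = 0 \<longleftrightarrow> \<alpha> = (\<lambda>_. 0)"
  by (auto simp: mi_order_def)

lemma mi_order_eq_SucE:
  assumes "mi_order \<alpha> = Suc n"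
  obtains i \<beta> where "\<alpha> = \<beta>(i := Suc (\<beta> i))" "mi_order \<beta> = n"
proof -
  obtain i where i: "\<alpha> i \<noteq> 0" using assms mi_order_eq_0[of \<alpha>] by fastforce
  define \<beta> where "\<beta> = \<alpha>(i := \<alpha> i - 1)"
  have "\<alpha> = \<beta>(i := Suc (\<beta> i))" using i by (auto simp: \<beta>_def)
  then show thesis using that[of \<beta> i] assms mi_order_Suc[of \<beta> i] by simp
qed

lemma mi_order_le_1: "{\<alpha>. mi_order \<alpha> \<le> 1} = insert (\<lambda>_. 0) (range unit_mi)"
proof -
  have "\<alpha> = (\<lambda>_. 0) \<or> \<alpha> \<in> range unit_mi" if \<alpha>: "mi_order \<alpha> \<le> 1" for \<alpha> :: "'a multi_index"
  proof (cases "mi_order \<alpha>")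
    case (Suc n)
    then obtain i \<beta> where *: "\<alpha> = \<beta>(i := Suc (\<beta> i))" "mi_order \<beta> = n" by (rule mi_order_eq_SucE)
    then have "\<beta> = (\<lambda>_. 0)" using Suc \<alpha> mi_order_eq_0[of \<beta>] by simp
    then show ?thesis using * by auto
  qed (simp add: mi_order_eq_0)
  then show ?thesis by auto
qed

lemma inj_unit_mi: "inj unit_mi"
  by (rule injI) (metis fun_upd_apply one_neq_zero)

lemma sum_mi_order_le_1:
  fixes F :: "'d::finite multi_index \<Rightarrow> real"
  shows "(\<Sum>\<alpha> | mi_order \<alpha> \<le> 1. F \<alpha>) = F (\<lambda>_. 0) + (\<Sum>i\<in>UNIV. F (unit_mi i))"
proof -
  have nin: "(\<lambda>_. 0) \<notin> range (unit_mi :: 'd \<Rightarrow> _)"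
    by (metis (mono_tags) fun_upd_same imageE zero_neq_one)
  have fin: "finite (range (unit_mi :: 'd \<Rightarrow> _))" by simp
  have eq: "sum F (range unit_mi) = (\<Sum>i\<in>UNIV. F (unit_mi i))"
    using sum.reindex[OF inj_unit_mi, of F] by (simp add: comp_def)
  show ?thesis unfolding mi_order_le_1 sum.insert[OF fin nin] eq ..
qed

lemma finite_mi_order_le: "finite {\<alpha> :: 'd::finite multi_index. mi_order \<alpha> \<le> k}"
proof (rule finite_subset)
  show "{\<alpha> :: 'd multi_index. mi_order \<alpha> \<le> k} \<subseteq> PiE UNIV (\<lambda>_. {..k})"
  proof (safe, simp)
    fix \<alpha> :: "'d multi_index" and i assume "mi_order \<alpha> \<le> k"
    moreover have "\<alpha> i \<le> mi_order \<alpha>" unfolding mi_order_def by (rule member_le_sum) auto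
    ultimately show "\<alpha> i \<le> k" by simp
  qed simp
qed (auto intro: finite_PiE)

section \<open>Square-integrable functions on a bounded open set\<close>

locale bounded_open =
  fixes \<Omega> :: "(real ^ 'd::finite) set"
  assumes open_\<Omega>: "open \<Omega>" and bounded_\<Omega>: "bounded \<Omega>"
begin

text \<open>Completeness of Lebesgue measure is the reason. It makes the representative picked by
  \<open>weak_deriv\<close> measurable as soon as some weak derivative is square integrable.\<close>

lemma borel_measurable_AE_cong:
  fixes f g :: "real ^ 'd \<Rightarrow> real"
  assumes "f \<in> borel_measurable (lebesgue_on \<Omega>)" "AE x in lebesgue_on \<Omega>. f x = g x"
  shows "g \<in> borel_measurable (lebesgue_on \<Omega>)"
proof (rule borel_measurable_if_D, rule borel_measurable_AE)
  show "(\<lambda>x. if x \<in> \<Omega> then f x else 0) \<in> borel_measurable lebesgue"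
    using assms(1) open_\<Omega> by (simp add: borel_measurable_if)
  show "AE x in lebesgue. (if x \<in> \<Omega> then f x else 0) = (if x \<in> \<Omega> then g x else 0)"
    using assms(2) unfolding AE_lebesgue_on_open[OF open_\<Omega>] by (rule eventually_mono) auto
qed

lemma integrable_const_\<Omega>: "integrable (lebesgue_on \<Omega>) (\<lambda>x. c :: real)"
proof -
  have "\<Omega> \<in> lmeasurable" using open_\<Omega> bounded_\<Omega> by (intro bounded_set_imp_lmeasurable) auto
  then interpret finite_measure "lebesgue_on \<Omega>" by (rule finite_measure_lebesgue_on)
  show ?thesis by simp
qed

lemma L2_AE_cong:
  assumes "v \<in> L2_space \<Omega>" "AE x in lebesgue_on \<Omega>. v x = v' x"
  shows "v' \<in> L2_space \<Omega>" and "(LINT x|lebesgue_on \<Omega>. (v x)\<^sup>2) = (LINT x|lebesgue_on \<Omega>. (v' x)\<^sup>2)"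
proof -
  have m: "v \<in> borel_measurable (lebesgue_on \<Omega>)" "v' \<in> borel_measurable (lebesgue_on \<Omega>)"
    using assms borel_measurable_AE_cong unfolding L2_space_def by blast+
  have ae: "AE x in lebesgue_on \<Omega>. (v x)\<^sup>2 = (v' x)\<^sup>2" using assms(2) by (rule eventually_mono) simp
  then show "(LINT x|lebesgue_on \<Omega>. (v x)\<^sup>2) = (LINT x|lebesgue_on \<Omega>. (v' x)\<^sup>2)"
    using m by (intro integral_cong_AE) auto
  have "integrable (lebesgue_on \<Omega>) (\<lambda>x. (v' x)\<^sup>2)"
    using assms(1) m by (intro integrable_cong_AE_imp[OF _ _ ae]) (auto simp: L2_space_def)
  then show "v' \<in> L2_space \<Omega>" using m by (simp add: L2_space_def)
qed

lemma L2_bound: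
  assumes "f \<in> borel_measurable (lebesgue_on \<Omega>)" "integrable (lebesgue_on \<Omega>) g"
    "AE x in lebesgue_on \<Omega>. (f x)\<^sup>2 \<le> g x"
  shows "f \<in> L2_space \<Omega>"
proof -
  have "integrable (lebesgue_on \<Omega>) (\<lambda>x. (f x)\<^sup>2)"
    using assms(1) by (intro Bochner_Integration.integrable_bound[OF assms(2)] eventually_mono[OF assms(3)]) auto
  then show ?thesis using assms by (simp add: L2_space_def)
qed

lemma L2_lincomb:
  assumes "u \<in> L2_space \<Omega>" "v \<in> L2_space \<Omega>"
  shows "(\<lambda>x. s * u x + t * v x) \<in> L2_space \<Omega>"
proof (rule L2_bound)
  show "(\<lambda>x. s * u x + t * v x) \<in> borel_measurable (lebesgue_on \<Omega>)"
    using assms by (auto simp: L2_space_def)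
  show "integrable (lebesgue_on \<Omega>) (\<lambda>x. 2 * s\<^sup>2 * (u x)\<^sup>2 + 2 * t\<^sup>2 * (v x)\<^sup>2)"
    using assms by (auto simp: L2_space_def)
  show "AE x in lebesgue_on \<Omega>. (s * u x + t * v x)\<^sup>2 \<le> 2 * s\<^sup>2 * (u x)\<^sup>2 + 2 * t\<^sup>2 * (v x)\<^sup>2"
  proof (rule AE_I2)
    fix x
    show "(s * u x + t * v x)\<^sup>2 \<le> 2 * s\<^sup>2 * (u x)\<^sup>2 + 2 * t\<^sup>2 * (v x)\<^sup>2"
      using zero_le_power2[of "s * u x - t * v x"] by (simp add: power2_eq_square algebra_simps)
  qed
qed

lemma L2_mult_bounded:
  assumes "u \<in> L2_space \<Omega>" "g \<in> borel_measurable (lebesgue_on \<Omega>)" "\<And>x. x \<in> \<Omega> \<Longrightarrow> \<bar>g x\<bar> \<le> M"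
  shows "(\<lambda>x. u x * g x) \<in> L2_space \<Omega>"
proof (rule L2_bound)
  show "(\<lambda>x. u x * g x) \<in> borel_measurable (lebesgue_on \<Omega>)"
    using assms by (auto simp: L2_space_def)
  show "integrable (lebesgue_on \<Omega>) (\<lambda>x. M\<^sup>2 * (u x)\<^sup>2)"
    using assms by (auto simp: L2_space_def)
  show "AE x in lebesgue_on \<Omega>. (u x * g x)\<^sup>2 \<le> M\<^sup>2 * (u x)\<^sup>2"
  proof (rule AE_I2)
    fix x assume "x \<in> space (lebesgue_on \<Omega>)"
    then have "(g x)\<^sup>2 \<le> M\<^sup>2" using assms(3)[of x] by (intro abs_le_square_iff[THEN iffD1]) auto
    then show "(u x * g x)\<^sup>2 \<le> M\<^sup>2 * (u x)\<^sup>2"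
      by (simp add: power_mult_distrib mult.commute[of "M\<^sup>2"] mult_left_mono)
  qed
qed

lemma L2_locally_integrable:
  assumes "u \<in> L2_space \<Omega>"
  shows "locally_integrable \<Omega> u"
proof (rule integrable_imp_locally_integrable[OF open_\<Omega>], rule Bochner_Integration.integrable_bound)
  show "integrable (lebesgue_on \<Omega>) (\<lambda>x. 1 + (u x)\<^sup>2)"
    using assms integrable_const_\<Omega> by (auto simp: L2_space_def)
  show "u \<in> borel_measurable (lebesgue_on \<Omega>)" using assms by (simp add: L2_space_def)
  show "AE x in lebesgue_on \<Omega>. norm (u x) \<le> norm (1 + (u x)\<^sup>2)"
  proof (rule AE_I2)
    fix x
    \<comment> \<open>Expanded, this reads |u| \<le> 1 + u^2; the constant 1 is integrable because
      the domain is bounded.\<close>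
    have "0 \<le> (\<bar>u x\<bar> - 1)\<^sup>2 + \<bar>u x\<bar>" by simp
    then show "norm (u x) \<le> norm (1 + (u x)\<^sup>2)" by (simp add: power2_diff)
  qed
qed

section \<open>Weak derivatives: linearity, uniqueness, product rule\<close>

lemma integral_test_lincomb:
  assumes "locally_integrable \<Omega> u" "locally_integrable \<Omega> v" "test_function \<Omega> \<phi>"
  shows "(LINT x|lebesgue_on \<Omega>. (s * u x + t * v x) * \<phi> x)
    = s * (LINT x|lebesgue_on \<Omega>. u x * \<phi> x) + t * (LINT x|lebesgue_on \<Omega>. v x * \<phi> x)"
proof -
  have "(\<lambda>x. (s * u x + t * v x) * \<phi> x) = (\<lambda>x. s * (u x * \<phi> x) + t * (v x * \<phi> x))"
    by (simp add: algebra_simps)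
  then show ?thesis
    using integrable_locally_integrable_test[OF open_\<Omega> _ assms(3)] assms(1,2) by simp
qed

lemma has_weak_deriv_integral:
  "has_weak_deriv \<Omega> \<alpha> u v \<Longrightarrow> test_function \<Omega> \<phi> \<Longrightarrow>
    (LINT x|lebesgue_on \<Omega>. u x * multi_deriv \<alpha> \<phi> x) = (- 1) ^ mi_order \<alpha> * (LINT x|lebesgue_on \<Omega>. v x * \<phi> x)"
  unfolding has_weak_deriv_def by blast

lemma has_weak_deriv_lincomb:
  assumes "has_weak_deriv \<Omega> \<alpha> u v" "has_weak_deriv \<Omega> \<alpha> u' v'"
  shows "has_weak_deriv \<Omega> \<alpha> (\<lambda>x. s * u x + t * u' x) (\<lambda>x. s * v x + t * v' x)"
proof -
  have li: "locally_integrable \<Omega> u" "locally_integrable \<Omega> u'" "locally_integrable \<Omega> v" "locally_integrable \<Omega> v'"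
    using assms unfolding has_weak_deriv_def by blast+
  show ?thesis
    unfolding has_weak_deriv_def
  proof (intro conjI allI impI locally_integrable_lincomb li)
    fix \<phi> assume \<phi>: "test_function \<Omega> \<phi>"
    show "(LINT x|lebesgue_on \<Omega>. (s * u x + t * u' x) * multi_deriv \<alpha> \<phi> x)
      = (- 1) ^ mi_order \<alpha> * (LINT x|lebesgue_on \<Omega>. (s * v x + t * v' x) * \<phi> x)"
      unfolding integral_test_lincomb[OF li(1,2) test_function_multi_deriv[OF \<phi>]] integral_test_lincomb[OF li(3,4) \<phi>]
        assms[THEN has_weak_deriv_integral[OF _ \<phi>]]
      by (simp add: algebra_simps)
  qed
qed

text \<open>Both candidates have the same integral against every test function, so the fundamental
  lemma applies to their difference. This is what allows \<open>weak_deriv\<close> to be replaced by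
  any weak derivative at hand.\<close>

lemma has_weak_deriv_AE_unique:
  assumes "has_weak_deriv \<Omega> \<alpha> u v" "has_weak_deriv \<Omega> \<alpha> u v'"
  shows "AE x in lebesgue_on \<Omega>. v x = v' x"
proof -
  have li: "locally_integrable \<Omega> v" "locally_integrable \<Omega> v'"
    using assms unfolding has_weak_deriv_def by blast+
  have "AE x in lebesgue_on \<Omega>. 1 * v x + (- 1) * v' x = 0"
  proof (rule AE_eq_0_of_test[OF open_\<Omega>])
    show "locally_integrable \<Omega> (\<lambda>x. 1 * v x + (- 1) * v' x)"
      using li by (rule locally_integrable_lincomb)
    fix \<phi> assume \<phi>: "test_function \<Omega> \<phi>"
    then have "(- 1) ^ mi_order \<alpha> * (LINT x|lebesgue_on \<Omega>. v x * \<phi> x) = (- 1) ^ mi_order \<alpha> * (LINT x|lebesgue_on \<Omega>. v' x * \<phi> x)"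
      using assms by (simp only: has_weak_deriv_integral[symmetric])
    then have "(LINT x|lebesgue_on \<Omega>. v x * \<phi> x) = (LINT x|lebesgue_on \<Omega>. v' x * \<phi> x)"
      by simp
    then show "(LINT x|lebesgue_on \<Omega>. (1 * v x + (- 1) * v' x) * \<phi> x) = 0"
      using integral_test_lincomb[OF li \<phi>, of 1 "- 1"] by simp
  qed
  then show ?thesis by (rule eventually_mono) auto
qed

lemma has_weak_deriv_weak_deriv: "has_weak_deriv \<Omega> \<alpha> u v \<Longrightarrow> has_weak_deriv \<Omega> \<alpha> u (weak_deriv \<Omega> \<alpha> u)"
  unfolding weak_deriv_def by (rule someI[of "has_weak_deriv \<Omega> \<alpha> u"])

lemma weak_deriv_AE_eq: "has_weak_deriv \<Omega> \<alpha> u v \<Longrightarrow> AE x in lebesgue_on \<Omega>. v x = weak_deriv \<Omega> \<alpha> u x"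
  using has_weak_deriv_AE_unique has_weak_deriv_weak_deriv by blast

lemma locally_integrable_cong:
  assumes "\<And>x. x \<in> \<Omega> \<Longrightarrow> u x = u' x"
  shows "locally_integrable \<Omega> u \<longleftrightarrow> locally_integrable \<Omega> u'"
proof -
  have "set_integrable lebesgue K u \<longleftrightarrow> set_integrable lebesgue K u'" if "K \<subseteq> \<Omega>" for K
    using that assms by (intro set_integrable_cong) auto
  then show ?thesis unfolding locally_integrable_def by blast
qed

lemma has_weak_deriv_cong:
  assumes "\<And>x. x \<in> \<Omega> \<Longrightarrow> u x = u' x" "\<And>x. x \<in> \<Omega> \<Longrightarrow> v x = v' x"
  shows "has_weak_deriv \<Omega> \<alpha> u v \<longleftrightarrow> has_weak_deriv \<Omega> \<alpha> u' v'"
proof -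
  have "(LINT x|lebesgue_on \<Omega>. u x * \<phi> x) = (LINT x|lebesgue_on \<Omega>. u' x * \<phi> x)"
    "(LINT x|lebesgue_on \<Omega>. v x * \<phi> x) = (LINT x|lebesgue_on \<Omega>. v' x * \<phi> x)" for \<phi>
    using assms by (auto intro: Bochner_Integration.integral_cong)
  then show ?thesis
    unfolding has_weak_deriv_def using locally_integrable_cong[of u u'] locally_integrable_cong[of v v'] assms by simp
qed

text \<open>Equality holds at every point and not just almost everywhere, since both sides are
  choices from one and the same predicate.\<close>

lemma weak_deriv_cong:
  assumes "\<And>x. x \<in> \<Omega> \<Longrightarrow> u x = u' x"
  shows "weak_deriv \<Omega> \<alpha> u = weak_deriv \<Omega> \<alpha> u'"
proof -
  have "has_weak_deriv \<Omega> \<alpha> u = has_weak_deriv \<Omega> \<alpha> u'"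
    by (rule ext, rule has_weak_deriv_cong) (simp_all add: assms)
  then show ?thesis by (simp add: weak_deriv_def)
qed

lemma sobolev_norm_cong:
  assumes "\<And>x. x \<in> \<Omega> \<Longrightarrow> u x = u' x"
  shows "sobolev_norm m \<Omega> u = sobolev_norm m \<Omega> u'"
proof -
  have "weak_deriv \<Omega> \<alpha> u = weak_deriv \<Omega> \<alpha> u'" for \<alpha>
    using assms by (rule weak_deriv_cong)
  then show ?thesis by (simp add: sobolev_norm_def)
qed

lemma has_weak_deriv_0: "locally_integrable \<Omega> u \<Longrightarrow> has_weak_deriv \<Omega> (\<lambda>_. 0) u u"
  by (simp add: has_weak_deriv_def)

lemma has_weak_deriv_AE_0:
  assumes "locally_integrable \<Omega> u" "AE x in lebesgue_on \<Omega>. u x = 0"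
  shows "has_weak_deriv \<Omega> \<alpha> u (\<lambda>x. 0)"
proof -
  have "(LINT x|lebesgue_on \<Omega>. u x * \<psi> x) = 0" for \<psi>
    by (intro integral_eq_zero_AE eventually_mono[OF assms(2)]) simp
  then show ?thesis using assms(1) by (simp add: has_weak_deriv_def)
qed

text \<open>With \<phi> a test function, so is \<phi> g. The definition of the weak derivative of u
  is applied to \<phi> g, whose classical product rule yields the additional term; u itself is never
  approximated.\<close>

lemma has_weak_deriv_mult:
  assumes u: "has_weak_deriv \<Omega> (unit_mi i) u v" and g: "smooth_in \<Omega> g"
    and li: "locally_integrable \<Omega> (\<lambda>x. u x * g x)"
    "locally_integrable \<Omega> (\<lambda>x. v x * g x)" "locally_integrable \<Omega> (\<lambda>x. u x * partial_deriv i g x)"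
  shows "has_weak_deriv \<Omega> (unit_mi i) (\<lambda>x. u x * g x) (\<lambda>x. v x * g x + u x * partial_deriv i g x)"
  unfolding has_weak_deriv_def
proof (intro conjI allI impI)
  show "locally_integrable \<Omega> (\<lambda>x. v x * g x + u x * partial_deriv i g x)"
    using locally_integrable_lincomb[OF li(2,3), of 1 1] by simp
  fix \<phi> assume \<phi>: "test_function \<Omega> \<phi>"
  note sm = test_function_smooth[OF \<phi>]
  have \<phi>g: "test_function \<Omega> (\<lambda>x. \<phi> x * g x)" using test_function_mult[OF open_\<Omega> \<phi> g] .
  have pd: "partial_deriv i (\<lambda>x. \<phi> x * g x) x = \<phi> x * partial_deriv i g x + g x * partial_deriv i \<phi> x"
    if "x \<in> \<Omega>" for x
    using that g sm by (intro partial_deriv_mult) (auto intro: smooth_in_differentiable)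
  have I1: "integrable (lebesgue_on \<Omega>) (\<lambda>x. u x * g x * partial_deriv i \<phi> x)"
    by (rule integrable_locally_integrable_test[OF open_\<Omega> li(1) test_function_partial[OF \<phi>]])
  have I2: "integrable (lebesgue_on \<Omega>) (\<lambda>x. u x * partial_deriv i g x * \<phi> x)"
    by (rule integrable_locally_integrable_test[OF open_\<Omega> li(3) \<phi>])
  have I3: "integrable (lebesgue_on \<Omega>) (\<lambda>x. v x * g x * \<phi> x)"
    by (rule integrable_locally_integrable_test[OF open_\<Omega> li(2) \<phi>])
  have "(LINT x|lebesgue_on \<Omega>. u x * partial_deriv i (\<lambda>x. \<phi> x * g x) x) = - (LINT x|lebesgue_on \<Omega>. v x * (\<phi> x * g x))"
    using has_weak_deriv_integral[OF u \<phi>g] multi_deriv_unit[OF test_function_smooth[OF \<phi>g]] by simp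
  moreover have "(LINT x|lebesgue_on \<Omega>. u x * partial_deriv i (\<lambda>x. \<phi> x * g x) x)
    = (LINT x|lebesgue_on \<Omega>. u x * partial_deriv i g x * \<phi> x + u x * g x * partial_deriv i \<phi> x)"
    by (rule Bochner_Integration.integral_cong) (auto simp: pd algebra_simps)
  moreover have "(LINT x|lebesgue_on \<Omega>. v x * (\<phi> x * g x)) = (LINT x|lebesgue_on \<Omega>. v x * g x * \<phi> x)"
    by (rule Bochner_Integration.integral_cong) (auto simp: algebra_simps)
  ultimately have "(LINT x|lebesgue_on \<Omega>. u x * g x * partial_deriv i \<phi> x)
    = - ((LINT x|lebesgue_on \<Omega>. v x * g x * \<phi> x) + (LINT x|lebesgue_on \<Omega>. u x * partial_deriv i g x * \<phi> x))"
    using I1 I2 by simp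
  also have "\<dots> = - (LINT x|lebesgue_on \<Omega>. (v x * g x + u x * partial_deriv i g x) * \<phi> x)"
    using I2 I3 by (simp add: distrib_right)
  finally show "(LINT x|lebesgue_on \<Omega>. u x * g x * multi_deriv (unit_mi i) \<phi> x) =
      (- 1) ^ mi_order (unit_mi i) * (LINT x|lebesgue_on \<Omega>. (v x * g x + u x * partial_deriv i g x) * \<phi> x)"
    using multi_deriv_unit[OF sm] by simp
qed (rule li(1))

lemma test_function_L2:
  assumes "test_function \<Omega> \<phi>"
  shows "\<phi> \<in> L2_space \<Omega>"
proof -
  obtain B where B: "\<And>x. \<bar>\<phi> x\<bar> \<le> B" using test_function_bounded[OF assms] by metis
  have "(\<lambda>x. 1 * \<phi> x) \<in> L2_space \<Omega>"
    using B integrable_const_\<Omega> continuous_on_measurable_lebesgue_on[OF test_function_continuous[OF assms] open_\<Omega>]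
    by (intro L2_mult_bounded[of "\<lambda>_. 1"]) (auto simp: L2_space_def)
  then show ?thesis by simp
qed

text \<open>Integration by parts: the derivative of the product of two test functions has integral 0
  over the whole space.\<close>

lemma has_weak_deriv_test:
  assumes "test_function \<Omega> \<phi>"
  shows "has_weak_deriv \<Omega> (unit_mi i) \<phi> (partial_deriv i \<phi>)"
  unfolding has_weak_deriv_def
proof (intro conjI allI impI)
  note p = test_function_partial[OF assms, of i]
  show li: "locally_integrable \<Omega> \<phi>" "locally_integrable \<Omega> (partial_deriv i \<phi>)"
    using test_function_L2 L2_locally_integrable assms p by blast+
  fix \<psi> assume \<psi>: "test_function \<Omega> \<psi>"
  have sub: "test_function UNIV (\<lambda>x. \<phi> x * \<psi> x)"
    using test_function_mult[OF open_\<Omega> assms smooth_in_subset[OF test_function_smooth[OF \<psi>]]]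
    unfolding test_function_def by auto
  obtain K where K: "compact K" "K \<subseteq> \<Omega>" "\<And>x. x \<notin> K \<Longrightarrow> \<phi> x = 0"
    using test_functionE[OF assms] by metis
  have pd: "partial_deriv i (\<lambda>x. \<phi> x * \<psi> x) x = \<phi> x * partial_deriv i \<psi> x + \<psi> x * partial_deriv i \<phi> x" for x
    using assms \<psi> by (intro partial_deriv_mult smooth_in_differentiable[of UNIV] test_function_smooth) auto
  \<comment> \<open>The product vanishes off a compact subset of \<Omega>, so integrals over
    \<Omega> and over the whole space agree.\<close>
  have z: "partial_deriv i (\<lambda>x. \<phi> x * \<psi> x) x = 0" if "x \<notin> \<Omega>" for x
    using K that by (intro partial_deriv_outside[of K]) (auto intro: compact_imp_closed)
  have "0 = (LINT x|lebesgue. indicator \<Omega> x * partial_deriv i (\<lambda>x. \<phi> x * \<psi> x) x)"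
    unfolding integral_partial_deriv_test[OF sub, of i, symmetric]
    by (rule Bochner_Integration.integral_cong) (auto simp: z indicator_def)
  also have "\<dots> = (LINT x|lebesgue_on \<Omega>. \<phi> x * partial_deriv i \<psi> x + partial_deriv i \<phi> x * \<psi> x)"
    unfolding integral_lebesgue_on_open[OF open_\<Omega>] pd by (simp add: mult.commute)
  also have "\<dots> = (LINT x|lebesgue_on \<Omega>. \<phi> x * partial_deriv i \<psi> x) + (LINT x|lebesgue_on \<Omega>. partial_deriv i \<phi> x * \<psi> x)"
    using integrable_locally_integrable_test[OF open_\<Omega>] li \<psi> test_function_partial[OF \<psi>] by simp
  finally show "(LINT x|lebesgue_on \<Omega>. \<phi> x * multi_deriv (unit_mi i) \<psi> x) =
      (- 1) ^ mi_order (unit_mi i) * (LINT x|lebesgue_on \<Omega>. partial_deriv i \<phi> x * \<psi> x)"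
    using multi_deriv_unit[OF test_function_smooth[OF \<psi>]] by simp
qed

section \<open>Sobolev spaces of integer order\<close>

lemma sobolev_space_0: "sobolev_space 0 \<Omega> = L2_space \<Omega>"
  unfolding sobolev_space_def le_zero_eq mi_order_eq_0 using has_weak_deriv_0 L2_locally_integrable by blast

lemma sobolev_space_mono: "m \<le> n \<Longrightarrow> sobolev_space n \<Omega> \<subseteq> sobolev_space m \<Omega>"
  unfolding sobolev_space_def by auto

lemma sobolev_space_L2: "u \<in> sobolev_space m \<Omega> \<Longrightarrow> u \<in> L2_space \<Omega>"
  unfolding sobolev_space_def by blast

lemma sobolev_spaceE:
  assumes "u \<in> sobolev_space m \<Omega>" "mi_order \<alpha> \<le> m"
  obtains v where "v \<in> L2_space \<Omega>" "has_weak_deriv \<Omega> \<alpha> u v"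
  using assms unfolding sobolev_space_def by blast

lemma sobolev_spaceI:
  assumes "u \<in> L2_space \<Omega>" "\<And>\<alpha>. mi_order \<alpha> \<le> m \<Longrightarrow> \<exists>v\<in>L2_space \<Omega>. has_weak_deriv \<Omega> \<alpha> u v"
  shows "u \<in> sobolev_space m \<Omega>"
  using assms unfolding sobolev_space_def by blast

text \<open>This recursive description reduces statements about order m to first-order weak
  derivatives, in particular the stability under products in
  \<open>sobolev_space_mult\<close>.\<close>

lemma sobolev_space_Suc_iff:
  "u \<in> sobolev_space (Suc m) \<Omega> \<longleftrightarrow>
     u \<in> L2_space \<Omega> \<and> (\<forall>i. \<exists>v\<in>sobolev_space m \<Omega>. has_weak_deriv \<Omega> (unit_mi i) u v)"
proof
  assume u: "u \<in> sobolev_space (Suc m) \<Omega>"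
  show "u \<in> L2_space \<Omega> \<and> (\<forall>i. \<exists>v\<in>sobolev_space m \<Omega>. has_weak_deriv \<Omega> (unit_mi i) u v)"
  proof (intro conjI allI)
    show "u \<in> L2_space \<Omega>" using u by (rule sobolev_space_L2)
    fix i :: 'd
    have "mi_order (unit_mi i) \<le> Suc m" by (simp only: mi_order_unit)
    then obtain v where v: "v \<in> L2_space \<Omega>" "has_weak_deriv \<Omega> (unit_mi i) u v"
      by (rule sobolev_spaceE[OF u])
    have w: "\<exists>w\<in>L2_space \<Omega>. has_weak_deriv \<Omega> \<beta> v w" if \<beta>: "mi_order \<beta> \<le> m" for \<beta>
    proof -
      \<comment> \<open>The weak derivative of v for \<beta> is that of u for \<beta> with entry i
        raised by one. To see this, the relation between u and v is tested with the derivative of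
        \<phi> for \<beta>, again a test function; the extra sign cancels against the exponent
        \<open>Suc\<close>.\<close>
      obtain w where w: "w \<in> L2_space \<Omega>" "has_weak_deriv \<Omega> (\<beta>(i := Suc (\<beta> i))) u w"
        using sobolev_spaceE[OF u, of "\<beta>(i := Suc (\<beta> i))"] \<beta> by auto
      have "(LINT x|lebesgue_on \<Omega>. v x * multi_deriv \<beta> \<phi> x) = (- 1) ^ mi_order \<beta> * (LINT x|lebesgue_on \<Omega>. w x * \<phi> x)"
        if \<phi>: "test_function \<Omega> \<phi>" for \<phi>
      proof -
        note sm = test_function_smooth[OF \<phi>]
        have "(LINT x|lebesgue_on \<Omega>. u x * multi_deriv (unit_mi i) (multi_deriv \<beta> \<phi>) x) = - (LINT x|lebesgue_on \<Omega>. v x * multi_deriv \<beta> \<phi> x)"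
          by (simp only: has_weak_deriv_integral[OF v(2) test_function_multi_deriv[OF \<phi>]]) simp
        moreover have "multi_deriv (unit_mi i) (multi_deriv \<beta> \<phi>) = multi_deriv (\<beta>(i := Suc (\<beta> i))) \<phi>"
          using multi_deriv_unit[OF smooth_in_multi_deriv[OF sm]] multi_deriv_Suc(1)[OF sm] by simp
        moreover have "(LINT x|lebesgue_on \<Omega>. u x * multi_deriv (\<beta>(i := Suc (\<beta> i))) \<phi> x) = (- 1) ^ Suc (mi_order \<beta>) * (LINT x|lebesgue_on \<Omega>. w x * \<phi> x)"
          using has_weak_deriv_integral[OF w(2) \<phi>] by simp
        ultimately show ?thesis by simp
      qed
      then show ?thesis using w v L2_locally_integrable unfolding has_weak_deriv_def by blast
    qed
    show "\<exists>v\<in>sobolev_space m \<Omega>. has_weak_deriv \<Omega> (unit_mi i) u v"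
      using v(2) sobolev_spaceI[OF v(1), of m] w by blast
  qed
next
  assume u: "u \<in> L2_space \<Omega> \<and> (\<forall>i. \<exists>v\<in>sobolev_space m \<Omega>. has_weak_deriv \<Omega> (unit_mi i) u v)"
  have w: "\<exists>w\<in>L2_space \<Omega>. has_weak_deriv \<Omega> \<alpha> u w" if \<alpha>: "mi_order \<alpha> \<le> Suc m" for \<alpha>
  proof (cases "mi_order \<alpha>")
    case 0
    then show ?thesis using u has_weak_deriv_0[OF L2_locally_integrable] unfolding mi_order_eq_0 by blast
  next
    case (Suc n)
    then obtain i \<beta> where \<beta>: "\<alpha> = \<beta>(i := Suc (\<beta> i))" "mi_order \<beta> = n" by (rule mi_order_eq_SucE)
    obtain v where v: "v \<in> sobolev_space m \<Omega>" "has_weak_deriv \<Omega> (unit_mi i) u v" using u by blast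
    then obtain w where w: "w \<in> L2_space \<Omega>" "has_weak_deriv \<Omega> \<beta> v w"
      using \<beta> \<alpha> Suc by (auto elim: sobolev_spaceE)
    have "(LINT x|lebesgue_on \<Omega>. u x * multi_deriv \<alpha> \<phi> x) = (- 1) ^ mi_order \<alpha> * (LINT x|lebesgue_on \<Omega>. w x * \<phi> x)"
      if \<phi>: "test_function \<Omega> \<phi>" for \<phi>
    proof -
      note sm = test_function_smooth[OF \<phi>]
      have "(LINT x|lebesgue_on \<Omega>. u x * multi_deriv (unit_mi i) (multi_deriv \<beta> \<phi>) x) = - (LINT x|lebesgue_on \<Omega>. v x * multi_deriv \<beta> \<phi> x)"
        by (simp only: has_weak_deriv_integral[OF v(2) test_function_multi_deriv[OF \<phi>]]) simp
      moreover have "multi_deriv (unit_mi i) (multi_deriv \<beta> \<phi>) = multi_deriv \<alpha> \<phi>"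
        using multi_deriv_unit[OF smooth_in_multi_deriv[OF sm]] multi_deriv_Suc(1)[OF sm] \<beta> by simp
      moreover have "(LINT x|lebesgue_on \<Omega>. v x * multi_deriv \<beta> \<phi> x) = (- 1) ^ mi_order \<beta> * (LINT x|lebesgue_on \<Omega>. w x * \<phi> x)"
        using has_weak_deriv_integral[OF w(2) \<phi>] by simp
      ultimately show ?thesis using \<beta> by simp
    qed
    then show ?thesis using w u L2_locally_integrable unfolding has_weak_deriv_def by blast
  qed
  show "u \<in> sobolev_space (Suc m) \<Omega>" by (rule sobolev_spaceI[OF conjunct1[OF u]]) (rule w)
qed

lemma sobolev_space_1_iff:
  "u \<in> sobolev_space 1 \<Omega> \<longleftrightarrow> u \<in> L2_space \<Omega> \<and> (\<forall>i. \<exists>v\<in>L2_space \<Omega>. has_weak_deriv \<Omega> (unit_mi i) u v)"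
  using sobolev_space_Suc_iff[of u 0] by (simp add: sobolev_space_0)

lemma sobolev_space_lincomb:
  assumes "u \<in> sobolev_space m \<Omega>" "v \<in> sobolev_space m \<Omega>"
  shows "(\<lambda>x. s * u x + t * v x) \<in> sobolev_space m \<Omega>"
proof (rule sobolev_spaceI)
  show "(\<lambda>x. s * u x + t * v x) \<in> L2_space \<Omega>"
    using assms by (intro L2_lincomb sobolev_space_L2)
  fix \<alpha> :: "'d multi_index" assume \<alpha>: "mi_order \<alpha> \<le> m"
  obtain u' where u': "u' \<in> L2_space \<Omega>" "has_weak_deriv \<Omega> \<alpha> u u'"
    using assms(1) \<alpha> by (rule sobolev_spaceE)
  obtain v' where v': "v' \<in> L2_space \<Omega>" "has_weak_deriv \<Omega> \<alpha> v v'"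
    using assms(2) \<alpha> by (rule sobolev_spaceE)
  show "\<exists>w\<in>L2_space \<Omega>. has_weak_deriv \<Omega> \<alpha> (\<lambda>x. s * u x + t * v x) w"
    using has_weak_deriv_lincomb[OF u'(2) v'(2)] L2_lincomb[OF u'(1) v'(1)] by blast
qed

lemma smooth_in_measurable:
  "smooth_in \<Omega> g \<Longrightarrow> g \<in> borel_measurable (lebesgue_on \<Omega>)"
  using continuous_on_measurable_lebesgue_on[OF smooth_in_continuous_on open_\<Omega>] .

section \<open>Multiplication by functions smooth up to the boundary\<close>

lemma smooth_on_closure_bounded:
  assumes "smooth_on_closure \<Omega> g"
  obtains M where "\<And>x. x \<in> \<Omega> \<Longrightarrow> \<bar>g x\<bar> \<le> M" "\<And>x i. x \<in> \<Omega> \<Longrightarrow> \<bar>partial_deriv i g x\<bar> \<le> M"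
proof -
  have sm: "smooth_upto \<Omega> (closure \<Omega>) (Suc 0) g" using assms unfolding smooth_on_closure_iff by blast
  obtain M where M: "\<And>x. x \<in> \<Omega> \<Longrightarrow> \<bar>g x\<bar> \<le> M"
    using sm extends_cont_bounded[OF bounded_\<Omega>] smooth_upto_extends by metis
  have "\<exists>M. \<forall>x\<in>\<Omega>. \<bar>partial_deriv i g x\<bar> \<le> M" for i
    using sm extends_cont_bounded[OF bounded_\<Omega>, of "partial_deriv i g"] unfolding smooth_upto.simps by metis
  then obtain N where N: "\<And>i x. x \<in> \<Omega> \<Longrightarrow> \<bar>partial_deriv i g x\<bar> \<le> N i" by metis
  have "\<bar>partial_deriv i g x\<bar> \<le> \<bar>M\<bar> + (\<Sum>j\<in>UNIV. \<bar>N j\<bar>)" if "x \<in> \<Omega>" for i x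
    using N[OF that, of i] member_le_sum[of i UNIV "\<lambda>j. \<bar>N j\<bar>"] by auto
  moreover have "\<bar>g x\<bar> \<le> \<bar>M\<bar> + (\<Sum>j\<in>UNIV. \<bar>N j\<bar>)" if "x \<in> \<Omega>" for x
  proof -
    have "0 \<le> (\<Sum>j\<in>UNIV. \<bar>N j\<bar>)" by (simp add: sum_nonneg)
    then show ?thesis using M[OF that] by linarith
  qed
  ultimately show thesis using that by blast
qed

lemma L2_mult_smooth:
  assumes "u \<in> L2_space \<Omega>" "smooth_on_closure \<Omega> g"
  shows "(\<lambda>x. u x * g x) \<in> L2_space \<Omega>" "(\<lambda>x. u x * partial_deriv i g x) \<in> L2_space \<Omega>"
proof -
  obtain M where M: "\<And>x. x \<in> \<Omega> \<Longrightarrow> \<bar>g x\<bar> \<le> M" "\<And>x i. x \<in> \<Omega> \<Longrightarrow> \<bar>partial_deriv i g x\<bar> \<le> M"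
    using smooth_on_closure_bounded[OF assms(2)] by metis
  have g: "smooth_in \<Omega> g" using assms(2) by (rule smooth_on_closure_smooth_in)
  show "(\<lambda>x. u x * g x) \<in> L2_space \<Omega>" "(\<lambda>x. u x * partial_deriv i g x) \<in> L2_space \<Omega>"
    using M g smooth_in_partial[OF g] by (auto intro!: L2_mult_bounded[OF assms(1)] smooth_in_measurable)
qed

lemma has_weak_deriv_mult_smooth:
  assumes "u \<in> L2_space \<Omega>" "v \<in> L2_space \<Omega>" "has_weak_deriv \<Omega> (unit_mi i) u v" "smooth_on_closure \<Omega> g"
  shows "has_weak_deriv \<Omega> (unit_mi i) (\<lambda>x. u x * g x) (\<lambda>x. v x * g x + u x * partial_deriv i g x)"
  using assms by (intro has_weak_deriv_mult L2_locally_integrable L2_mult_smooth smooth_on_closure_smooth_in)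

text \<open>The induction leaves both factors arbitrary, because the product rule pairs the
  derivative of u with g, and u with the derivative of g.\<close>

lemma sobolev_space_mult:
  assumes "u \<in> sobolev_space m \<Omega>" "smooth_on_closure \<Omega> g"
  shows "(\<lambda>x. u x * g x) \<in> sobolev_space m \<Omega>"
  using assms
proof (induction m arbitrary: u g)
  case 0
  then show ?case by (simp add: sobolev_space_0 L2_mult_smooth)
next
  case (Suc m)
  note uL = sobolev_space_L2[OF Suc.prems(1)]
  have um: "u \<in> sobolev_space m \<Omega>" using Suc.prems(1) sobolev_space_mono[of m "Suc m"] by auto
  show ?case unfolding sobolev_space_Suc_iff
  proof (intro conjI allI)
    show "(\<lambda>x. u x * g x) \<in> L2_space \<Omega>" using uL Suc.prems(2) by (rule L2_mult_smooth)
    fix i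
    obtain v where v: "v \<in> sobolev_space m \<Omega>" "has_weak_deriv \<Omega> (unit_mi i) u v"
      using Suc.prems(1) unfolding sobolev_space_Suc_iff by blast
    obtain g' where g': "smooth_on_closure \<Omega> g'" "\<And>x. x \<in> \<Omega> \<Longrightarrow> g' x = partial_deriv i g x"
      using smooth_on_closure_partial[OF open_\<Omega> Suc.prems(2)] by metis
    have "(\<lambda>x. 1 * (v x * g x) + 1 * (u x * g' x)) \<in> sobolev_space m \<Omega>"
      using Suc.IH v um g' Suc.prems(2) by (intro sobolev_space_lincomb) auto
    moreover have "has_weak_deriv \<Omega> (unit_mi i) (\<lambda>x. u x * g x) (\<lambda>x. v x * g x + u x * partial_deriv i g x)"
      using uL sobolev_space_L2[OF v(1)] v(2) Suc.prems(2) by (rule has_weak_deriv_mult_smooth)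
    ultimately show "\<exists>v\<in>sobolev_space m \<Omega>. has_weak_deriv \<Omega> (unit_mi i) (\<lambda>x. u x * g x) v"
      using has_weak_deriv_cong[of "\<lambda>x. u x * g x" "\<lambda>x. u x * g x" "\<lambda>x. v x * g x + u x * partial_deriv i g x"
          "\<lambda>x. 1 * (v x * g x) + 1 * (u x * g' x)"] g'(2) by auto
  qed
qed

end

subsection \<open>The space \<open>H\<^sup>1\<close>\<close>

context bounded_open
begin

lemma has_weak_deriv_H1:
  assumes "u \<in> sobolev_space 1 \<Omega>"
  shows "has_weak_deriv \<Omega> (unit_mi i) u (weak_deriv \<Omega> (unit_mi i) u)"
    and "weak_deriv \<Omega> (unit_mi i) u \<in> L2_space \<Omega>"
proof -
  obtain v where v: "v \<in> L2_space \<Omega>" "has_weak_deriv \<Omega> (unit_mi i) u v"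
    using assms unfolding sobolev_space_1_iff by blast
  show "has_weak_deriv \<Omega> (unit_mi i) u (weak_deriv \<Omega> (unit_mi i) u)"
    using v(2) by (rule has_weak_deriv_weak_deriv)
  show "weak_deriv \<Omega> (unit_mi i) u \<in> L2_space \<Omega>"
    using L2_AE_cong(1)[OF v(1) weak_deriv_AE_eq[OF v(2)]] .
qed

lemma integral_weak_deriv_sq:
  assumes "has_weak_deriv \<Omega> \<alpha> u v" "v \<in> L2_space \<Omega>"
  shows "(LINT x|lebesgue_on \<Omega>. (weak_deriv \<Omega> \<alpha> u x)\<^sup>2) = (LINT x|lebesgue_on \<Omega>. (v x)\<^sup>2)"
  using L2_AE_cong(2)[OF assms(2) weak_deriv_AE_eq[OF assms(1)]] by simp

text \<open>Frees the norm from the choices inside \<open>weak_deriv\<close>: any square-integrable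
  weak derivatives may be inserted. This concerns order 0 too, where the selected derivative equals
  u only almost everywhere.\<close>

lemma sobolev_norm_1_sq:
  assumes "u \<in> L2_space \<Omega>" "\<And>i. has_weak_deriv \<Omega> (unit_mi i) u (v i)" "\<And>i. v i \<in> L2_space \<Omega>"
  shows "(sobolev_norm 1 \<Omega> u)\<^sup>2 = (LINT x|lebesgue_on \<Omega>. (u x)\<^sup>2) + (\<Sum>i\<in>UNIV. LINT x|lebesgue_on \<Omega>. (v i x)\<^sup>2)"
proof -
  have "(sobolev_norm 1 \<Omega> u)\<^sup>2 = (\<Sum>\<alpha> | mi_order \<alpha> \<le> 1. LINT x|lebesgue_on \<Omega>. (weak_deriv \<Omega> \<alpha> u x)\<^sup>2)"
    unfolding sobolev_norm_def by (intro real_sqrt_pow2 sum_nonneg integral_nonneg_AE) simp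
  also have "\<dots> = (LINT x|lebesgue_on \<Omega>. (weak_deriv \<Omega> (\<lambda>_. 0) u x)\<^sup>2)
      + (\<Sum>i\<in>UNIV. LINT x|lebesgue_on \<Omega>. (weak_deriv \<Omega> (unit_mi i) u x)\<^sup>2)"
    by (rule sum_mi_order_le_1)
  also have "(LINT x|lebesgue_on \<Omega>. (weak_deriv \<Omega> (\<lambda>_. 0) u x)\<^sup>2) = (LINT x|lebesgue_on \<Omega>. (u x)\<^sup>2)"
    using assms(1) by (intro integral_weak_deriv_sq has_weak_deriv_0 L2_locally_integrable)
  also have "(\<Sum>i\<in>UNIV. LINT x|lebesgue_on \<Omega>. (weak_deriv \<Omega> (unit_mi i) u x)\<^sup>2)
      = (\<Sum>i\<in>UNIV. LINT x|lebesgue_on \<Omega>. (v i x)\<^sup>2)"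
    by (intro sum.cong refl integral_weak_deriv_sq assms)
  finally show ?thesis .
qed

lemma sobolev_norm_nonneg: "0 \<le> sobolev_norm m \<Omega> u"
  unfolding sobolev_norm_def by (intro real_sqrt_ge_zero sum_nonneg integral_nonneg_AE) simp

lemma sobolev_seminorm_nonneg: "0 \<le> sobolev_seminorm m \<Omega> u"
  unfolding sobolev_seminorm_def by (intro real_sqrt_ge_zero sum_nonneg integral_nonneg_AE) simp

lemma integral_sq_lincomb_le:
  assumes "u \<in> L2_space \<Omega>" "v \<in> L2_space \<Omega>"
  shows "(LINT x|lebesgue_on \<Omega>. (s * u x + t * v x)\<^sup>2)
    \<le> 2 * s\<^sup>2 * (LINT x|lebesgue_on \<Omega>. (u x)\<^sup>2) + 2 * t\<^sup>2 * (LINT x|lebesgue_on \<Omega>. (v x)\<^sup>2)"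
proof -
  have "(LINT x|lebesgue_on \<Omega>. (s * u x + t * v x)\<^sup>2)
    \<le> (LINT x|lebesgue_on \<Omega>. 2 * s\<^sup>2 * (u x)\<^sup>2 + 2 * t\<^sup>2 * (v x)\<^sup>2)"
  proof (rule integral_mono)
    show "integrable (lebesgue_on \<Omega>) (\<lambda>x. (s * u x + t * v x)\<^sup>2)"
      using L2_lincomb[OF assms] by (simp add: L2_space_def)
    show "(s * u x + t * v x)\<^sup>2 \<le> 2 * s\<^sup>2 * (u x)\<^sup>2 + 2 * t\<^sup>2 * (v x)\<^sup>2" for x
      using zero_le_power2[of "s * u x - t * v x"] by (simp add: power2_eq_square algebra_simps)
  qed (use assms in \<open>auto simp: L2_space_def\<close>)
  then show ?thesis using assms by (simp add: L2_space_def)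
qed

lemma integral_sq_mult_le:
  assumes "u \<in> L2_space \<Omega>" "(\<lambda>x. u x * g x) \<in> L2_space \<Omega>" "\<And>x. x \<in> \<Omega> \<Longrightarrow> \<bar>g x\<bar> \<le> M"
  shows "(LINT x|lebesgue_on \<Omega>. (u x * g x)\<^sup>2) \<le> M\<^sup>2 * (LINT x|lebesgue_on \<Omega>. (u x)\<^sup>2)"
proof -
  have "(LINT x|lebesgue_on \<Omega>. (u x * g x)\<^sup>2) \<le> (LINT x|lebesgue_on \<Omega>. M\<^sup>2 * (u x)\<^sup>2)"
  proof (rule integral_mono)
    fix x assume "x \<in> space (lebesgue_on \<Omega>)"
    then have "(g x)\<^sup>2 \<le> M\<^sup>2" using assms(3)[of x] by (intro abs_le_square_iff[THEN iffD1]) auto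
    then show "(u x * g x)\<^sup>2 \<le> M\<^sup>2 * (u x)\<^sup>2"
      by (simp add: power_mult_distrib mult.commute[of "M\<^sup>2"] mult_left_mono)
  qed (use assms in \<open>auto simp: L2_space_def\<close>)
  then show ?thesis by simp
qed

text \<open>A substitute for the triangle inequality that follows termwise from (p + q)^2 \<le> 2
  p^2 + 2 q^2; the factor 2 is irrelevant for density arguments.\<close>

lemma sobolev_norm_1_lincomb_le:
  assumes "u \<in> sobolev_space 1 \<Omega>" "v \<in> sobolev_space 1 \<Omega>"
  shows "(sobolev_norm 1 \<Omega> (\<lambda>x. s * u x + t * v x))\<^sup>2
    \<le> 2 * s\<^sup>2 * (sobolev_norm 1 \<Omega> u)\<^sup>2 + 2 * t\<^sup>2 * (sobolev_norm 1 \<Omega> v)\<^sup>2"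
proof -
  note uv = assms[THEN sobolev_space_L2]
  note du = has_weak_deriv_H1[OF assms(1)] and dv = has_weak_deriv_H1[OF assms(2)]
  have "(sobolev_norm 1 \<Omega> (\<lambda>x. s * u x + t * v x))\<^sup>2 = (LINT x|lebesgue_on \<Omega>. (s * u x + t * v x)\<^sup>2)
    + (\<Sum>i\<in>UNIV. LINT x|lebesgue_on \<Omega>. (s * weak_deriv \<Omega> (unit_mi i) u x + t * weak_deriv \<Omega> (unit_mi i) v x)\<^sup>2)"
    by (intro sobolev_norm_1_sq L2_lincomb has_weak_deriv_lincomb uv du dv)
  also have "\<dots> \<le> (2 * s\<^sup>2 * (LINT x|lebesgue_on \<Omega>. (u x)\<^sup>2) + 2 * t\<^sup>2 * (LINT x|lebesgue_on \<Omega>. (v x)\<^sup>2))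
    + (\<Sum>i\<in>UNIV. 2 * s\<^sup>2 * (LINT x|lebesgue_on \<Omega>. (weak_deriv \<Omega> (unit_mi i) u x)\<^sup>2)
        + 2 * t\<^sup>2 * (LINT x|lebesgue_on \<Omega>. (weak_deriv \<Omega> (unit_mi i) v x)\<^sup>2))"
    by (intro add_mono sum_mono integral_sq_lincomb_le uv du dv)
  also have "\<dots> = 2 * s\<^sup>2 * (sobolev_norm 1 \<Omega> u)\<^sup>2 + 2 * t\<^sup>2 * (sobolev_norm 1 \<Omega> v)\<^sup>2"
    unfolding sobolev_norm_1_sq[OF uv(1) du] sobolev_norm_1_sq[OF uv(2) dv]
    by (simp add: sum.distrib sum_distrib_left algebra_simps)
  finally show ?thesis .
qed

lemma sobolev_norm_1_mult_le:
  assumes u: "u \<in> sobolev_space 1 \<Omega>" and g: "smooth_on_closure \<Omega> g" and "M \<ge> 0"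
    and M: "\<And>x. x \<in> \<Omega> \<Longrightarrow> \<bar>g x\<bar> \<le> M" "\<And>x i. x \<in> \<Omega> \<Longrightarrow> \<bar>partial_deriv i g x\<bar> \<le> M"
  shows "sobolev_norm 1 \<Omega> (\<lambda>x. u x * g x) \<le> sqrt (2 + 2 * real CARD('d)) * M * sobolev_norm 1 \<Omega> u"
proof (rule power2_le_imp_le)
  note uL = sobolev_space_L2[OF u] and du = has_weak_deriv_H1[OF u]
  let ?D = "\<lambda>i. weak_deriv \<Omega> (unit_mi i) u"
  let ?I = "\<lambda>f. LINT x|lebesgue_on \<Omega>. (f x)\<^sup>2"
  have L2: "(\<lambda>x. ?D i x * g x + u x * partial_deriv i g x) \<in> L2_space \<Omega>" for i
    using L2_lincomb[OF L2_mult_smooth(1)[OF du(2) g] L2_mult_smooth(2)[OF uL g], of 1 i 1 i] by simp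
  have step: "?I (\<lambda>x. ?D i x * g x + u x * partial_deriv i g x) \<le> 2 * (M\<^sup>2 * ?I (?D i)) + 2 * (M\<^sup>2 * ?I u)" for i
  proof -
    have "?I (\<lambda>x. ?D i x * g x + u x * partial_deriv i g x)
       \<le> 2 * ?I (\<lambda>x. ?D i x * g x) + 2 * ?I (\<lambda>x. u x * partial_deriv i g x)"
      using integral_sq_lincomb_le[OF L2_mult_smooth(1)[OF du(2) g] L2_mult_smooth(2)[OF uL g], of 1 i 1 i] by simp
    also have "\<dots> \<le> 2 * (M\<^sup>2 * ?I (?D i)) + 2 * (M\<^sup>2 * ?I u)"
      using integral_sq_mult_le[OF du(2) L2_mult_smooth(1)[OF du(2) g] M(1)]
        integral_sq_mult_le[OF uL L2_mult_smooth(2)[OF uL g] M(2)]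
      by (intro add_mono mult_left_mono) auto
    finally show ?thesis .
  qed
  have nn: "0 \<le> ?I f" for f :: "real ^ 'd \<Rightarrow> real" by (intro integral_nonneg_AE) simp
  have "(sobolev_norm 1 \<Omega> (\<lambda>x. u x * g x))\<^sup>2
    = ?I (\<lambda>x. u x * g x) + (\<Sum>i\<in>UNIV. ?I (\<lambda>x. ?D i x * g x + u x * partial_deriv i g x))"
    by (intro sobolev_norm_1_sq L2 has_weak_deriv_mult_smooth L2_mult_smooth uL du g)
  also have "\<dots> \<le> M\<^sup>2 * ?I u + (\<Sum>i\<in>UNIV. 2 * (M\<^sup>2 * ?I (?D i)) + 2 * (M\<^sup>2 * ?I u))"
    by (intro add_mono sum_mono step integral_sq_mult_le[OF uL L2_mult_smooth(1)[OF uL g] M(1)])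
  \<comment> \<open>The integral of u^2 enters once through the function and twice through each of
    the d partial derivatives, those of the derivatives enter twice. Both 1 + 2 d and 2 are at most
    2 + 2 d, the constant in the claim.\<close>
  also have "\<dots> = M\<^sup>2 * ((1 + 2 * real CARD('d)) * ?I u + 2 * (\<Sum>i\<in>UNIV. ?I (?D i)))"
    by (simp add: sum.distrib sum_distrib_left algebra_simps)
  also have "\<dots> \<le> M\<^sup>2 * ((2 + 2 * real CARD('d)) * ?I u + (2 + 2 * real CARD('d)) * (\<Sum>i\<in>UNIV. ?I (?D i)))"
    by (intro mult_left_mono add_mono mult_right_mono sum_nonneg nn) auto
  also have "\<dots> = (2 + 2 * real CARD('d)) * M\<^sup>2 * (sobolev_norm 1 \<Omega> u)\<^sup>2"
    unfolding sobolev_norm_1_sq[OF uL du] by (simp add: algebra_simps)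
  also have "\<dots> = (sqrt (2 + 2 * real CARD('d)) * M * sobolev_norm 1 \<Omega> u)\<^sup>2"
    by (simp add: power_mult_distrib)
  finally show "(sobolev_norm 1 \<Omega> (\<lambda>x. u x * g x))\<^sup>2 \<le> (sqrt (2 + 2 * real CARD('d)) * M * sobolev_norm 1 \<Omega> u)\<^sup>2" .
  show "0 \<le> sqrt (2 + 2 * real CARD('d)) * M * sobolev_norm 1 \<Omega> u"
    using \<open>M \<ge> 0\<close> sobolev_norm_nonneg by simp
qed

lemma sobolev_norm_1_eq_0_AE:
  assumes u: "u \<in> sobolev_space 1 \<Omega>" and "sobolev_norm 1 \<Omega> u = 0"
  shows "AE x in lebesgue_on \<Omega>. u x = 0"
proof -
  have "(LINT x|lebesgue_on \<Omega>. (u x)\<^sup>2) + (\<Sum>i\<in>UNIV. LINT x|lebesgue_on \<Omega>. (weak_deriv \<Omega> (unit_mi i) u x)\<^sup>2) = 0"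
    using sobolev_norm_1_sq[OF sobolev_space_L2[OF u] has_weak_deriv_H1[OF u]] assms(2) by simp
  moreover have "0 \<le> (LINT x|lebesgue_on \<Omega>. (u x)\<^sup>2)" by (intro integral_nonneg_AE) simp
  moreover have "0 \<le> (\<Sum>i\<in>UNIV. LINT x|lebesgue_on \<Omega>. (weak_deriv \<Omega> (unit_mi i) u x)\<^sup>2)"
    by (intro sum_nonneg integral_nonneg_AE) simp
  ultimately have "(LINT x|lebesgue_on \<Omega>. (u x)\<^sup>2) = 0" by linarith
  then have "AE x in lebesgue_on \<Omega>. (u x)\<^sup>2 = 0"
    using sobolev_space_L2[OF u] by (subst (asm) integral_nonneg_eq_0_iff_AE) (auto simp: L2_space_def)
  then show ?thesis by simp
qed

lemma sobolev_norm_1_AE_0: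
  assumes u: "u \<in> L2_space \<Omega>" and "AE x in lebesgue_on \<Omega>. u x = 0"
  shows "sobolev_norm 1 \<Omega> u = 0"
proof -
  have z: "(\<lambda>x. 0) \<in> L2_space \<Omega>" by (simp add: L2_space_def)
  have "(sobolev_norm 1 \<Omega> u)\<^sup>2 = (LINT x|lebesgue_on \<Omega>. (u x)\<^sup>2) + (\<Sum>i\<in>(UNIV :: 'd set). LINT x|lebesgue_on \<Omega>. 0\<^sup>2)"
    using assms z by (intro sobolev_norm_1_sq has_weak_deriv_AE_0 L2_locally_integrable)
  moreover have "(LINT x|lebesgue_on \<Omega>. (u x)\<^sup>2) = 0"
    by (intro integral_eq_zero_AE eventually_mono[OF assms(2)]) simp
  ultimately show ?thesis by simp
qed

section \<open>The closure of the test functions in the first-order space\<close>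

lemma H01_sobolev: "u \<in> H01 \<Omega> \<Longrightarrow> u \<in> sobolev_space 1 \<Omega>"
  unfolding H01_def by blast

lemma test_function_sobolev_1: "test_function \<Omega> \<phi> \<Longrightarrow> \<phi> \<in> sobolev_space 1 \<Omega>"
  unfolding sobolev_space_1_iff using has_weak_deriv_test test_function_L2 test_function_partial by blast

lemma H01_approx:
  assumes "u \<in> H01 \<Omega>" "\<epsilon> > 0"
  obtains \<phi> where "test_function \<Omega> \<phi>" "sobolev_norm 1 \<Omega> (\<lambda>x. u x - \<phi> x) < \<epsilon>"
  using assms unfolding H01_def by blast

lemma H01_lincomb:
  assumes u: "u \<in> H01 \<Omega>" and v: "v \<in> H01 \<Omega>"
  shows "(\<lambda>x. s * u x + t * v x) \<in> H01 \<Omega>"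
proof -
  have "\<exists>\<phi>. test_function \<Omega> \<phi> \<and> sobolev_norm 1 \<Omega> (\<lambda>x. s * u x + t * v x - \<phi> x) < \<epsilon>" if \<epsilon>: "\<epsilon> > 0" for \<epsilon>
  proof -
    \<comment> \<open>Chosen to make 2 s^2 + 2 t^2 strictly smaller than r^2, also for s = t = 0, so
      that approximations up to \<epsilon> / r are good enough.\<close>
    define r where "r = 2 * (\<bar>s\<bar> + \<bar>t\<bar> + 1)"
    have r: "r > 0" by (simp add: r_def)
    obtain \<phi> where \<phi>: "test_function \<Omega> \<phi>" "sobolev_norm 1 \<Omega> (\<lambda>x. u x - \<phi> x) < \<epsilon> / r"
      using H01_approx[OF u, of "\<epsilon> / r"] \<epsilon> r by auto
    obtain \<psi> where \<psi>: "test_function \<Omega> \<psi>" "sobolev_norm 1 \<Omega> (\<lambda>x. v x - \<psi> x) < \<epsilon> / r"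
      using H01_approx[OF v, of "\<epsilon> / r"] \<epsilon> r by auto
    have "(\<lambda>x. 1 * u x + (- 1) * \<phi> x) \<in> sobolev_space 1 \<Omega>" "(\<lambda>x. 1 * v x + (- 1) * \<psi> x) \<in> sobolev_space 1 \<Omega>"
      using u v \<phi> \<psi> by (intro sobolev_space_lincomb H01_sobolev test_function_sobolev_1; simp)+
    then have H1: "(\<lambda>x. u x - \<phi> x) \<in> sobolev_space 1 \<Omega>" "(\<lambda>x. v x - \<psi> x) \<in> sobolev_space 1 \<Omega>" by simp_all
    have "(sobolev_norm 1 \<Omega> (\<lambda>x. s * (u x - \<phi> x) + t * (v x - \<psi> x)))\<^sup>2
      \<le> 2 * s\<^sup>2 * (sobolev_norm 1 \<Omega> (\<lambda>x. u x - \<phi> x))\<^sup>2 + 2 * t\<^sup>2 * (sobolev_norm 1 \<Omega> (\<lambda>x. v x - \<psi> x))\<^sup>2"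
      by (rule sobolev_norm_1_lincomb_le[OF H1])
    also have "\<dots> \<le> 2 * s\<^sup>2 * (\<epsilon> / r)\<^sup>2 + 2 * t\<^sup>2 * (\<epsilon> / r)\<^sup>2"
      using \<phi>(2) \<psi>(2) sobolev_norm_nonneg by (intro add_mono mult_left_mono power_mono) auto
    also have "\<dots> = (2 * s\<^sup>2 + 2 * t\<^sup>2) * (\<epsilon> / r)\<^sup>2" by (simp add: distrib_right)
    also have "\<dots> < r\<^sup>2 * (\<epsilon> / r)\<^sup>2"
    proof (rule mult_strict_right_mono)
      have "2 * p\<^sup>2 + 2 * q\<^sup>2 < (2 * (p + q + 1))\<^sup>2" if "p \<ge> 0" "q \<ge> 0" for p q :: real
      proof -
        have "(2 * (p + q + 1))\<^sup>2 = 4 * p\<^sup>2 + 4 * q\<^sup>2 + 8 * (p * q) + 8 * p + 8 * q + 4"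
          by (simp add: power2_eq_square algebra_simps)
        moreover have "0 \<le> p\<^sup>2" "0 \<le> q\<^sup>2" "0 \<le> p * q" using that by simp_all
        ultimately show ?thesis using that by linarith
      qed
      from this[of "\<bar>s\<bar>" "\<bar>t\<bar>"] show "2 * s\<^sup>2 + 2 * t\<^sup>2 < r\<^sup>2" by (simp add: r_def)
      show "0 < (\<epsilon> / r)\<^sup>2" using \<epsilon> r by simp
    qed
    also have "\<dots> = \<epsilon>\<^sup>2" using r by (simp add: power_divide)
    finally have "sobolev_norm 1 \<Omega> (\<lambda>x. s * (u x - \<phi> x) + t * (v x - \<psi> x)) < \<epsilon>"
      using \<epsilon> by (rule power2_less_imp_less[OF _ less_imp_le])
    then have "sobolev_norm 1 \<Omega> (\<lambda>x. s * u x + t * v x - (s * \<phi> x + t * \<psi> x)) < \<epsilon>"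
      by (simp add: algebra_simps)
    then show ?thesis using test_function_lincomb[OF \<phi>(1) \<psi>(1)] by blast
  qed
  moreover have "(\<lambda>x. s * u x + t * v x) \<in> sobolev_space 1 \<Omega>"
    using u v by (intro sobolev_space_lincomb H01_sobolev)
  ultimately show ?thesis unfolding H01_def by blast
qed

lemma H01_diff: "u \<in> H01 \<Omega> \<Longrightarrow> v \<in> H01 \<Omega> \<Longrightarrow> (\<lambda>x. u x - v x) \<in> H01 \<Omega>"
  using H01_lincomb[of u v 1 "- 1"] by simp

text \<open>Multiplication by g is bounded in the first-order norm and maps test functions to test
  functions, so approximants of u times g approximate the product.\<close>

lemma H01_mult:
  assumes u: "u \<in> H01 \<Omega>" and g: "smooth_on_closure \<Omega> g"
  shows "(\<lambda>x. u x * g x) \<in> H01 \<Omega>"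
proof -
  obtain M0 where M0: "\<And>x. x \<in> \<Omega> \<Longrightarrow> \<bar>g x\<bar> \<le> M0" "\<And>x i. x \<in> \<Omega> \<Longrightarrow> \<bar>partial_deriv i g x\<bar> \<le> M0"
    using smooth_on_closure_bounded[OF g] by metis
  \<comment> \<open>Enlarged to be positive, since \<epsilon> is divided by a multiple of M.\<close>
  define M where "M = \<bar>M0\<bar> + 1"
  have "M0 \<le> M" "M > 0" by (auto simp: M_def)
  then have M: "M > 0" "\<And>x. x \<in> \<Omega> \<Longrightarrow> \<bar>g x\<bar> \<le> M" "\<And>x i. x \<in> \<Omega> \<Longrightarrow> \<bar>partial_deriv i g x\<bar> \<le> M"
    using M0 order_trans by blast+
  define r where "r = sqrt (2 + 2 * real CARD('d)) * M"
  have r: "r > 0" unfolding r_def using M(1) by simp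
  have "\<exists>\<phi>. test_function \<Omega> \<phi> \<and> sobolev_norm 1 \<Omega> (\<lambda>x. u x * g x - \<phi> x) < \<epsilon>" if \<epsilon>: "\<epsilon> > 0" for \<epsilon>
  proof -
    obtain \<phi> where \<phi>: "test_function \<Omega> \<phi>" "sobolev_norm 1 \<Omega> (\<lambda>x. u x - \<phi> x) < \<epsilon> / r"
      using H01_approx[OF u, of "\<epsilon> / r"] \<epsilon> r by auto
    have "(\<lambda>x. 1 * u x + (- 1) * \<phi> x) \<in> sobolev_space 1 \<Omega>"
      using u \<phi> by (intro sobolev_space_lincomb H01_sobolev test_function_sobolev_1)
    then have "(\<lambda>x. u x - \<phi> x) \<in> sobolev_space 1 \<Omega>" by simp
    then have "sobolev_norm 1 \<Omega> (\<lambda>x. (u x - \<phi> x) * g x) \<le> r * sobolev_norm 1 \<Omega> (\<lambda>x. u x - \<phi> x)"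
      unfolding r_def using g M by (intro sobolev_norm_1_mult_le) auto
    also have "\<dots> < \<epsilon>" using \<phi>(2) r by (simp add: field_simps)
    finally have "sobolev_norm 1 \<Omega> (\<lambda>x. u x * g x - \<phi> x * g x) < \<epsilon>" by (simp add: algebra_simps)
    then show ?thesis
      using test_function_mult[OF open_\<Omega> \<phi>(1) smooth_on_closure_smooth_in[OF g]] by blast
  qed
  moreover have "(\<lambda>x. u x * g x) \<in> sobolev_space 1 \<Omega>"
    using u g by (intro sobolev_space_mult H01_sobolev)
  ultimately show ?thesis unfolding H01_def by blast
qed

section \<open>The weak gradient and the bilinear form\<close>

lemma weak_grad_lincomb_AE:
  assumes "u \<in> sobolev_space 1 \<Omega>" "v \<in> sobolev_space 1 \<Omega>"
  shows "AE x in lebesgue_on \<Omega>. weak_grad \<Omega> (\<lambda>x. s * u x + t * v x) x = s *\<^sub>R weak_grad \<Omega> u x + t *\<^sub>R weak_grad \<Omega> v x"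
proof -
  have "AE x in lebesgue_on \<Omega>. s * weak_deriv \<Omega> (unit_mi i) u x + t * weak_deriv \<Omega> (unit_mi i) v x
      = weak_deriv \<Omega> (unit_mi i) (\<lambda>x. s * u x + t * v x) x" for i
    using assms by (intro weak_deriv_AE_eq has_weak_deriv_lincomb has_weak_deriv_H1)
  then have "AE x in lebesgue_on \<Omega>. \<forall>i. s * weak_deriv \<Omega> (unit_mi i) u x + t * weak_deriv \<Omega> (unit_mi i) v x
      = weak_deriv \<Omega> (unit_mi i) (\<lambda>x. s * u x + t * v x) x"
    by (rule eventually_all_finite)
  then show ?thesis
    by (rule eventually_mono) (simp add: weak_grad_def vec_eq_iff)
qed

lemma bform_commute: "bform \<Omega> a c u v = bform \<Omega> a c v u"
  unfolding bform_def weak_integrand_def by (simp add: inner_commute mult.left_commute mult.commute)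

text \<open>The integrands agree only almost everywhere. Integrability is a hypothesis for each of
  them because nothing is assumed about the coefficients a and c by themselves.\<close>

lemma bform_lincomb:
  assumes H1: "u \<in> sobolev_space 1 \<Omega>" "v \<in> sobolev_space 1 \<Omega>"
    and int: "integrable (lebesgue_on \<Omega>) (weak_integrand \<Omega> a c u w)" "integrable (lebesgue_on \<Omega>) (weak_integrand \<Omega> a c v w)"
      "integrable (lebesgue_on \<Omega>) (weak_integrand \<Omega> a c (\<lambda>x. s * u x + t * v x) w)"
  shows "bform \<Omega> a c (\<lambda>x. s * u x + t * v x) w = s * bform \<Omega> a c u w + t * bform \<Omega> a c v w"
proof -
  have "bform \<Omega> a c (\<lambda>x. s * u x + t * v x) w
    = (LINT x|lebesgue_on \<Omega>. s * weak_integrand \<Omega> a c u w x + t * weak_integrand \<Omega> a c v w x)"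
    unfolding bform_def
  proof (rule integral_cong_AE)
    show "AE x in lebesgue_on \<Omega>. weak_integrand \<Omega> a c (\<lambda>x. s * u x + t * v x) w x
        = s * weak_integrand \<Omega> a c u w x + t * weak_integrand \<Omega> a c v w x"
      using weak_grad_lincomb_AE[OF H1, of s t]
      by (rule eventually_mono) (simp add: weak_integrand_def inner_add_left algebra_simps)
  qed (use int in auto)
  also have "\<dots> = s * bform \<Omega> a c u w + t * bform \<Omega> a c v w"
    unfolding bform_def using int by simp
  finally show ?thesis .
qed

lemma C1_norm_ge:
  assumes g: "smooth_on_closure \<Omega> g" and x: "x \<in> \<Omega>"
  shows "\<bar>g x\<bar> \<le> C1_norm \<Omega> g" "\<bar>partial_deriv i g x\<bar> \<le> C1_norm \<Omega> g"
proof -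
  obtain M where M: "\<And>x. x \<in> \<Omega> \<Longrightarrow> \<bar>g x\<bar> \<le> M" "\<And>x i. x \<in> \<Omega> \<Longrightarrow> \<bar>partial_deriv i g x\<bar> \<le> M"
    using smooth_on_closure_bounded[OF g] by metis
  have "\<bar>g x\<bar> \<le> (SUP x\<in>\<Omega>. \<bar>g x\<bar>)"
    using x M(1) by (intro cSUP_upper bdd_aboveI2)
  also have "\<dots> \<le> C1_norm \<Omega> g" unfolding C1_norm_def by (intro Max_ge) auto
  finally show "\<bar>g x\<bar> \<le> C1_norm \<Omega> g" .
  have "\<bar>partial_deriv i g x\<bar> \<le> (SUP x\<in>\<Omega>. \<bar>partial_deriv i g x\<bar>)"
    using x M(2) by (intro cSUP_upper bdd_aboveI2)
  also have "\<dots> \<le> C1_norm \<Omega> g" unfolding C1_norm_def by (intro Max_ge) auto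
  finally show "\<bar>partial_deriv i g x\<bar> \<le> C1_norm \<Omega> g" .
qed

end

subsection \<open>Galerkin approximation\<close>

text \<open>Nothing but nonnegativity and the two bounds is asked of \<open>N\<close>; in the
  application it vanishes at null functions. The absolute value in the coercivity admits negative
  forms.\<close>

locale coercive_form =
  fixes V :: "('x \<Rightarrow> real) set" and B :: "('x \<Rightarrow> real) \<Rightarrow> ('x \<Rightarrow> real) \<Rightarrow> real"
    and N :: "('x \<Rightarrow> real) \<Rightarrow> real" and \<alpha> \<beta> :: real
  assumes V_lincomb: "u \<in> V \<Longrightarrow> v \<in> V \<Longrightarrow> (\<lambda>x. s * u x + t * v x) \<in> V"
    and B_lincomb: "u \<in> V \<Longrightarrow> v \<in> V \<Longrightarrow> w \<in> V \<Longrightarrow> B (\<lambda>x. s * u x + t * v x) w = s * B u w + t * B v w"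
    and B_commute: "u \<in> V \<Longrightarrow> v \<in> V \<Longrightarrow> B u v = B v u"
    and B_bounded: "u \<in> V \<Longrightarrow> v \<in> V \<Longrightarrow> \<bar>B u v\<bar> \<le> \<alpha> * N u * N v"
    and B_coercive: "u \<in> V \<Longrightarrow> \<beta> * (N u)\<^sup>2 \<le> \<bar>B u u\<bar>"
    and N_nonneg: "0 \<le> N u" and \<alpha>: "\<alpha> > 0" and \<beta>: "\<beta> > 0"
begin

lemma B_lincomb_right:
  assumes "u \<in> V" "v \<in> V" "w \<in> V"
  shows "B w (\<lambda>x. s * u x + t * v x) = s * B w u + t * B w v"
  unfolding B_commute[OF assms(3) V_lincomb[OF assms(1,2)]] B_commute[OF assms(3,1)] B_commute[OF assms(3,2)]
  using assms by (rule B_lincomb)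

text \<open>Null elements lie in the kernel of the form; this replaces the passage to a quotient
  space.\<close>

lemma B_eq_0_of_null: "u \<in> V \<Longrightarrow> v \<in> V \<Longrightarrow> N u = 0 \<or> N v = 0 \<Longrightarrow> B u v = 0"
  using B_bounded[of u v] by auto

lemma null_of_B_eq_0:
  assumes "u \<in> V" "B u u = 0"
  shows "N u = 0"
proof -
  have "\<beta> * (N u)\<^sup>2 \<le> 0" using B_coercive[OF assms(1)] assms(2) by simp
  then have "(N u)\<^sup>2 \<le> 0" using \<beta> by (simp add: mult_le_0_iff)
  then show ?thesis by simp
qed

text \<open>The finite-dimensional subspace consists of the first components of \<open>G\<close>, each paired with its
  coefficients; the coefficients need only determine the function up to \<open>N\<close>, that is almost
  everywhere in the application.  Each induction step is a Gram-Schmidt step.\<close>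

lemma galerkin_exists:
  fixes G :: "(('x \<Rightarrow> real) \<times> ('j \<Rightarrow> real)) set"
  assumes "finite J" "fst ` G \<subseteq> V" "((\<lambda>_. 0), (\<lambda>_. 0)) \<in> G"
    and "\<And>u c v e s t. (u, c) \<in> G \<Longrightarrow> (v, e) \<in> G \<Longrightarrow> ((\<lambda>x. s * u x + t * v x), (\<lambda>j. s * c j + t * e j)) \<in> G"
    and "\<And>u c. (u, c) \<in> G \<Longrightarrow> (\<And>j. j \<in> J \<Longrightarrow> c j = 0) \<Longrightarrow> N u = 0"
    and "\<And>u v s t. u \<in> V \<Longrightarrow> v \<in> V \<Longrightarrow> F (\<lambda>x. s * u x + t * v x) = s * F u + t * F v"
    and "\<And>v. v \<in> V \<Longrightarrow> \<bar>F v\<bar> \<le> M * N v"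
  shows "\<exists>u\<in>fst ` G. \<forall>v\<in>fst ` G. B u v = F v"
  using assms
proof (induction J arbitrary: G F M rule: finite_induct)
  case empty
  \<comment> \<open>With no coefficients left all members are null, form and functional vanish on
    them, and the zero function is a solution.\<close>
  have null: "N v = 0" if "v \<in> fst ` G" for v using that empty.prems(4) by auto
  have "B (\<lambda>_. 0) v = F v" if v: "v \<in> fst ` G" for v
  proof -
    have "B (\<lambda>_. 0) v = 0" using empty.prems(1,2) v null by (intro B_eq_0_of_null) auto
    moreover have "F v = 0" using empty.prems(1,6) v null[OF v] by fastforce
    ultimately show ?thesis by simp
  qed
  then show ?case using empty.prems(2) by force
next
  case (insert j J)
  note GV = insert.prems(1) and G0 = insert.prems(2) and Glin = insert.prems(3) and Gnull = insert.prems(4)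
    and Flin = insert.prems(5) and Fbd = insert.prems(6)
  have inV: "u \<in> V" if "(u, c) \<in> G" for u c using GV that by force
  define G' where "G' = {p \<in> G. snd p j = 0}"
  \<comment> \<open>Stated for an arbitrary bounded functional because it is used twice: for F, and
    for the form with first argument w1.\<close>
  have step: "\<exists>u\<in>fst ` G'. \<forall>v\<in>fst ` G'. B u v = H v"
    if "\<And>u v s t. u \<in> V \<Longrightarrow> v \<in> V \<Longrightarrow> H (\<lambda>x. s * u x + t * v x) = s * H u + t * H v"
      "\<And>v. v \<in> V \<Longrightarrow> \<bar>H v\<bar> \<le> L * N v" for H L
  proof (rule insert.IH)
    show "N u = 0" if "(u, c) \<in> G'" "\<And>i. i \<in> J \<Longrightarrow> c i = 0" for u c
      using Gnull[of u c] that by (auto simp: G'_def)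
  qed (use GV G0 Glin that in \<open>auto simp: G'_def\<close>)
  show ?case
  proof (cases "G' = G")
    case True
    show ?thesis by (rule step[OF Flin Fbd, unfolded True])
  next
    case False
    then obtain w1 c1 where w1: "(w1, c1) \<in> G" "c1 j \<noteq> 0" unfolding G'_def by force
    have solve: "\<exists>u cu. (u, cu) \<in> G' \<and> (\<forall>v c. (v, c) \<in> G' \<longrightarrow> B u v = H v)"
      if H: "\<exists>u\<in>fst ` G'. \<forall>v\<in>fst ` G'. B u v = H v" for H
    proof -
      obtain p where p: "p \<in> G'" "\<forall>v\<in>fst ` G'. B (fst p) v = H v" using H by blast
      have "B (fst p) v = H v" if "(v, c) \<in> G'" for v c
        using bspec[OF p(2) imageI[OF that]] by simp
      then show ?thesis using p(1) by (intro exI[of _ "fst p"] exI[of _ "snd p"]) simp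
    qed
    obtain u cu where u: "(u, cu) \<in> G'" "\<And>v c. (v, c) \<in> G' \<Longrightarrow> B u v = F v"
      using solve[OF step[OF Flin Fbd]] by blast
    \<comment> \<open>p is the projection of w1 onto the smaller space with respect to the form, so
      that q = w1 - p is orthogonal to that space; as p has coefficient 0 at j, q keeps the nonzero
      coefficient of w1.\<close>
    have "\<exists>p\<in>fst ` G'. \<forall>v\<in>fst ` G'. B p v = B w1 v"
      by (rule step[where L = "\<alpha> * N w1"]) (simp_all add: B_lincomb_right B_bounded inV[OF w1(1)])
    from solve[OF this] obtain p cp where p: "(p, cp) \<in> G'" "\<And>v c. (v, c) \<in> G' \<Longrightarrow> B p v = B w1 v"
      by blast
    have uG: "(u, cu) \<in> G" "cu j = 0" and pG: "(p, cp) \<in> G" "cp j = 0"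
      using u(1) p(1) by (auto simp: G'_def)
    define q where "q = (\<lambda>x. 1 * w1 x + (- 1) * p x)"
    define cq where "cq = (\<lambda>j. 1 * c1 j + (- 1) * cp j)"
    have qG: "(q, cq) \<in> G" unfolding q_def cq_def using Glin[OF w1(1) pG(1)] .
    have cq: "cq j \<noteq> 0" using w1 pG by (simp add: cq_def)
    note uV = inV[OF uG(1)] and qV = inV[OF qG]
    have orth: "B q v = 0" if v: "(v, c) \<in> G'" for v c
    proof -
      have "v \<in> V" using v inV by (auto simp: G'_def)
      then have "B q v = 1 * B w1 v + (- 1) * B p v"
        unfolding q_def using inV[OF w1(1)] inV[OF pG(1)] by (intro B_lincomb)
      then show ?thesis using p(2)[OF v] by simp
    qed
    have uq: "B u q = 0" using orth[OF u(1)] B_commute uV qV by simp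
    have decomp: "\<exists>v t. (\<exists>c. (v, c) \<in> G') \<and> v \<in> V \<and> w = (\<lambda>x. 1 * v x + t * q x)" if w: "(w, c) \<in> G" for w c
    proof -
      \<comment> \<open>The multiple of q whose removal from w makes the coefficient at j
        vanish.\<close>
      define t where "t = c j / cq j"
      define v where "v = (\<lambda>x. 1 * w x + (- t) * q x)"
      have vG: "(v, \<lambda>j. 1 * c j + (- t) * cq j) \<in> G" unfolding v_def using Glin[OF w qG] .
      then have "(v, \<lambda>j. 1 * c j + (- t) * cq j) \<in> G'" using cq by (simp add: G'_def t_def)
      moreover have "w = (\<lambda>x. 1 * v x + t * q x)" by (simp add: v_def)
      ultimately show ?thesis using inV[OF vG] by blast
    qed
    show ?thesis
    proof (cases "B q q = 0")
      case True
      \<comment> \<open>In the degenerate case the new direction is null and imposes no further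
        condition, so u already solves the larger problem.\<close>
      then have Nq: "N q = 0" using null_of_B_eq_0 qV by blast
      then have Fq: "F q = 0" using Fbd[OF qV] by simp
      have "B u w = F w" if wG: "(w, c) \<in> G" for w c
      proof -
        obtain v t e where v: "(v, e) \<in> G'" "v \<in> V" and w: "w = (\<lambda>x. 1 * v x + t * q x)"
          using decomp[OF wG] by blast
        show ?thesis
          unfolding w B_lincomb_right[OF v(2) qV uV] Flin[OF v(2) qV] using u(2)[OF v(1)] uq Fq by simp
      qed
      then show ?thesis using uG(1) by force
    next
      case False
      \<comment> \<open>As u is orthogonal to q, this is the condition B u' q = F q solved for s;
        the equations on the smaller space are unaffected because q is orthogonal to it.\<close>
      define s where "s = F q / B q q"
      define u' where "u' = (\<lambda>x. 1 * u x + s * q x)"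
      have u'G: "(u', \<lambda>j. 1 * cu j + s * cq j) \<in> G" unfolding u'_def using Glin[OF uG(1) qG] .
      have "B u' w = F w" if wG: "(w, c) \<in> G" for w c
      proof -
        obtain v t e where v: "(v, e) \<in> G'" "v \<in> V" and w: "w = (\<lambda>x. 1 * v x + t * q x)"
          using decomp[OF wG] by blast
        have "B u' v = F v" "B u' q = F q"
          unfolding u'_def B_lincomb[OF uV qV v(2)] B_lincomb[OF uV qV qV]
          using u(2)[OF v(1)] orth[OF v(1)] uq False by (simp_all add: s_def)
        then show ?thesis
          unfolding w B_lincomb_right[OF v(2) qV inV[OF u'G]] Flin[OF v(2) qV] by simp
      qed
      then show ?thesis using u'G by force
    qed
  qed
qed

lemma galerkin_unique:
  assumes W: "W \<subseteq> V" "\<And>u v s t. u \<in> W \<Longrightarrow> v \<in> W \<Longrightarrow> (\<lambda>x. s * u x + t * v x) \<in> W"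
    and uv: "u \<in> W" "v \<in> W" "\<And>w. w \<in> W \<Longrightarrow> B u w = B v w"
  shows "N (\<lambda>x. u x - v x) = 0"
proof -
  let ?e = "\<lambda>x. 1 * u x + (- 1) * v x"
  have e: "?e \<in> W" using W(2)[OF uv(1,2)] .
  then have "B ?e ?e = 1 * B u ?e + (- 1) * B v ?e" using uv W(1) by (intro B_lincomb) auto
  then have "B ?e ?e = 0" using uv(3)[OF e] by simp
  then have "N ?e = 0" using e W(1) by (intro null_of_B_eq_0) auto
  then show ?thesis by simp
qed

lemma cea:
  assumes W: "W \<subseteq> V" and u: "u \<in> V" and uh: "u\<^sub>h \<in> W" "\<And>w. w \<in> W \<Longrightarrow> B u w = B u\<^sub>h w" and v: "v \<in> W"
  shows "N (\<lambda>x. u x - u\<^sub>h x) \<le> \<alpha> / \<beta> * N (\<lambda>x. u x - v x)"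
proof -
  have vV: "v \<in> V" and uhV: "u\<^sub>h \<in> V" using v uh(1) W by auto
  let ?e = "\<lambda>x. 1 * u x + (- 1) * u\<^sub>h x" and ?d = "\<lambda>x. 1 * u x + (- 1) * v x"
  have eV: "?e \<in> V" and dV: "?d \<in> V" using u uhV vV V_lincomb by blast+
  have orth: "B ?e w = 0" if "w \<in> W" for w
    using B_lincomb[OF u uhV, of w 1 "- 1"] uh(2)[OF that] that W by auto
  \<comment> \<open>The second arguments differ from u by a member of W, to which the error is
    orthogonal.\<close>
  have "B ?e ?e = B ?e u" "B ?e ?d = B ?e u"
    using B_lincomb_right[OF u uhV eV, of 1 "- 1"] B_lincomb_right[OF u vV eV, of 1 "- 1"] orth[OF uh(1)] orth[OF v] by simp_all
  then have "\<beta> * (N ?e)\<^sup>2 \<le> \<alpha> * N ?e * N ?d"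
    using B_coercive[OF eV] B_bounded[OF eV dV] by simp
  then have "N ?e * (\<beta> * N ?e) \<le> N ?e * (\<alpha> * N ?d)" by (simp add: power2_eq_square algebra_simps)
  then have "\<beta> * N ?e \<le> \<alpha> * N ?d"
    using N_nonneg[of ?e] N_nonneg[of ?d] \<alpha> by (cases "N ?e = 0") auto
  then have "N ?e \<le> \<alpha> / \<beta> * N ?d" using \<beta> by (simp add: field_simps)
  then show ?thesis by simp
qed

end

section \<open>Finite element functions and their coefficients\<close>

lemma fe_space_H01: "w \<in> fe_space \<Omega> k \<T> \<Longrightarrow> w \<in> H01 \<Omega>"
  unfolding fe_space_def by blast

definition mi_poly :: "nat \<Rightarrow> ('d::finite multi_index \<Rightarrow> real) \<Rightarrow> real ^ 'd \<Rightarrow> real" where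
  "mi_poly k c x = (\<Sum>\<alpha> | mi_order \<alpha> \<le> k. c \<alpha> * (\<Prod>i\<in>UNIV. (x $ i) ^ \<alpha> i))"

lemma mi_poly_lincomb: "mi_poly k (\<lambda>\<alpha>. s * c \<alpha> + t * e \<alpha>) x = s * mi_poly k c x + t * mi_poly k e x"
  by (simp add: mi_poly_def sum.distrib sum_distrib_left algebra_simps)

text \<open>Collects the polynomial coefficients of all elements into one function on pairs of an
  element and a multi-index: the finite index set required by
  \<open>galerkin_exists\<close>.\<close>

lemma fe_space_iff:
  "w \<in> fe_space \<Omega> k \<T> \<longleftrightarrow> w \<in> H01 \<Omega> \<and>
     (\<exists>c. \<forall>K\<in>\<T>. AE x in lebesgue_on \<Omega>. x \<in> K \<longrightarrow> w x = mi_poly k (\<lambda>\<alpha>. c (K, \<alpha>)) x)"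
proof -
  have poly: "poly_fun_le k p \<longleftrightarrow> (\<exists>c. p = mi_poly k c)" for p :: "real ^ 'a \<Rightarrow> real"
    by (simp add: poly_fun_le_def mi_poly_def fun_eq_iff)
  show ?thesis
  proof
    assume w: "w \<in> fe_space \<Omega> k \<T>"
    then have "\<forall>K\<in>\<T>. \<exists>c. AE x in lebesgue_on \<Omega>. x \<in> K \<longrightarrow> w x = mi_poly k c x"
      unfolding fe_space_def poly by blast
    from bchoice[OF this] obtain c where "\<forall>K\<in>\<T>. AE x in lebesgue_on \<Omega>. x \<in> K \<longrightarrow> w x = mi_poly k (c K) x"
      by blast
    then have "\<forall>K\<in>\<T>. AE x in lebesgue_on \<Omega>. x \<in> K \<longrightarrow> w x = mi_poly k (\<lambda>\<alpha>. (\<lambda>(K, \<alpha>). c K \<alpha>) (K, \<alpha>)) x" by simp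
    then show "w \<in> H01 \<Omega> \<and> (\<exists>c. \<forall>K\<in>\<T>. AE x in lebesgue_on \<Omega>. x \<in> K \<longrightarrow> w x = mi_poly k (\<lambda>\<alpha>. c (K, \<alpha>)) x)"
      using fe_space_H01[OF w] by blast
  next
    assume "w \<in> H01 \<Omega> \<and> (\<exists>c. \<forall>K\<in>\<T>. AE x in lebesgue_on \<Omega>. x \<in> K \<longrightarrow> w x = mi_poly k (\<lambda>\<alpha>. c (K, \<alpha>)) x)"
    then show "w \<in> fe_space \<Omega> k \<T>" unfolding fe_space_def poly by blast
  qed
qed

locale elliptic_form = bounded_open \<Omega> for \<Omega> :: "(real ^ 'd::finite) set" +
  fixes a c :: "real ^ 'd \<Rightarrow> real" and \<alpha> \<beta> :: real
  assumes integrand: "\<And>u v. u \<in> H01 \<Omega> \<Longrightarrow> v \<in> H01 \<Omega> \<Longrightarrow>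
            integrable (lebesgue_on \<Omega>) (weak_integrand \<Omega> a c u v)"
    and pos: "\<alpha> > 0" "\<beta> > 0"
    and continuous: "\<And>u v. u \<in> H01 \<Omega> \<Longrightarrow> v \<in> H01 \<Omega> \<Longrightarrow>
            \<bar>bform \<Omega> a c u v\<bar> \<le> \<alpha> * sobolev_norm 1 \<Omega> u * sobolev_norm 1 \<Omega> v"
    and coercive: "\<And>u. u \<in> H01 \<Omega> \<Longrightarrow> \<beta> * (sobolev_norm 1 \<Omega> u)\<^sup>2 \<le> \<bar>bform \<Omega> a c u u\<bar>"
begin

sublocale coercive_form "H01 \<Omega>" "bform \<Omega> a c" "sobolev_norm 1 \<Omega>" \<alpha> \<beta>
proof
  show "bform \<Omega> a c (\<lambda>x. s * u x + t * v x) w = s * bform \<Omega> a c u w + t * bform \<Omega> a c v w"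
    if "u \<in> H01 \<Omega>" "v \<in> H01 \<Omega>" "w \<in> H01 \<Omega>" for u v w s t
    using that by (intro bform_lincomb integrand H01_sobolev H01_lincomb)
qed (rule H01_lincomb bform_commute continuous coercive sobolev_norm_nonneg pos; assumption)+

text \<open>A relation and not a coefficient map, because values of e outside the relevant index set
  are unconstrained; linearity of the relation is what the Galerkin argument asks for.\<close>

definition fe_coeffs ::
    "nat \<Rightarrow> (real ^ 'd) set set \<Rightarrow> (real ^ 'd \<Rightarrow> real) \<Rightarrow> ((real ^ 'd) set \<times> 'd multi_index \<Rightarrow> real) \<Rightarrow> bool" where
  "fe_coeffs k \<T> w e \<longleftrightarrow> w \<in> H01 \<Omega> \<and>
     (\<forall>K\<in>\<T>. AE x in lebesgue_on \<Omega>. x \<in> K \<longrightarrow> w x = mi_poly k (\<lambda>\<alpha>. e (K, \<alpha>)) x)"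

lemma fe_space_iff_coeffs: "w \<in> fe_space \<Omega> k \<T> \<longleftrightarrow> (\<exists>e. fe_coeffs k \<T> w e)"
  unfolding fe_space_iff fe_coeffs_def by blast

lemma fe_coeffs_lincomb:
  assumes "fe_coeffs k \<T> w e" "fe_coeffs k \<T> w' e'"
  shows "fe_coeffs k \<T> (\<lambda>x. s * w x + t * w' x) (\<lambda>j. s * e j + t * e' j)"
proof -
  have "AE x in lebesgue_on \<Omega>. x \<in> K \<longrightarrow> s * w x + t * w' x = mi_poly k (\<lambda>\<alpha>. s * e (K, \<alpha>) + t * e' (K, \<alpha>)) x"
    if K: "K \<in> \<T>" for K
  proof -
    have "AE x in lebesgue_on \<Omega>. x \<in> K \<longrightarrow> w x = mi_poly k (\<lambda>\<alpha>. e (K, \<alpha>)) x"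
      "AE x in lebesgue_on \<Omega>. x \<in> K \<longrightarrow> w' x = mi_poly k (\<lambda>\<alpha>. e' (K, \<alpha>)) x"
      using assms K unfolding fe_coeffs_def by blast+
    then show ?thesis by (rule eventually_elim2) (simp add: mi_poly_lincomb)
  qed
  moreover have "(\<lambda>x. s * w x + t * w' x) \<in> H01 \<Omega>"
    using assms unfolding fe_coeffs_def by (intro H01_lincomb) blast+
  ultimately show ?thesis unfolding fe_coeffs_def by blast
qed

lemma fe_space_lincomb:
  "w \<in> fe_space \<Omega> k \<T> \<Longrightarrow> w' \<in> fe_space \<Omega> k \<T> \<Longrightarrow> (\<lambda>x. s * w x + t * w' x) \<in> fe_space \<Omega> k \<T>"
  unfolding fe_space_iff_coeffs using fe_coeffs_lincomb by blast

lemma variational_solution_exists: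
  assumes \<T>: "subdivision \<Omega> \<T>" and g: "smooth_on_closure \<Omega> g"
    and f: "\<And>v. v \<in> H01 \<Omega> \<Longrightarrow> integrable (lebesgue_on \<Omega>) (\<lambda>x. f x * v x)"
    and M: "\<And>v. v \<in> H01 \<Omega> \<Longrightarrow> \<bar>load \<Omega> f v\<bar> \<le> M * sobolev_norm 1 \<Omega> v"
    and zero: "(\<lambda>x. 0) \<in> H01 \<Omega>"
  shows "\<exists>u. variational_solution (bform \<Omega> a c) (load \<Omega> f) {\<lambda>x. w x * g x | w. w \<in> fe_space \<Omega> k \<T>} u"
proof -
  define G where "G = {(\<lambda>x. w x * g x, e) | w e. fe_coeffs k \<T> w e}"
  have fin: "finite \<T>" and cover: "\<Omega> \<subseteq> \<Union>\<T>"
    using \<T> closure_subset unfolding subdivision_def by auto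
  have fstG: "fst ` G = {\<lambda>x. w x * g x | w. w \<in> fe_space \<Omega> k \<T>}"
    unfolding G_def fe_space_iff_coeffs by (auto simp: image_iff) blast
  have "\<exists>u\<in>fst ` G. \<forall>v\<in>fst ` G. bform \<Omega> a c u v = load \<Omega> f v"
  proof (rule galerkin_exists)
    show "finite (\<T> \<times> {\<alpha> :: 'd multi_index. mi_order \<alpha> \<le> k})"
      using fin finite_mi_order_le by blast
    show "fst ` G \<subseteq> H01 \<Omega>" unfolding fstG using H01_mult[OF fe_space_H01 g] by blast
    have "fe_coeffs k \<T> (\<lambda>_. 0) (\<lambda>_. 0)" unfolding fe_coeffs_def using zero by (simp add: mi_poly_def)
    then show "(\<lambda>_. 0, \<lambda>_. 0) \<in> G" unfolding G_def by force
    show "(\<lambda>x. s * u x + t * v x, \<lambda>j. s * e j + t * e' j) \<in> G" if uv: "(u, e) \<in> G" "(v, e') \<in> G" for u e v e' s t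
    proof -
      obtain w w' where w: "fe_coeffs k \<T> w e" "fe_coeffs k \<T> w' e'" "u = (\<lambda>x. w x * g x)" "v = (\<lambda>x. w' x * g x)"
        using uv unfolding G_def by blast
      then have "(\<lambda>x. s * u x + t * v x) = (\<lambda>x. (s * w x + t * w' x) * g x)" by (simp add: algebra_simps)
      then show ?thesis
        unfolding G_def
        by (intro CollectI exI[of _ "\<lambda>x. s * w x + t * w' x"] exI[of _ "\<lambda>j. s * e j + t * e' j"] conjI
            fe_coeffs_lincomb[OF w(1,2)]) simp
    qed
    show "sobolev_norm 1 \<Omega> u = 0"
      if uG: "(u, e) \<in> G" and e: "\<And>j. j \<in> \<T> \<times> {\<alpha>. mi_order \<alpha> \<le> k} \<Longrightarrow> e j = 0" for u e
    proof -
      obtain w where w: "fe_coeffs k \<T> w e" "u = (\<lambda>x. w x * g x)" using uG unfolding G_def by blast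
      have "AE x in lebesgue_on \<Omega>. x \<in> K \<longrightarrow> w x = 0" if K: "K \<in> \<T>" for K
      proof -
        have "mi_poly k (\<lambda>\<alpha>. e (K, \<alpha>)) x = 0" for x
          unfolding mi_poly_def using e K by (intro sum.neutral) auto
        moreover have "AE x in lebesgue_on \<Omega>. x \<in> K \<longrightarrow> w x = mi_poly k (\<lambda>\<alpha>. e (K, \<alpha>)) x"
          using w(1) K unfolding fe_coeffs_def by blast
        ultimately show ?thesis by simp
      qed
      \<comment> \<open>There are finitely many elements, and they cover \<Omega>, so vanishing
        coefficients force w to vanish almost everywhere.\<close>
      then have "AE x in lebesgue_on \<Omega>. \<forall>K\<in>\<T>. x \<in> K \<longrightarrow> w x = 0"
        by (subst AE_finite_all[OF fin]) blast
      moreover have "AE x in lebesgue_on \<Omega>. x \<in> \<Omega>" by (rule AE_I2) simp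
      ultimately have "AE x in lebesgue_on \<Omega>. u x = 0"
        by (rule eventually_elim2) (use cover w(2) in auto)
      moreover have "u \<in> L2_space \<Omega>"
        using w sobolev_space_L2[OF H01_sobolev[OF H01_mult[OF _ g]]] unfolding fe_coeffs_def by blast
      ultimately show ?thesis by (intro sobolev_norm_1_AE_0)
    qed
    show "load \<Omega> f (\<lambda>x. s * u x + t * v x) = s * load \<Omega> f u + t * load \<Omega> f v"
      if "u \<in> H01 \<Omega>" "v \<in> H01 \<Omega>" for u v s t
    proof -
      have "(\<lambda>x. f x * (s * u x + t * v x)) = (\<lambda>x. s * (f x * u x) + t * (f x * v x))"
        by (simp add: algebra_simps)
      then show ?thesis unfolding load_def using f that by simp
    qed
    show "\<bar>load \<Omega> f v\<bar> \<le> M * sobolev_norm 1 \<Omega> v" if "v \<in> H01 \<Omega>" for v using M[OF that] .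
  qed
  then show ?thesis unfolding variational_solution_def fstG by blast
qed

end

section \<open>The error estimate for the modified finite element space\<close>

theorem theorem4p5:
  fixes \<Omega> :: "(real ^ 'd::finite) set"
    and a c :: "real ^ 'd \<Rightarrow> real"
    and m k :: nat
    and \<alpha> \<beta> C0 :: real
    and mesh_sizes :: "real set"
    and \<T> :: "real \<Rightarrow> (real ^ 'd) set set"
    and \<I> :: "real \<Rightarrow> (real ^ 'd \<Rightarrow> real) \<Rightarrow> real ^ 'd \<Rightarrow> real"
  assumes domain: "open \<Omega>" "connected \<Omega>" "bounded \<Omega>" "\<Omega> \<noteq> {}"
    and m: "m \<ge> 2"
    and B_defined: "\<And>u v. u \<in> H01 \<Omega> \<Longrightarrow> v \<in> H01 \<Omega> \<Longrightarrow>
            integrable (lebesgue_on \<Omega>) (weak_integrand \<Omega> a c u v)"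
    and constants: "\<alpha> > 0" "\<beta> > 0"
    and B_continuous: "\<And>u v. u \<in> H01 \<Omega> \<Longrightarrow> v \<in> H01 \<Omega> \<Longrightarrow>
            \<bar>bform \<Omega> a c u v\<bar> \<le> \<alpha> * sobolev_norm 1 \<Omega> u * sobolev_norm 1 \<Omega> v"
    and B_coercive: "\<And>u. u \<in> H01 \<Omega> \<Longrightarrow> \<beta> * (sobolev_norm 1 \<Omega> u)\<^sup>2 \<le> \<bar>bform \<Omega> a c u u\<bar>"
    and mesh: "\<And>h. h \<in> mesh_sizes \<Longrightarrow> h > 0 \<and> subdivision \<Omega> (\<T> h)"
    and interp: "\<And>h v. h \<in> mesh_sizes \<Longrightarrow> v \<in> sobolev_space m \<Omega> \<inter> H01 \<Omega> \<Longrightarrow>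
            \<I> h v \<in> fe_space \<Omega> k (\<T> h)"
    and approx: "\<And>h v. h \<in> mesh_sizes \<Longrightarrow> v \<in> sobolev_space m \<Omega> \<inter> H01 \<Omega> \<Longrightarrow>
            sobolev_norm 1 \<Omega> (\<lambda>x. v x - \<I> h v x) \<le> C0 * h ^ (m - 1) * sobolev_seminorm m \<Omega> v"
  shows "\<exists>C>0. \<forall>h\<in>mesh_sizes. \<forall>u\<^sub>\<theta> f u.
           smooth_on_closure \<Omega> u\<^sub>\<theta> \<longrightarrow> (\<forall>x\<in>closure \<Omega>. u\<^sub>\<theta> x \<noteq> 0) \<longrightarrow>
           (\<forall>v\<in>H01 \<Omega>. integrable (lebesgue_on \<Omega>) (\<lambda>x. f x * v x)) \<longrightarrow>
           (\<exists>M. \<forall>v\<in>H01 \<Omega>. \<bar>load \<Omega> f v\<bar> \<le> M * sobolev_norm 1 \<Omega> v) \<longrightarrow>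
           u \<in> sobolev_space m \<Omega> \<longrightarrow>
           variational_solution (bform \<Omega> a c) (load \<Omega> f) (H01 \<Omega>) u \<longrightarrow>
           (let V\<^sub>h_star = {\<lambda>x. w x * u\<^sub>\<theta> x | w. w \<in> fe_space \<Omega> k (\<T> h)};
                solution = variational_solution (bform \<Omega> a c) (load \<Omega> f) V\<^sub>h_star
            in (\<exists>u\<^sub>h. solution u\<^sub>h \<and>
                  (\<forall>w. solution w \<longrightarrow> (AE x in lebesgue_on \<Omega>. w x = u\<^sub>h x)) \<and>
                  sobolev_norm 1 \<Omega> (\<lambda>x. u x - u\<^sub>h x)
                    \<le> C * h ^ (m - 1) * C1_norm \<Omega> u\<^sub>\<theta> * sobolev_seminorm m \<Omega> (\<lambda>x. u x / u\<^sub>\<theta> x)))"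
proof -
  interpret elliptic_form \<Omega> a c \<alpha> \<beta>
    using domain(1,3) B_defined constants B_continuous B_coercive by unfold_locales auto
  define D where "D = sqrt (2 + 2 * real CARD('d))"
  \<comment> \<open>The factors come from Cea's lemma, from multiplication by the weight and from
    interpolation. C0 has no prescribed sign, and |C0| + 1 keeps the product positive.\<close>
  define C where "C = \<alpha> / \<beta> * D * (\<bar>C0\<bar> + 1)"
  have D: "D > 0" by (simp add: D_def)
  then have C: "C > 0" unfolding C_def using constants by simp
  show ?thesis
  proof (intro exI[of _ C] conjI C ballI allI impI, unfold Let_def)
    fix h g f u
    assume h: "h \<in> mesh_sizes" and g: "smooth_on_closure \<Omega> g" "\<forall>x\<in>closure \<Omega>. g x \<noteq> 0"
      and f: "\<forall>v\<in>H01 \<Omega>. integrable (lebesgue_on \<Omega>) (\<lambda>x. f x * v x)"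
      and "\<exists>M. \<forall>v\<in>H01 \<Omega>. \<bar>load \<Omega> f v\<bar> \<le> M * sobolev_norm 1 \<Omega> v"
      and um: "u \<in> sobolev_space m \<Omega>"
      and sol: "variational_solution (bform \<Omega> a c) (load \<Omega> f) (H01 \<Omega>) u"
    then obtain M where M: "\<forall>v\<in>H01 \<Omega>. \<bar>load \<Omega> f v\<bar> \<le> M * sobolev_norm 1 \<Omega> v" by blast
    let ?W = "{\<lambda>x. w x * g x | w. w \<in> fe_space \<Omega> k (\<T> h)}"
    let ?solution = "variational_solution (bform \<Omega> a c) (load \<Omega> f) ?W"
    have h0: "h > 0" and \<T>: "subdivision \<Omega> (\<T> h)" using mesh[OF h] by auto
    have u: "u \<in> H01 \<Omega>" using sol unfolding variational_solution_def by blast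
    have WV: "?W \<subseteq> H01 \<Omega>" using H01_mult[OF fe_space_H01 g(1)] by blast
    have Wlin: "(\<lambda>x. s * v x + t * w x) \<in> ?W" if vw: "v \<in> ?W" "w \<in> ?W" for v w s t
    proof -
      obtain v' w' where v': "v = (\<lambda>x. v' x * g x)" "v' \<in> fe_space \<Omega> k (\<T> h)"
        and w': "w = (\<lambda>x. w' x * g x)" "w' \<in> fe_space \<Omega> k (\<T> h)" using vw by blast
      have "(\<lambda>x. s * v x + t * w x) = (\<lambda>x. (s * v' x + t * w' x) * g x)"
        by (simp add: v' w' algebra_simps)
      then show ?thesis
        by (intro CollectI exI[of _ "\<lambda>x. s * v' x + t * w' x"] conjI fe_space_lincomb v'(2) w'(2))
    qed
    have "(\<lambda>x. 0) \<in> H01 \<Omega>" using H01_lincomb[OF u u, of 0 0] by simp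
    then obtain u\<^sub>h where u\<^sub>h: "?solution u\<^sub>h"
      using variational_solution_exists[OF \<T> g(1), of f M k] f M by blast
    have uniq: "AE x in lebesgue_on \<Omega>. w x = u\<^sub>h x" if w: "?solution w" for w
    proof -
      have W: "w \<in> ?W" "u\<^sub>h \<in> ?W" using w u\<^sub>h unfolding variational_solution_def by blast+
      have "sobolev_norm 1 \<Omega> (\<lambda>x. w x - u\<^sub>h x) = 0"
      proof (rule galerkin_unique[OF WV _ W])
        show "bform \<Omega> a c w v = bform \<Omega> a c u\<^sub>h v" if "v \<in> ?W" for v
          using w u\<^sub>h that unfolding variational_solution_def by simp
      qed (rule Wlin)
      then have "AE x in lebesgue_on \<Omega>. w x - u\<^sub>h x = 0"
        using W WV by (intro sobolev_norm_1_eq_0_AE H01_sobolev H01_diff) auto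
      then show ?thesis by simp
    qed
    define z where "z = (\<lambda>x. u x / g x)"
    have ig: "smooth_on_closure \<Omega> (\<lambda>x. inverse (g x))"
      using smooth_on_closure_inverse[OF domain(1) g(1)] g(2) by blast
    have z: "z \<in> sobolev_space m \<Omega> \<inter> H01 \<Omega>"
      unfolding z_def divide_inverse using sobolev_space_mult[OF um ig] H01_mult[OF u ig] by blast
    define d where "d = (\<lambda>x. z x - \<I> h z x)"
    have d: "d \<in> H01 \<Omega>" unfolding d_def using z fe_space_H01[OF interp[OF h z]] by (intro H01_diff) auto
    have Ih: "(\<lambda>x. \<I> h z x * g x) \<in> ?W" using interp[OF h z] by blast
    \<comment> \<open>A point of the domain is needed because the suprema in \<open>C1_norm\<close>
      are known to be nonnegative only over a nonempty set.\<close>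
    obtain x0 where "x0 \<in> \<Omega>" using domain(4) by blast
    then have C1: "C1_norm \<Omega> g \<ge> 0" using C1_norm_ge(1)[OF g(1), of x0] by linarith
    \<comment> \<open>Dividing by g and multiplying back recovers u where g is nonzero, thus on all
      of \<Omega>, and the norm depends on no other values.\<close>
    have "sobolev_norm 1 \<Omega> (\<lambda>x. u x - \<I> h z x * g x) = sobolev_norm 1 \<Omega> (\<lambda>x. d x * g x)"
      using g(2) closure_subset[of \<Omega>]
      by (intro sobolev_norm_cong) (auto simp: d_def z_def left_diff_distrib)
    also have "\<dots> \<le> D * C1_norm \<Omega> g * sobolev_norm 1 \<Omega> d"
      unfolding D_def using C1 C1_norm_ge[OF g(1)] d by (intro sobolev_norm_1_mult_le g(1) H01_sobolev)
    also have "\<dots> \<le> D * C1_norm \<Omega> g * ((\<bar>C0\<bar> + 1) * h ^ (m - 1) * sobolev_seminorm m \<Omega> z)"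
    proof (rule mult_left_mono)
      have "sobolev_norm 1 \<Omega> d \<le> C0 * h ^ (m - 1) * sobolev_seminorm m \<Omega> z"
        unfolding d_def by (rule approx[OF h z])
      also have "\<dots> \<le> (\<bar>C0\<bar> + 1) * h ^ (m - 1) * sobolev_seminorm m \<Omega> z"
        using h0 sobolev_seminorm_nonneg by (intro mult_right_mono) auto
      finally show "sobolev_norm 1 \<Omega> d \<le> (\<bar>C0\<bar> + 1) * h ^ (m - 1) * sobolev_seminorm m \<Omega> z" .
      show "0 \<le> D * C1_norm \<Omega> g" using D C1 by simp
    qed
    finally have best: "sobolev_norm 1 \<Omega> (\<lambda>x. u x - \<I> h z x * g x)
      \<le> D * C1_norm \<Omega> g * ((\<bar>C0\<bar> + 1) * h ^ (m - 1) * sobolev_seminorm m \<Omega> z)" .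
    have "sobolev_norm 1 \<Omega> (\<lambda>x. u x - u\<^sub>h x) \<le> \<alpha> / \<beta> * sobolev_norm 1 \<Omega> (\<lambda>x. u x - \<I> h z x * g x)"
    proof (rule cea[OF WV u _ _ Ih])
      show "u\<^sub>h \<in> ?W" "\<And>w. w \<in> ?W \<Longrightarrow> bform \<Omega> a c u w = bform \<Omega> a c u\<^sub>h w"
        using sol u\<^sub>h WV unfolding variational_solution_def by (simp_all add: subset_eq)
    qed
    also have "\<dots> \<le> \<alpha> / \<beta> * (D * C1_norm \<Omega> g * ((\<bar>C0\<bar> + 1) * h ^ (m - 1) * sobolev_seminorm m \<Omega> z))"
      using best constants by (intro mult_left_mono) auto
    also have "\<dots> = C * h ^ (m - 1) * C1_norm \<Omega> g * sobolev_seminorm m \<Omega> (\<lambda>x. u x / g x)"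
      by (simp add: C_def z_def)
    finally have est: "sobolev_norm 1 \<Omega> (\<lambda>x. u x - u\<^sub>h x)
      \<le> C * h ^ (m - 1) * C1_norm \<Omega> g * sobolev_seminorm m \<Omega> (\<lambda>x. u x / g x)" .
    show "\<exists>u\<^sub>h. ?solution u\<^sub>h \<and> (\<forall>w. ?solution w \<longrightarrow> (AE x in lebesgue_on \<Omega>. w x = u\<^sub>h x)) \<and>
        sobolev_norm 1 \<Omega> (\<lambda>x. u x - u\<^sub>h x) \<le> C * h ^ (m - 1) * C1_norm \<Omega> g * sobolev_seminorm m \<Omega> (\<lambda>x. u x / g x)"
      using u\<^sub>h uniq est by blast
  qed
qed

end
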